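(* Let $[\mathbf{T},\mathbf{o}]$ be a unimodular ordered Eternal Family Tree such that (a.s.) $\mathbf{T}$ has a unique succession line. Then there exists a stationary sequence $Y=(Y_n)_{n\in\mathbb{Z}}$ of random variables taking values in $\{-1,0,1,2,\dots\}$ such that $[\mathbf{T},\mathbf{o}]\overset{\mathcal{D}}{=}[\mathbb{Z}^R_Y(0),0]$, where $\mathbb{Z}^R_Y(0)$ is the component of $0$ in the record graph $\mathbb{Z}^R_Y$ of $(\mathbb{Z},Y)$. In particular, if $[\mathbf{T},\mathbf{o}]$ is of class $\mathcal{I}/\mathcal{I}$, then such a stationary sequence $Y$ exists.
   Context: **Family Trees.** A Family Tree is a locally finite directed tree in which each vertex has out-degree at most $1$; it is an Eternal Family Tree (EFT) if every vertex has out-degree exactly $1$. $F(v)$ denotes the parent of $v$ (endpoint of its outgoing edge). It is ordered if the children of each vertex are totally ordered by $<$. Rooted (doubly rooted) ordered Family Trees are considered up to order- and root(s)-preserving isomorphism, with the local topology. A random rooted ordered EFT $[\mathbf{T},\mathbf{o}]$ is unimodular if $\mathbb{E}\big[\sum_{u\in V(\mathbf{T})}g([\mathbf{T},\mathbf{o},u])\big]=\mathbb{E}\big[\sum_{u\in V(\mathbf{T})}g([\mathbf{T},u,\mathbf{o}])\big]$ for every non-negative measurable function $g$ of doubly rooted ordered Family Trees. It is of class $\mathcal{I}/\mathcal{I}$ if it is infinite and each foil $\{v:F^n(v)=F^n(u)\text{ for some }n\ge0\}$ is infinite (for unimodular EFTs, known to be equivalent to every vertex having finitely many descendants and there being no bi-infinite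 directed path). **RLS order and succession lines.** On an ordered Family Tree, write $u\prec v$ if either $v=F^k(u)$ for some $k>0$, or $u,v$ have a common ancestor $w=F^m(u)=F^n(v)$, with $m,n$ smallest positive such integers, and $F^{m-1}(u)<F^{n-1}(v)$. Put $b(u)=\max\{v:v\prec u\}$ and $a(u)=\min\{v:v\succ u\}$ (with respect to $\prec$) when they exist. The succession line passing through $u$ is the sequence $(u_n)_{n\in\mathbb{Z}}$ with $u_0=u$; for $n<0$, $u_n=b(u_{n+1})$ if it exists and $u_n=u_{n+1}$ otherwise; for $n>0$, $u_n=a(u_{n-1})$ if it exists and $u_n=u_{n-1}$ otherwise. The set $\{u_n:n\in\mathbb{Z}\}$ is also called the succession line of $u$; $T$ has a unique succession line if these sets coincide for all $u\in V(T)$. **Record graph.** For an integer-valued sequence $y$ the record map is $R_y(i)=\inf\{j>i:\sum_{l=i}^{j-1}y_l\ge 0\}$ if the infimum exists and $R_y(i)=i$ otherwise. The record graph $\mathbb{Z}^R_y$ is the directed graph on $\mathbb{Z}$ with edges $(i,R_y(i))$ for all $i$ with $R_y(i)\ne i$, with the children of each vertex ordered as integers. *)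

theory Defs
  imports "HOL-Probability.Probability"
begin

section \<open>Ordered Family Trees\<close>

text \<open>The relation \<open>lt\<close> is only meaningful between children of a common vertex; its values on other
  pairs are ignored by every notion below.\<close>

record 'v odigraph =
  verts :: "'v set"
  arcs :: "('v \<times> 'v) set"
  lt :: "'v \<Rightarrow> 'v \<Rightarrow> bool"

definition children :: "'v odigraph \<Rightarrow> 'v \<Rightarrow> 'v set" where
  "children T w = {u. (u, w) \<in> arcs T}"

definition adj :: "'v odigraph \<Rightarrow> ('v \<times> 'v) set" where
  "adj T = arcs T \<union> (arcs T)\<inverse>"

definition restrict_verts :: "'v odigraph \<Rightarrow> 'v set \<Rightarrow> 'v odigraph" where
  "restrict_verts T W = \<lparr>verts = verts T \<inter> W, arcs = arcs T \<inter> W \<times> W, lt = lt T\<rparr>"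

definition component :: "'v odigraph \<Rightarrow> 'v \<Rightarrow> 'v odigraph" where
  "component T v = restrict_verts T {w. (v, w) \<in> (adj T)\<^sup>*}"

definition simple_path :: "'v odigraph \<Rightarrow> 'v \<Rightarrow> 'v list \<Rightarrow> 'v \<Rightarrow> bool" where
  "simple_path T u p v \<longleftrightarrow>
     p \<noteq> [] \<and> hd p = u \<and> last p = v \<and> distinct p \<and> successively (\<lambda>x y. (x, y) \<in> adj T) p"

text \<open>An orientation of an undirected tree. Asymmetry of the arcs excludes loops and pairs of
  opposite arcs, which simple paths do not detect.\<close>

definition directed_tree :: "'v odigraph \<Rightarrow> bool" where
  "directed_tree T \<longleftrightarrow>
     verts T \<noteq> {} \<and> arcs T \<subseteq> verts T \<times> verts T \<and> asym (arcs T) \<and>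
     (\<forall>u\<in>verts T. \<forall>v\<in>verts T. \<exists>!p. simple_path T u p v)"

definition family_tree :: "'v odigraph \<Rightarrow> bool" where
  "family_tree T \<longleftrightarrow>
     directed_tree T \<and>
     (\<forall>v\<in>verts T. finite {u. (v, u) \<in> adj T}) \<and>
     (\<forall>u v w. (u, v) \<in> arcs T \<longrightarrow> (u, w) \<in> arcs T \<longrightarrow> v = w)"

definition ordered_family_tree :: "'v odigraph \<Rightarrow> bool" where
  "ordered_family_tree T \<longleftrightarrow>
     family_tree T \<and>
     (\<forall>w\<in>verts T. irreflp_on (children T w) (lt T) \<and> transp_on (children T w) (lt T) \<and>
        totalp_on (children T w) (lt T))"

definition ordered_EFT :: "'v odigraph \<Rightarrow> bool" where
  "ordered_EFT T \<longleftrightarrow> ordered_family_tree T \<and> (\<forall>v\<in>verts T. \<exists>!w. (v, w) \<in> arcs T)"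

text \<open>The parent map \<open>F\<close> is the partial function whose graph is \<open>arcs T\<close>; its iterates are
  written as relation powers, that is, \<open>F\<^sup>n(u) = w\<close> is \<open>(u, w) \<in> arcs T ^^ n\<close>.\<close>

definition foil :: "'v odigraph \<Rightarrow> 'v \<Rightarrow> 'v set" where
  "foil T u = {v \<in> verts T. \<exists>n w. (v, w) \<in> arcs T ^^ n \<and> (u, w) \<in> arcs T ^^ n}"

definition class_I_I :: "'v odigraph \<Rightarrow> bool" where
  "class_I_I T \<longleftrightarrow> infinite (verts T) \<and> (\<forall>u\<in>verts T. infinite (foil T u))"


section \<open>RLS order and succession lines\<close>

definition meet_times :: "'v odigraph \<Rightarrow> 'v \<Rightarrow> 'v \<Rightarrow> nat \<Rightarrow> nat \<Rightarrow> bool" where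
  "meet_times T u v m n \<longleftrightarrow> 0 < m \<and> 0 < n \<and> (\<exists>w. (u, w) \<in> arcs T ^^ m \<and> (v, w) \<in> arcs T ^^ n)"

definition rls_less :: "'v odigraph \<Rightarrow> 'v \<Rightarrow> 'v \<Rightarrow> bool" where
  "rls_less T u v \<longleftrightarrow>
     u \<in> verts T \<and> v \<in> verts T \<and>
     ((\<exists>k>0. (u, v) \<in> arcs T ^^ k) \<or>
      (\<exists>m n u' v'. meet_times T u v m n \<and>
         (\<forall>m' n'. meet_times T u v m' n' \<longrightarrow> m \<le> m' \<and> n \<le> n') \<and>
         (u, u') \<in> arcs T ^^ (m - 1) \<and> (v, v') \<in> arcs T ^^ (n - 1) \<and> lt T u' v'))"

definition is_rls_before :: "'v odigraph \<Rightarrow> 'v \<Rightarrow> 'v \<Rightarrow> bool" where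
  "is_rls_before T u b \<longleftrightarrow>
     rls_less T b u \<and> (\<forall>v. rls_less T v u \<longrightarrow> v = b \<or> rls_less T v b)"

definition is_rls_after :: "'v odigraph \<Rightarrow> 'v \<Rightarrow> 'v \<Rightarrow> bool" where
  "is_rls_after T u a \<longleftrightarrow>
     rls_less T u a \<and> (\<forall>v. rls_less T u v \<longrightarrow> v = a \<or> rls_less T a v)"

definition rls_prev :: "'v odigraph \<Rightarrow> 'v \<Rightarrow> 'v" where
  "rls_prev T u = (if \<exists>b. is_rls_before T u b then (THE b. is_rls_before T u b) else u)"

definition rls_next :: "'v odigraph \<Rightarrow> 'v \<Rightarrow> 'v" where
  "rls_next T u = (if \<exists>a. is_rls_after T u a then (THE a. is_rls_after T u a) else u)"

definition succession_line :: "'v odigraph \<Rightarrow> 'v \<Rightarrow> int \<Rightarrow> 'v" where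
  "succession_line T u n =
     (if 0 \<le> n then (rls_next T ^^ nat n) u else (rls_prev T ^^ nat (- n)) u)"

definition unique_succession_line :: "'v odigraph \<Rightarrow> bool" where
  "unique_succession_line T \<longleftrightarrow>
     (\<forall>u\<in>verts T. \<forall>v\<in>verts T. range (succession_line T u) = range (succession_line T v))"


section \<open>The record graph\<close>

definition record_map :: "(int \<Rightarrow> int) \<Rightarrow> int \<Rightarrow> int" where
  "record_map y i =
     (if \<exists>j>i. 0 \<le> (\<Sum>l\<in>{i..j - 1}. y l) then Inf {j. i < j \<and> 0 \<le> (\<Sum>l\<in>{i..j - 1}. y l)} else i)"

definition record_graph :: "(int \<Rightarrow> int) \<Rightarrow> int odigraph" where
  "record_graph y =
     \<lparr>verts = UNIV, arcs = {(i, record_map y i) | i. record_map y i \<noteq> i}, lt = (<)\<rparr>"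


section \<open>Isomorphism classes and the local topology\<close>

text \<open>Rooted and doubly rooted trees are pairs of a tree and a list of roots of length 1 and 2,
  respectively.\<close>

definition odigraph_iso :: "('v \<Rightarrow> 'w) \<Rightarrow> 'v odigraph \<Rightarrow> 'w odigraph \<Rightarrow> bool" where
  "odigraph_iso f S T \<longleftrightarrow>
     bij_betw f (verts S) (verts T) \<and>
     (\<forall>u\<in>verts S. \<forall>v\<in>verts S. (u, v) \<in> arcs S \<longleftrightarrow> (f u, f v) \<in> arcs T) \<and>
     (\<forall>w\<in>verts S. \<forall>u\<in>children S w. \<forall>v\<in>children S w. lt S u v \<longleftrightarrow> lt T (f u) (f v))"

definition rooted_iso :: "'v odigraph \<Rightarrow> 'v list \<Rightarrow> 'w odigraph \<Rightarrow> 'w list \<Rightarrow> bool" where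
  "rooted_iso S os T ps \<longleftrightarrow> (\<exists>f. odigraph_iso f S T \<and> map f os = ps)"

text \<open>Connected locally finite graphs are countable, so every tree has an isomorphic copy with
  vertices in \<open>nat\<close>; the class of a tree over any vertex type is the set of these copies.\<close>

type_synonym tree_class = "(nat odigraph \<times> nat list) set"

definition tree_class :: "'v odigraph \<Rightarrow> 'v list \<Rightarrow> tree_class" where
  "tree_class T os = {(S, ps). ordered_family_tree S \<and> set ps \<subseteq> verts S \<and> rooted_iso T os S ps}"

definition tree_classes :: "nat \<Rightarrow> tree_class set" where
  "tree_classes k =
     {tree_class T os | (T :: nat odigraph) os.
        ordered_family_tree T \<and> set os \<subseteq> verts T \<and> length os = k}"

definition root_ball :: "'v odigraph \<Rightarrow> 'v list \<Rightarrow> nat \<Rightarrow> 'v odigraph" where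
  "root_ball T os r = restrict_verts T {v. \<exists>p\<in>set os. \<exists>n\<le>r. (p, v) \<in> adj T ^^ n}"

definition local_nbhd :: "nat \<Rightarrow> nat odigraph \<Rightarrow> nat list \<Rightarrow> nat \<Rightarrow> tree_class set" where
  "local_nbhd k T os r =
     {C \<in> tree_classes k. \<exists>(S, ps)\<in>C. rooted_iso (root_ball T os r) os (root_ball S ps r) ps}"

definition local_topology :: "nat \<Rightarrow> tree_class topology" where
  "local_topology k =
     topology_generated_by
       {local_nbhd k T os r | T os r.
          ordered_family_tree T \<and> set os \<subseteq> verts T \<and> length os = k}"

definition tree_space :: "nat \<Rightarrow> tree_class measure" where
  "tree_space k = sigma (tree_classes k) {U. openin (local_topology k) U}"

abbreviation rooted_trees :: "tree_class measure" where
  "rooted_trees \<equiv> tree_space 1"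

abbreviation doubly_rooted_trees :: "tree_class measure" where
  "doubly_rooted_trees \<equiv> tree_space 2"

text \<open>An isomorphism-invariant property of trees, read off a class.\<close>

definition holds_for :: "(nat odigraph \<Rightarrow> bool) \<Rightarrow> tree_class \<Rightarrow> bool" where
  "holds_for P C \<longleftrightarrow> (\<forall>(T, os)\<in>C. P T)"


section \<open>Random rooted trees\<close>

definition random_rooted_ordered_EFT :: "'w measure \<Rightarrow> ('w \<Rightarrow> tree_class) \<Rightarrow> bool" where
  "random_rooted_ordered_EFT M X \<longleftrightarrow>
     prob_space M \<and> X \<in> measurable M rooted_trees \<and> (AE \<omega> in M. holds_for ordered_EFT (X \<omega>))"

text \<open>The sum of \<open>h T o u\<close> over all vertices \<open>u\<close>, for an arbitrary representative \<open>(T, [o])\<close> of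
  the class; below it is only used for functions \<open>h\<close> invariant under isomorphism.\<close>

definition vertex_sum ::
  "(nat odigraph \<Rightarrow> nat \<Rightarrow> nat \<Rightarrow> ennreal) \<Rightarrow> tree_class \<Rightarrow> ennreal" where
  "vertex_sum h C =
     (case (SOME R. R \<in> C) of (T, os) \<Rightarrow> \<integral>\<^sup>+ u. h T (hd os) u \<partial>count_space (verts T))"

definition unimodular :: "'w measure \<Rightarrow> ('w \<Rightarrow> tree_class) \<Rightarrow> bool" where
  "unimodular M X \<longleftrightarrow>
     (\<forall>g \<in> borel_measurable doubly_rooted_trees.
        (\<integral>\<^sup>+ \<omega>. vertex_sum (\<lambda>T p u. g (tree_class T [p, u])) (X \<omega>) \<partial>M) =
        (\<integral>\<^sup>+ \<omega>. vertex_sum (\<lambda>T p u. g (tree_class T [u, p])) (X \<omega>) \<partial>M))"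

definition stationary_sequence :: "'w measure \<Rightarrow> (int \<Rightarrow> 'w \<Rightarrow> int) \<Rightarrow> bool" where
  "stationary_sequence M Y \<longleftrightarrow>
     prob_space M \<and> (\<forall>n. Y n \<in> measurable M (count_space UNIV)) \<and>
     (\<forall>k. distr M (\<Pi>\<^sub>M n\<in>UNIV. count_space UNIV) (\<lambda>\<omega> n. Y (n + k) \<omega>) =
          distr M (\<Pi>\<^sub>M n\<in>UNIV. count_space UNIV) (\<lambda>\<omega> n. Y n \<omega>))"

definition eq_in_distribution ::
  "'s measure \<Rightarrow> 'w measure \<Rightarrow> ('w \<Rightarrow> 's) \<Rightarrow> 'u measure \<Rightarrow> ('u \<Rightarrow> 's) \<Rightarrow> bool" where
  "eq_in_distribution S M X N Z \<longleftrightarrow>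
     X \<in> measurable M S \<and> Z \<in> measurable N S \<and> distr M S X = distr N S Z"

definition record_tree :: "(int \<Rightarrow> int) \<Rightarrow> tree_class" where
  "record_tree y = tree_class (component (record_graph y) 0) [0]"

end

theory Submission
  imports Defs
begin

text \<open>
  The RLS order of an ordered Eternal Family Tree is a strict total order. If all its intervals are
  finite, then its covering relation is given by a local rule (a last child is followed by its
  parent, any other vertex by the first leaf below its next sibling), and the tree is isomorphic to
  the record graph of \<open>Y n = #children (u (n + 1)) - 1\<close> along the succession line \<open>u\<close>: the partial
  sums of \<open>Y\<close> are the differences of the number of left siblings along the ancestral line, so that
  the first nonnegative sum started at \<open>i\<close> occurs at the parent of \<open>u i\<close>. Mass transport along
  \<open>u 0 \<mapsto> u k\<close> shows that the succession line is almost surely bi-infinite and that \<open>Y\<close> is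
  stationary. In class I/I, transporting mass from a vertex to its \<open>n\<close>-th ancestor shows that
  \<open>o\<close> has an \<open>n\<close>-th descendant with probability \<open>E[1/c\<^sub>n]\<close>, where \<open>c\<^sub>n\<close> counts the vertices with the
  same \<open>n\<close>-th ancestor as \<open>o\<close>; this tends to \<open>0\<close>, hence all descendant trees are finite and the
  intervals of the RLS order are finite.
\<close>

section \<open>The RLS order is a strict total order\<close>

text \<open>Both hypotheses are used only through one consequence, finiteness of the intervals of
  the RLS order, so a single argument serves both claims. Finite intervals alone do not give a
  bi-infinite line: in the ray with arcs from \<open>n\<close> to \<open>n + 1\<close> all
  succession lines have the same range, yet \<open>0\<close> has no predecessor. Unimodularity has
  to exclude this.

  The obstacle is measurability. \<open>rls_next\<close> is an extremum over an infinite tree, which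
  no finite ball decides as it stands. The rule \<open>succ_rel\<close> replaces it: each of its
  instances is certified by finitely many vertices, hence persists in all trees that agree on a
  large enough ball. Such properties define open sets of classes and are automatically invariant
  under isomorphism, which yields the measurable invariant functions that mass transport needs.

  The index shift in \<open>Y\<close> comes from the record map: the sum from \<open>i\<close> to
  \<open>j - 1\<close> has to collect the vertices met after leaving \<open>u i\<close>, up to and
  including \<open>u j\<close>, so \<open>Y n\<close> belongs to \<open>u (n + 1)\<close>.\<close>

lemma single_valued_relpow:
  fixes r :: "('a \<times> 'a) set"
  assumes "single_valued r" "(x, y) \<in> r ^^ n" "(x, z) \<in> r ^^ n"
  shows "y = z"
  using assms(2,3)
proof (induction n arbitrary: y z)
  case (Suc n)
  then obtain y' z' where "(x, y') \<in> r ^^ n" "(y', y) \<in> r" "(x, z') \<in> r ^^ n" "(z', z) \<in> r"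
    by auto
  then show ?case
    using Suc.IH assms(1) by (metis single_valuedD)
qed auto

lemma single_valued_relpow_diff:
  fixes r :: "('a \<times> 'a) set"
  assumes "single_valued r" "(x, y) \<in> r ^^ m" "(x, z) \<in> r ^^ n" "m \<le> n"
  shows "(y, z) \<in> r ^^ (n - m)"
proof -
  have "(x, z) \<in> r ^^ m O r ^^ (n - m)"
    using assms(3,4) by (metis le_add_diff_inverse relpow_add)
  then show ?thesis
    using single_valued_relpow[OF assms(1,2)] by auto
qed

locale ordered_tree =
  fixes T :: "'v odigraph"
  assumes oft: "ordered_family_tree T"
begin

lemma ft: "family_tree T" and dt: "directed_tree T"
  using oft by (auto simp: ordered_family_tree_def family_tree_def)

lemma arcs_verts: "(u, v) \<in> arcs T \<Longrightarrow> u \<in> verts T \<and> v \<in> verts T"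
  using dt by (auto simp: directed_tree_def)

lemma sv: "single_valued (arcs T)"
  using ft by (auto simp: family_tree_def single_valued_def)

lemma finite_children: "finite (children T w)"
proof (cases "w \<in> verts T")
  case True
  then have "finite {u. (w, u) \<in> adj T}"
    using ft by (auto simp: family_tree_def)
  then show ?thesis
    by (rule rev_finite_subset) (auto simp: children_def adj_def)
next
  case False
  then have "children T w = {}"
    using arcs_verts by (auto simp: children_def)
  then show ?thesis by simp
qed

lemma lt_irrefl: "(u, w) \<in> arcs T \<Longrightarrow> \<not> lt T u u"
  using oft arcs_verts by (force simp: ordered_family_tree_def irreflp_on_def children_def)

lemma lt_trans:
  "\<lbrakk>(a, w) \<in> arcs T; (b, w) \<in> arcs T; (c, w) \<in> arcs T; lt T a b; lt T b c\<rbrakk> \<Longrightarrow> lt T a c"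
  using oft arcs_verts unfolding ordered_family_tree_def transp_on_def children_def by blast

lemma lt_total:
  "\<lbrakk>(a, w) \<in> arcs T; (b, w) \<in> arcs T; a \<noteq> b\<rbrakk> \<Longrightarrow> lt T a b \<or> lt T b a"
  using oft arcs_verts unfolding ordered_family_tree_def totalp_on_def children_def by blast

lemma rtrancl_verts: "(u, v) \<in> (arcs T)\<^sup>* \<Longrightarrow> u \<in> verts T \<longleftrightarrow> v \<in> verts T"
  by (induction rule: rtrancl_induct) (auto dest: arcs_verts)

lemma trancl_verts: "(u, v) \<in> (arcs T)\<^sup>+ \<Longrightarrow> u \<in> verts T \<and> v \<in> verts T"
  by (induction rule: trancl_induct) (auto dest: arcs_verts)

text \<open>Strong induction makes the cycle a shortest one, so its vertices are distinct. Going
  round it and using its last arc backwards are then two simple paths between the same vertices.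
  This needs length at least 3; the lengths 1 and 2, invisible to simple paths, are excluded by
  asymmetry.\<close>

lemma no_cycle: "0 < k \<Longrightarrow> (v, v) \<notin> arcs T ^^ k"
proof (induction k arbitrary: v rule: less_induct)
  case (less k)
  show ?case
  proof
    assume cyc: "(v, v) \<in> arcs T ^^ k"
    then obtain f where f: "f 0 = v" "f k = v" "\<And>i. i < k \<Longrightarrow> (f i, f (Suc i)) \<in> arcs T"
      unfolding relpow_fun_conv by blast
    have as: "asym (arcs T)"
      using dt by (simp add: directed_tree_def)
    have seg: "(f i, f j) \<in> arcs T ^^ (j - i)" if "i \<le> j" "j \<le> k" for i j
      unfolding relpow_fun_conv using f that by (intro exI[of _ "\<lambda>n. f (n + i)"]) auto
    have ne: "f i \<noteq> f j" if "i < j" "j < k" for i j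
      using less.IH[of "j - i" "f i"] seg[of i j] that by auto
    have "(v, v) \<in> arcs T" if "k = 1"
      using f(1,2) f(3)[of 0] that by simp
    then have "k \<noteq> 1"
      using asymD[OF as, of v v] by blast
    moreover have "(v, f 1) \<in> arcs T" "(f 1, v) \<in> arcs T" if "k = 2"
      using f(1,2) f(3)[of 0] f(3)[of 1] that by (simp_all add: numeral_2_eq_2)
    then have "k \<noteq> 2"
      using asymD[OF as, of v "f 1"] by blast
    ultimately have k: "k \<ge> 3"
      using less.prems by simp
    let ?w = "f (k - 1)"
    have vw: "v \<in> verts T" "?w \<in> verts T"
      using f(1) f(3)[of 0] f(3)[of "k - 1"] k arcs_verts by auto
    have "distinct (map f [0..<k])"
      using ne by (auto simp: distinct_map inj_on_def) (metis linorder_neq_iff)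
    moreover have "successively (\<lambda>x y. (x, y) \<in> adj T) (map f [0..<k])"
      unfolding successively_conv_nth using f(3) by (auto simp: adj_def)
    ultimately have p1: "simple_path T v (map f [0..<k]) ?w"
      using k f(1) by (simp add: Defs.simple_path_def hd_map last_map)
    have "(?w, v) \<in> arcs T"
      using f(2) f(3)[of "k - 1"] k by simp
    moreover have "?w \<noteq> v"
      using ne[of 0 "k - 1"] k f(1) by auto
    ultimately have p2: "simple_path T v [v, ?w] ?w"
      by (simp add: Defs.simple_path_def adj_def)
    have "\<exists>!p. simple_path T v p ?w"
      using vw dt unfolding directed_tree_def by simp
    then obtain q where q: "\<And>p. simple_path T v p ?w \<Longrightarrow> p = q"
      by blast
    have "map f [0..<k] = [v, ?w]"
      by (rule trans[OF q[OF p1] q[OF p2, symmetric]])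
    then have "length (map f [0..<k]) = length [v, ?w]"
      by (rule arg_cong)
    then show False
      using k by simp
  qed
qed

lemma acyc: "(v, v) \<notin> (arcs T)\<^sup>+"
  using no_cycle by (auto simp: trancl_power)

lemma level_unique: "\<lbrakk>(x, y) \<in> arcs T ^^ i; (x, y) \<in> arcs T ^^ j\<rbrakk> \<Longrightarrow> i = j"
proof (induction i j rule: linorder_wlog)
  case (le i j)
  then have "(y, y) \<in> arcs T ^^ (j - i)"
    using single_valued_relpow_diff[OF sv] by blast
  then show ?case
    using no_cycle[of "j - i" y] le by (cases "i = j") auto
qed auto

lemma adj_rtrancl: "\<lbrakk>u \<in> verts T; v \<in> verts T\<rbrakk> \<Longrightarrow> (u, v) \<in> (adj T)\<^sup>*"
proof -
  assume "u \<in> verts T" "v \<in> verts T"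
  then obtain p where "simple_path T u p v"
    using dt unfolding directed_tree_def by blast
  then have p: "p \<noteq> []" "hd p = u" "last p = v" "successively (\<lambda>x y. (x, y) \<in> adj T) p"
    by (auto simp: simple_path_def)
  from p show ?thesis
  proof (induction p arbitrary: u)
    case (Cons x p)
    show ?case
    proof (cases p)
      case (Cons y q)
      then have "(y, v) \<in> (adj T)\<^sup>*" "(u, y) \<in> adj T"
        using Cons.IH[of y] Cons.prems Cons by auto
      then show ?thesis
        by (rule converse_rtrancl_into_rtrancl[rotated])
    qed (use Cons.prems in auto)
  qed auto
qed

text \<open>Follow the undirected path from \<open>u\<close> to \<open>v\<close>. A step down to a
  child keeps the current common ancestor; a step up to \<open>z\<close> either stays below it or,
  by confluence of a single-valued relation, makes \<open>z\<close> the new one.\<close>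

lemma common_ancestor:
  assumes "u \<in> verts T" "v \<in> verts T"
  obtains w where "(u, w) \<in> (arcs T)\<^sup>*" "(v, w) \<in> (arcs T)\<^sup>*"
proof -
  have "\<exists>w. (u, w) \<in> (arcs T)\<^sup>* \<and> (v, w) \<in> (arcs T)\<^sup>*"
    using adj_rtrancl[OF assms]
  proof (induction rule: rtrancl_induct)
    case (step y z)
    then obtain w where w: "(u, w) \<in> (arcs T)\<^sup>*" "(y, w) \<in> (arcs T)\<^sup>*"
      by blast
    show ?case
    proof (cases "(y, z) \<in> arcs T")
      case True
      with w consider "(z, w) \<in> (arcs T)\<^sup>*" | "(w, z) \<in> (arcs T)\<^sup>*"
        using single_valued_confluent[OF sv, of y w z] by blast
      then show ?thesis
        by cases (use w in \<open>auto intro: rtrancl_trans\<close>)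
    next
      case False
      then have "(z, y) \<in> arcs T"
        using step by (auto simp: adj_def)
      then show ?thesis
        using w by (meson converse_rtrancl_into_rtrancl)
    qed
  qed auto
  with that show thesis by blast
qed

text \<open>\<open>lt\<close> means nothing between vertices with different parents; including the
  parent in the relation frees later statements of side conditions.\<close>

definition sib_less :: "'v \<Rightarrow> 'v \<Rightarrow> bool" where
  "sib_less a b \<longleftrightarrow> (\<exists>w. (a, w) \<in> arcs T \<and> (b, w) \<in> arcs T \<and> lt T a b)"

text \<open>Distinct siblings above \<open>u\<close> and \<open>v\<close> have their parent as first
  meeting point: a meeting point \<open>z\<close> at or below \<open>a\<close> would put
  \<open>a\<close> above \<open>v\<close>, at the level of \<open>b\<close> by uniqueness of levels,
  forcing \<open>a = b\<close>.\<close>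

lemma meet_minimal:
  assumes "(u, a) \<in> arcs T ^^ i" "(v, b) \<in> arcs T ^^ j" "(a, w) \<in> arcs T" "(b, w) \<in> arcs T" "a \<noteq> b"
    and "(u, z) \<in> arcs T ^^ m" "(v, z) \<in> arcs T ^^ n"
  shows "Suc i \<le> m"
proof (rule ccontr)
  assume "\<not> ?thesis"
  then have m: "m \<le> i" by simp
  then have "(z, a) \<in> arcs T ^^ (i - m)"
    using single_valued_relpow_diff[OF sv assms(6,1)] by blast
  then have va: "(v, a) \<in> arcs T ^^ (n + (i - m))"
    using assms(7) by (auto simp: relpow_add)
  then have "(v, w) \<in> arcs T ^^ Suc (n + (i - m))" "(v, w) \<in> arcs T ^^ Suc j"
    using assms by auto
  then have "n + (i - m) = j"
    using level_unique by blast
  then show False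
    using va assms single_valued_relpow[OF sv] by metis
qed

text \<open>Trades the minimal meeting times of the definition for the mere existence of a pair of
  siblings above \<open>u\<close> and \<open>v\<close>; the parent of such a pair is automatically
  the first meeting point. Further order arguments use this form.\<close>

lemma rls_less_iff:
  "rls_less T u v \<longleftrightarrow> u \<in> verts T \<and> v \<in> verts T \<and>
     ((u, v) \<in> (arcs T)\<^sup>+ \<or> (\<exists>a b. (u, a) \<in> (arcs T)\<^sup>* \<and> (v, b) \<in> (arcs T)\<^sup>* \<and> sib_less a b))"
    (is "_ \<longleftrightarrow> _ \<and> _ \<and> (?A \<or> ?B)")
proof -
  have 1: "?A \<longleftrightarrow> (\<exists>k>0. (u, v) \<in> arcs T ^^ k)"
    by (auto simp: trancl_power)
  have 2: "?B \<longleftrightarrow> (\<exists>m n u' v'. meet_times T u v m n \<and>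
         (\<forall>m' n'. meet_times T u v m' n' \<longrightarrow> m \<le> m' \<and> n \<le> n') \<and>
         (u, u') \<in> arcs T ^^ (m - 1) \<and> (v, v') \<in> arcs T ^^ (n - 1) \<and> lt T u' v')" (is "_ \<longleftrightarrow> ?C")
  proof
    assume ?B
    then obtain a b w i j where ab: "(u, a) \<in> arcs T ^^ i" "(v, b) \<in> arcs T ^^ j"
      "(a, w) \<in> arcs T" "(b, w) \<in> arcs T" "lt T a b"
      by (auto simp: sib_less_def rtrancl_power)
    then have "a \<noteq> b"
      using lt_irrefl by blast
    have "meet_times T u v (Suc i) (Suc j)"
      using ab by (auto simp: meet_times_def)
    moreover have "Suc i \<le> m' \<and> Suc j \<le> n'" if "meet_times T u v m' n'" for m' n'
      using that meet_minimal[of u a i v b j w] meet_minimal[of v b j u a i w] ab \<open>a \<noteq> b\<close>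
      unfolding meet_times_def by metis
    ultimately show ?C
      using ab by (intro exI[of _ "Suc i"] exI[of _ "Suc j"] exI[of _ a] exI[of _ b]) simp
  next
    assume ?C
    then obtain m n u' v' where mn: "meet_times T u v m n"
       "(u, u') \<in> arcs T ^^ (m - 1)" "(v, v') \<in> arcs T ^^ (n - 1)" "lt T u' v'"
      by blast
    then obtain i j w where ij: "m = Suc i" "n = Suc j" "(u, w) \<in> arcs T ^^ Suc i" "(v, w) \<in> arcs T ^^ Suc j"
      unfolding meet_times_def by (metis Suc_pred)
    then have "(u', w) \<in> arcs T" "(v', w) \<in> arcs T"
      using mn ij single_valued_relpow[OF sv, of u _ i] single_valued_relpow[OF sv, of v _ j] by auto
    then show ?B
      using mn by (auto simp: sib_less_def rtrancl_power)
  qed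
  show ?thesis
    unfolding rls_less_def 1 2 by blast
qed

lemma sib_lessD:
  assumes "sib_less a b"
  shows "a \<in> verts T" "b \<in> verts T" "a \<noteq> b"
    "(a, b) \<notin> (arcs T)\<^sup>*" "(b, a) \<notin> (arcs T)\<^sup>*"
proof -
  obtain w where w: "(a, w) \<in> arcs T" "(b, w) \<in> arcs T" "lt T a b"
    using assms by (auto simp: sib_less_def)
  then show "a \<in> verts T" "b \<in> verts T" and ne: "a \<noteq> b"
    using arcs_verts lt_irrefl by auto
  have *: "(x, y) \<notin> (arcs T)\<^sup>*" if xy: "x \<noteq> y" "(x, w) \<in> arcs T" "(y, w) \<in> arcs T" for x y
  proof
    assume "(x, y) \<in> (arcs T)\<^sup>*"
    with xy(1) have "(x, y) \<in> (arcs T)\<^sup>+"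
      by (simp add: rtrancl_eq_or_trancl)
    then obtain z where "(x, z) \<in> arcs T" "(z, y) \<in> (arcs T)\<^sup>*"
      by (meson tranclD)
    then have "(w, y) \<in> (arcs T)\<^sup>*"
      using single_valuedD[OF sv xy(2), of z] by simp
    then show False
      using rtrancl_into_trancl1[of w y, OF _ xy(3)] acyc[of w] by blast
  qed
  show "(a, b) \<notin> (arcs T)\<^sup>*" "(b, a) \<notin> (arcs T)\<^sup>*"
    using * ne w by auto
qed

lemma sib_less_strict_upper:
  "\<lbrakk>sib_less a b; (b, x) \<in> (arcs T)\<^sup>+\<rbrakk> \<Longrightarrow> (a, x) \<in> (arcs T)\<^sup>+"
  "\<lbrakk>sib_less a b; (a, x) \<in> (arcs T)\<^sup>+\<rbrakk> \<Longrightarrow> (b, x) \<in> (arcs T)\<^sup>+"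
  using sv unfolding sib_less_def
  by (metis single_valuedD tranclD rtrancl_into_trancl2)+

lemma ancestors_cases:
  assumes "(v, b) \<in> (arcs T)\<^sup>*" "(v, x) \<in> (arcs T)\<^sup>*"
  obtains "b = x" | "(b, x) \<in> (arcs T)\<^sup>+" | "(x, b) \<in> (arcs T)\<^sup>+"
  using single_valued_confluent[OF sv assms] that unfolding rtrancl_eq_or_trancl by blast

lemma rls_irrefl: "\<not> rls_less T u u"
proof
  assume "rls_less T u u"
  then obtain a b where ab: "(u, a) \<in> (arcs T)\<^sup>*" "(u, b) \<in> (arcs T)\<^sup>*" "sib_less a b"
    using acyc by (auto simp: rls_less_iff)
  then show False
    using sib_lessD[OF ab(3)] single_valued_confluent[OF sv ab(1,2)] by auto
qed

text \<open>The main case has sibling pairs \<open>a\<close>, \<open>b\<close> and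
  \<open>b'\<close>, \<open>c\<close> with both \<open>b\<close> and \<open>b'\<close> above
  \<open>v\<close>, hence comparable. If they are equal, \<open>lt\<close> is transitive; otherwise
  the pair sitting higher also separates \<open>u\<close> from \<open>x\<close>, because siblings
  have the same strict ancestors.\<close>

lemma rls_trans:
  assumes "rls_less T u v" "rls_less T v x"
  shows "rls_less T u x"
proof -
  have V: "u \<in> verts T" "v \<in> verts T" "x \<in> verts T"
    using assms by (auto simp: rls_less_def)
  have "(u, x) \<in> (arcs T)\<^sup>+ \<or> (\<exists>a b. (u, a) \<in> (arcs T)\<^sup>* \<and> (x, b) \<in> (arcs T)\<^sup>* \<and> sib_less a b)"
    using assms(1)[unfolded rls_less_iff]
  proof (elim conjE disjE exE)
    assume uv: "(u, v) \<in> (arcs T)\<^sup>+"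
    show ?thesis
      using assms(2)[unfolded rls_less_iff] uv by (meson rtrancl_trans trancl_into_rtrancl trancl_trans)
  next
    fix a b assume ab: "(u, a) \<in> (arcs T)\<^sup>*" "(v, b) \<in> (arcs T)\<^sup>*" "sib_less a b"
    show ?thesis
      using assms(2)[unfolded rls_less_iff]
    proof (elim conjE disjE exE)
      assume vx: "(v, x) \<in> (arcs T)\<^sup>+"
      from ab(2) trancl_into_rtrancl[OF vx] show ?thesis
      proof (cases rule: ancestors_cases)
        case 2
        then show ?thesis
          using ab sib_less_strict_upper by (meson rtrancl_trancl_trancl)
      qed (use ab in \<open>auto dest: trancl_into_rtrancl\<close>)
    next
      fix b' c assume bc: "(v, b') \<in> (arcs T)\<^sup>*" "(x, c) \<in> (arcs T)\<^sup>*" "sib_less b' c"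
      from ab(2) bc(1) show ?thesis
      proof (cases rule: ancestors_cases)
        case 1
        then have "sib_less a c"
          using ab(3) bc(3) sv lt_trans unfolding sib_less_def by (metis single_valuedD)
        then show ?thesis
          using ab bc by blast
      next
        case 2
        then have "(u, b') \<in> (arcs T)\<^sup>*"
          using ab sib_less_strict_upper(1) by (meson rtrancl_trancl_trancl trancl_into_rtrancl)
        then show ?thesis
          using bc by blast
      next
        case 3
        then have "(x, b) \<in> (arcs T)\<^sup>*"
          using bc sib_less_strict_upper(2) by (meson rtrancl_trancl_trancl trancl_into_rtrancl)
        then show ?thesis
          using ab by blast
      qed
    qed
  qed
  then show ?thesis
    using V by (simp add: rls_less_iff)
qed

lemma rls_asym: "rls_less T u v \<Longrightarrow> \<not> rls_less T v u"
  using rls_trans rls_irrefl by blast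

text \<open>Climb from \<open>u\<close> to its lowest ancestor that is also above \<open>v\<close>.
  Either it is \<open>v\<close> itself, or it is entered from two different children, which
  \<open>lt\<close> compares.\<close>

lemma rls_total:
  assumes "u \<in> verts T" "v \<in> verts T" "u \<noteq> v"
  shows "rls_less T u v \<or> rls_less T v u"
proof -
  obtain w where w: "(u, w) \<in> (arcs T)\<^sup>*" "(v, w) \<in> (arcs T)\<^sup>*"
    using common_ancestor assms by blast
  from w(1,2) show ?thesis
  proof (induction rule: rtrancl_induct)
    case base
    then show ?case
      using assms by (metis rls_less_iff rtranclD)
  next
    case (step a w)
    show ?case
    proof (cases "(v, a) \<in> (arcs T)\<^sup>*")
      case True
      then show ?thesis
        using step by blast
    next
      case nva: False
      show ?thesis
      proof (cases "v = w")
        case True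
        then show ?thesis
          using step assms by (meson rls_less_iff rtrancl_into_trancl1)
      next
        case False
        then obtain b where b: "(v, b) \<in> (arcs T)\<^sup>*" "(b, w) \<in> arcs T"
          using step.prems by (metis rtranclE)
        then have "a \<noteq> b"
          using nva by auto
        then have "sib_less a b \<or> sib_less b a"
          using lt_total step b unfolding sib_less_def by blast
        then show ?thesis
          using b step assms by (auto simp: rls_less_iff)
      qed
    qed
  qed
qed

lemma rls_parent: "(u, v) \<in> arcs T \<Longrightarrow> rls_less T u v"
  using arcs_verts by (auto simp: rls_less_iff)

text \<open>Descendant trees are convex in the RLS order, with their root as largest element:
  whatever follows a member without belonging to the tree follows the root.\<close>

lemma rls_subtree:
  assumes "(u, w) \<in> (arcs T)\<^sup>*" "(x, w) \<notin> (arcs T)\<^sup>*" "rls_less T u x"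
  shows "rls_less T w x"
proof -
  have V: "w \<in> verts T" "x \<in> verts T"
    using assms rtrancl_verts by (auto simp: rls_less_iff)
  show ?thesis
    using assms(3)[unfolded rls_less_iff]
  proof (elim conjE disjE exE)
    assume "(u, x) \<in> (arcs T)\<^sup>+"
    then have "(u, x) \<in> (arcs T)\<^sup>*" by simp
    with assms(1) show ?thesis
      by (cases rule: ancestors_cases)
        (use assms V trancl_into_rtrancl[of x w] in \<open>auto simp: rls_less_iff\<close>)
  next
    fix a b assume ab: "(u, a) \<in> (arcs T)\<^sup>*" "(x, b) \<in> (arcs T)\<^sup>*" "sib_less a b"
    from ab(1) assms(1) have "(w, a) \<in> (arcs T)\<^sup>*"
    proof (cases rule: ancestors_cases)
      case 2
      then have "(x, w) \<in> (arcs T)\<^sup>*"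
        using ab sib_less_strict_upper(2) by (meson rtrancl_trancl_trancl trancl_into_rtrancl)
      then show ?thesis
        using assms by simp
    qed auto
    then show ?thesis
      using ab V by (auto simp: rls_less_iff)
  qed
qed

end

section \<open>The covering relation of the RLS order\<close>

definition last_child :: "'v odigraph \<Rightarrow> 'v \<Rightarrow> 'v \<Rightarrow> bool" where
  "last_child T p w \<longleftrightarrow> p \<in> children T w \<and> (\<forall>t\<in>children T w. \<not> lt T p t)"

definition next_sibling :: "'v odigraph \<Rightarrow> 'v \<Rightarrow> 'v \<Rightarrow> bool" where
  "next_sibling T p s \<longleftrightarrow> (\<exists>w. p \<in> children T w \<and> s \<in> children T w \<and> lt T p s \<and>
     (\<forall>t\<in>children T w. lt T p t \<longrightarrow> t = s \<or> lt T s t))"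

definition first_child :: "'v odigraph \<Rightarrow> 'v \<Rightarrow> 'v \<Rightarrow> bool" where
  "first_child T w c \<longleftrightarrow> c \<in> children T w \<and> (\<forall>d\<in>children T w. d = c \<or> lt T c d)"

text \<open>Being inductive, this holds only if the descent through first children stops after
  finitely many steps; along an infinite descent there is no \<open>q\<close>.\<close>

inductive first_leaf :: "'v odigraph \<Rightarrow> 'v \<Rightarrow> 'v \<Rightarrow> bool" for T where
  leaf: "\<lbrakk>s \<in> verts T; children T s = {}\<rbrakk> \<Longrightarrow> first_leaf T s s"
| descend: "\<lbrakk>first_child T s c; first_leaf T c q\<rbrakk> \<Longrightarrow> first_leaf T s q"

text \<open>A relation instead of a function with default value, unlike \<open>rls_next\<close>: its
  powers and its converse stay meaningful where a successor or predecessor is missing.\<close>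

definition succ_rel :: "'v odigraph \<Rightarrow> ('v \<times> 'v) set" where
  "succ_rel T = {(p, q). last_child T p q \<or> (\<exists>s. next_sibling T p s \<and> first_leaf T s q)}"

context ordered_tree
begin

lemma rls_less_verts: "rls_less T u v \<Longrightarrow> u \<in> verts T \<and> v \<in> verts T"
  by (simp add: rls_less_def)

lemma rtrancl_last_step:
  "(v, s) \<in> (arcs T)\<^sup>* \<Longrightarrow> v = s \<or> (\<exists>d. (v, d) \<in> (arcs T)\<^sup>* \<and> (d, s) \<in> arcs T)"
  by (erule rtranclE) auto

lemma rtrancl_via_parent:
  assumes "(p, a) \<in> (arcs T)\<^sup>*" "(p, w) \<in> arcs T"
  shows "p = a \<or> (w, a) \<in> (arcs T)\<^sup>*"
  using assms(1)
proof (cases rule: converse_rtranclE)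
  case (step y)
  then show ?thesis
    using single_valuedD[OF sv step(1) assms(2)] by simp
qed simp

lemma descendant_le:
  assumes "(u, v) \<in> (arcs T)\<^sup>*" "v \<in> verts T"
  shows "u = v \<or> rls_less T u v"
  using assms rtrancl_verts[OF assms(1)] by (auto simp: rls_less_iff rtrancl_eq_or_trancl)

lemma exists_lt_least:
  assumes "finite A" "A \<noteq> {}" "A \<subseteq> children T w"
  shows "\<exists>c\<in>A. \<forall>d\<in>A. d = c \<or> lt T c d"
  using assms
proof (induction A rule: finite_ne_induct)
  case (insert x A)
  then obtain c where c: "c \<in> A" "\<forall>d\<in>A. d = c \<or> lt T c d"
    by auto
  have ch: "(y, w) \<in> arcs T" if "y \<in> insert x A" for y
    using insert.prems that by (auto simp: children_def)
  have "x \<noteq> c"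
    using c insert by auto
  then consider "lt T x c" | "lt T c x"
    using lt_total ch c by blast
  then show ?case
  proof cases
    case 1
    then have "\<forall>d\<in>insert x A. d = x \<or> lt T x d"
      using c(2) lt_trans[OF ch[of x] ch[of c] ch 1] c(1) by auto
    then show ?thesis by blast
  next
    case 2
    then show ?thesis
      using c by auto
  qed
qed auto

lemma exists_first_child: "children T w \<noteq> {} \<Longrightarrow> \<exists>c. first_child T w c"
  using exists_lt_least[OF finite_children, of w w] by (auto simp: first_child_def)

lemma last_or_next_sibling:
  assumes "(p, w) \<in> arcs T"
  shows "last_child T p w \<or> (\<exists>s. next_sibling T p s \<and> (s, w) \<in> arcs T)"
proof (cases "last_child T p w")
  case False
  let ?A = "{t \<in> children T w. lt T p t}"
  have "?A \<noteq> {}"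
    using False assms by (auto simp: last_child_def children_def)
  then obtain s where "s \<in> ?A" "\<forall>d\<in>?A. d = s \<or> lt T s d"
    using exists_lt_least[of ?A w] finite_children by auto
  then have "next_sibling T p s" "(s, w) \<in> arcs T"
    using assms by (auto simp: next_sibling_def children_def)
  then show ?thesis by blast
qed auto

lemma first_leaf_below: "first_leaf T s q \<Longrightarrow> (q, s) \<in> (arcs T)\<^sup>*"
proof (induction rule: first_leaf.induct)
  case (descend s c q)
  then have "(c, s) \<in> arcs T"
    by (simp add: first_child_def children_def)
  with descend.IH show ?case
    by (rule rtrancl_into_rtrancl)
qed simp

text \<open>Passing to the first child never loses the minimum: later branches, and \<open>s\<close>
  itself, come after the whole first branch.\<close>

lemma first_leaf_least:
  "\<lbrakk>first_leaf T s q; (v, s) \<in> (arcs T)\<^sup>*\<rbrakk> \<Longrightarrow> v = q \<or> rls_less T q v"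
proof (induction rule: first_leaf.induct)
  case (leaf s)
  then show ?case
    using rtrancl_last_step[of v s] by (auto simp: children_def)
next
  case (descend s c q)
  have c: "(c, s) \<in> arcs T" "\<And>d. (d, s) \<in> arcs T \<Longrightarrow> d = c \<or> lt T c d"
    using descend by (auto simp: first_child_def children_def)
  have qc: "(q, c) \<in> (arcs T)\<^sup>*"
    using descend first_leaf_below by blast
  show ?case
  proof (cases "v = s")
    case True
    have "(q, s) \<in> (arcs T)\<^sup>+"
      using qc c(1) by (rule rtrancl_into_trancl1)
    then show ?thesis
      using True trancl_verts by (auto simp: rls_less_iff)
  next
    case False
    then obtain d where d: "(v, d) \<in> (arcs T)\<^sup>*" "(d, s) \<in> arcs T"
      using descend.prems rtrancl_last_step by blast
    show ?thesis
    proof (cases "d = c")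
      case True
      then show ?thesis
        using descend.IH d by blast
    next
      case False
      then have "sib_less c d"
        using c d by (auto simp: sib_less_def)
      moreover have "q \<in> verts T" "v \<in> verts T"
        using rtrancl_verts[OF qc] rtrancl_verts[OF d(1)] arcs_verts[OF c(1)] arcs_verts[OF d(2)]
        by simp_all
      ultimately have "rls_less T q v"
        unfolding rls_less_iff using qc d(1) by blast
      then show ?thesis ..
    qed
  qed
qed

lemma exists_first_leaf:
  assumes "s \<in> verts T" "finite {x. (x, s) \<in> (arcs T)\<^sup>*}"
  shows "\<exists>q. first_leaf T s q"
  using assms(2,1)
proof (induction "{x. (x, s) \<in> (arcs T)\<^sup>*}" arbitrary: s rule: finite_psubset_induct)
  case psubset
  show ?case
  proof (cases "children T s = {}")
    case True
    then show ?thesis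
      using first_leaf.leaf[OF psubset.prems] by blast
  next
    case False
    then obtain c where c: "first_child T s c"
      using exists_first_child by blast
    then have cs: "(c, s) \<in> arcs T"
      by (auto simp: first_child_def children_def)
    then have "(s, c) \<notin> (arcs T)\<^sup>*"
      using acyc rtrancl_into_trancl1[of s c "arcs T" s] by blast
    then have "{x. (x, c) \<in> (arcs T)\<^sup>*} \<subset> {x. (x, s) \<in> (arcs T)\<^sup>*}"
      using rtrancl_into_rtrancl[OF _ cs] by blast
    then show ?thesis
      using psubset(2)[of c] arcs_verts[OF cs] first_leaf.descend[OF c] by blast
  qed
qed

lemma succ_verts: "(p, q) \<in> succ_rel T \<Longrightarrow> p \<in> verts T \<and> q \<in> verts T"
  unfolding succ_rel_def last_child_def next_sibling_def children_def
  using arcs_verts first_leaf_below rtrancl_verts by blast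

text \<open>For a last child, vertices outside the tree below the parent \<open>q\<close> are
  handled by convexity, and those strictly below \<open>q\<close> lie in the branch of
  \<open>p\<close> or of an earlier sibling, hence not after \<open>p\<close>. For a next sibling
  \<open>s\<close>, a vertex after \<open>p\<close> is an ancestor of \<open>p\<close>, lies under
  \<open>s\<close> or a later sibling, or is separated from \<open>p\<close> at or above their
  parent; each comes no earlier than the first leaf below \<open>s\<close>.\<close>

lemma succ_is_after:
  assumes "(p, q) \<in> succ_rel T"
  shows "is_rls_after T p q"
  using assms unfolding succ_rel_def
proof (elim CollectE case_prodE disjE exE conjE Pair_inject, goal_cases)
  case (1 p' q')
  then have pq: "(p, q) \<in> arcs T" and last: "\<And>t. (t, q) \<in> arcs T \<Longrightarrow> \<not> lt T p t"
    by (auto simp: last_child_def children_def)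
  show ?case
    unfolding is_rls_after_def
  proof (intro conjI allI impI)
    show "rls_less T p q"
      by (rule rls_parent[OF pq])
    fix v assume pv: "rls_less T p v"
    then have V: "v \<in> verts T" "q \<in> verts T"
      using pq arcs_verts by (auto simp: rls_less_def)
    show "v = q \<or> rls_less T q v"
    proof (cases "(v, q) \<in> (arcs T)\<^sup>*")
      case False
      then show ?thesis
        using rls_subtree[of p q v] pq pv by blast
    next
      case True
      have "\<not> rls_less T p v" if "v \<noteq> q"
      proof -
        obtain d where d: "(v, d) \<in> (arcs T)\<^sup>*" "(d, q) \<in> arcs T"
          using True \<open>v \<noteq> q\<close> rtrancl_last_step by blast
        show ?thesis
        proof (cases "d = p")
          case True
          then have "v = p \<or> rls_less T v p"
            using d pq arcs_verts descendant_le by blast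
          then show ?thesis
            using rls_asym rls_irrefl by blast
        next
          case False
          then have "sib_less d p"
            using d last pq lt_total unfolding sib_less_def by blast
          then have "rls_less T v p"
            using d V pq arcs_verts by (auto simp: rls_less_iff)
          then show ?thesis
            using rls_asym by blast
        qed
      qed
      then show ?thesis
        using pv by blast
    qed
  qed
next
  case (2 p' q' s)
  then have fl: "first_leaf T s q" and "next_sibling T p s"
    by auto
  then obtain w where w: "(p, w) \<in> arcs T" "(s, w) \<in> arcs T" "lt T p s"
    "\<And>t. \<lbrakk>(t, w) \<in> arcs T; lt T p t\<rbrakk> \<Longrightarrow> t = s \<or> lt T s t"
    by (auto simp: next_sibling_def children_def)
  have qs: "(q, s) \<in> (arcs T)\<^sup>*"
    using fl first_leaf_below by blast
  then have V: "q \<in> verts T" "p \<in> verts T"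
    using w arcs_verts rtrancl_verts by blast+
  show ?case
    unfolding is_rls_after_def
  proof (intro conjI allI impI)
    show "rls_less T p q"
      using w qs V by (auto simp: rls_less_iff sib_less_def)
    fix v assume pv: "rls_less T p v"
    then have vV: "v \<in> verts T"
      by (simp add: rls_less_def)
    have qw: "(q, w) \<in> (arcs T)\<^sup>+"
      using qs w(2) by (rule rtrancl_into_trancl1)
    show "v = q \<or> rls_less T q v"
      using pv[unfolded rls_less_iff]
    proof (elim conjE disjE exE)
      assume "(p, v) \<in> (arcs T)\<^sup>+"
      then have "(w, v) \<in> (arcs T)\<^sup>*"
        using single_valuedD[OF sv w(1)] by (auto dest: tranclD)
      with qw have "(q, v) \<in> (arcs T)\<^sup>+"
        by (rule trancl_rtrancl_trancl)
      then show ?thesis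
        using V vV by (simp add: rls_less_iff)
    next
      fix a b assume ab: "(p, a) \<in> (arcs T)\<^sup>*" "(v, b) \<in> (arcs T)\<^sup>*" "sib_less a b"
      show ?thesis
      proof (cases "a = p")
        case True
        then have b: "(b, w) \<in> arcs T" "lt T p b"
          using ab(3) w(1) sv by (auto simp: sib_less_def dest: single_valuedD)
        then consider "b = s" | "sib_less s b"
          using w by (auto simp: sib_less_def)
        then show ?thesis
        proof cases
          case 1
          then show ?thesis
            using first_leaf_least[OF fl] ab by blast
        next
          case 2
          then show ?thesis
            using qs ab V vV by (auto simp: rls_less_iff)
        qed
      next
        case False
        then have "(w, a) \<in> (arcs T)\<^sup>*"
          using rtrancl_via_parent[OF ab(1) w(1)] by simp
        then have "(q, a) \<in> (arcs T)\<^sup>*"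
          using qw by simp
        then show ?thesis
          using ab V vV by (auto simp: rls_less_iff)
      qed
    qed
  qed
qed

lemma succ_less: "(p, q) \<in> succ_rel T \<Longrightarrow> rls_less T p q"
  using succ_is_after by (auto simp: is_rls_after_def)

lemma succ_least: "\<lbrakk>(p, q) \<in> succ_rel T; rls_less T p v\<rbrakk> \<Longrightarrow> v = q \<or> rls_less T q v"
  using succ_is_after by (auto simp: is_rls_after_def)

lemma succ_unique: "\<lbrakk>(p, q) \<in> succ_rel T; (p, q') \<in> succ_rel T\<rbrakk> \<Longrightarrow> q = q'"
  using succ_less succ_least rls_asym by metis

lemma succ_inj:
  assumes "(p, q) \<in> succ_rel T" "(p', q) \<in> succ_rel T"
  shows "p = p'"
proof (rule ccontr)
  assume "p \<noteq> p'"
  then have "rls_less T p p' \<or> rls_less T p' p"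
    using assms succ_verts rls_total by blast
  then show False
    using assms succ_less succ_least rls_asym rls_irrefl by metis
qed

lemma single_valued_succ: "single_valued (succ_rel T)" "single_valued ((succ_rel T)\<inverse>)"
  by (auto simp: single_valued_def intro: succ_unique succ_inj)

lemma succ_pow_less: "\<lbrakk>(p, q) \<in> succ_rel T ^^ n; 0 < n\<rbrakk> \<Longrightarrow> rls_less T p q"
proof (induction n arbitrary: q)
  case (Suc n)
  then obtain x where "(p, x) \<in> succ_rel T ^^ n" "(x, q) \<in> succ_rel T"
    by auto
  then show ?case
    using Suc.IH[of x] succ_less[of x q] rls_trans[of p x q] by (cases "n = 0") auto
qed simp

end

section \<open>Eternal Family Trees whose RLS order has finite intervals\<close>

locale interval_finite_eft = ordered_tree +
  assumes ex_parent: "v \<in> verts T \<Longrightarrow> \<exists>w. (v, w) \<in> arcs T"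
    and finite_interval: "finite {x. rls_less T u x \<and> rls_less T x v}"
begin

text \<open>If \<open>p\<close> is not a last child, the descendants of its next sibling all lie
  between \<open>p\<close> and the parent of \<open>p\<close>. There are thus finitely many, and the
  descent to the first leaf ends.\<close>

lemma exists_succ:
  assumes "p \<in> verts T"
  shows "\<exists>q. (p, q) \<in> succ_rel T"
proof -
  obtain w where w: "(p, w) \<in> arcs T"
    using assms ex_parent by blast
  consider "last_child T p w" | s where "next_sibling T p s" "(s, w) \<in> arcs T"
    using last_or_next_sibling[OF w] by blast
  then show ?thesis
  proof cases
    case 1
    then show ?thesis
      by (auto simp: succ_rel_def)
  next
    case 2
    then have ps: "sib_less p s"
      using w sv by (auto simp: next_sibling_def sib_less_def children_def dest: single_valuedD)
    have "{x. (x, s) \<in> (arcs T)\<^sup>*} \<subseteq> {x. rls_less T p x \<and> rls_less T x w}"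
    proof
      fix x assume "x \<in> {x. (x, s) \<in> (arcs T)\<^sup>*}"
      then have xs: "(x, s) \<in> (arcs T)\<^sup>*" by simp
      then have "x \<in> verts T"
        using 2 arcs_verts rtrancl_verts by blast
      moreover have "(x, w) \<in> (arcs T)\<^sup>+"
        using xs 2(2) by (rule rtrancl_into_trancl1)
      ultimately show "x \<in> {x. rls_less T p x \<and> rls_less T x w}"
        using assms ps xs arcs_verts[OF w] by (auto simp: rls_less_iff)
    qed
    then have "finite {x. (x, s) \<in> (arcs T)\<^sup>*}"
      using finite_interval finite_subset by blast
    then show ?thesis
      using exists_first_leaf 2 arcs_verts by (fastforce simp: succ_rel_def)
  qed
qed

lemma exists_succ_pow: "p \<in> verts T \<Longrightarrow> \<exists>q\<in>verts T. (p, q) \<in> succ_rel T ^^ n"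
proof (induction n)
  case (Suc n)
  then show ?case
    using exists_succ succ_verts by (meson relpow_Suc_I)
qed auto

text \<open>A successor step cannot jump over \<open>v\<close> and removes a point from the interval
  below \<open>v\<close>, so finitely many steps reach \<open>v\<close>.\<close>

lemma less_imp_succ_pow:
  assumes "rls_less T u v"
  shows "\<exists>n. (u, v) \<in> succ_rel T ^^ n"
  using finite_interval[of u v] assms
proof (induction "{x. rls_less T u x \<and> rls_less T x v}" arbitrary: u rule: finite_psubset_induct)
  case psubset
  then obtain q where q: "(u, q) \<in> succ_rel T"
    using exists_succ rls_less_verts by blast
  show ?case
  proof (cases "v = q")
    case True
    then show ?thesis
      using q by (metis relpow_1)
  next
    case False
    then have qv: "rls_less T q v"
      using q psubset.prems succ_least by blast
    then have "{x. rls_less T q x \<and> rls_less T x v} \<subset> {x. rls_less T u x \<and> rls_less T x v}"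
      using succ_less[OF q] rls_trans rls_irrefl by blast
    then obtain n where "(q, v) \<in> succ_rel T ^^ n"
      using psubset(2) qv by blast
    then show ?thesis
      using q by (meson relpow_Suc_I2)
  qed
qed

end

section \<open>Two sufficient conditions for finite intervals\<close>

context ordered_tree
begin

lemma is_rls_after_unique: "\<lbrakk>is_rls_after T p q; is_rls_after T p q'\<rbrakk> \<Longrightarrow> q = q'"
  unfolding is_rls_after_def using rls_asym by metis

lemma is_rls_before_unique: "\<lbrakk>is_rls_before T p q; is_rls_before T p q'\<rbrakk> \<Longrightarrow> q = q'"
  unfolding is_rls_before_def using rls_asym by metis

lemma rls_next_after:
  assumes "rls_less T u x" "x \<noteq> rls_next T u"
  shows "rls_less T (rls_next T u) x"
proof (cases "\<exists>a. is_rls_after T u a")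
  case True
  then obtain a where a: "is_rls_after T u a" by blast
  then have "rls_next T u = a"
    using is_rls_after_unique by (auto simp: rls_next_def)
  then show ?thesis
    using a assms by (auto simp: is_rls_after_def)
qed (use assms in \<open>auto simp: rls_next_def\<close>)

lemma rls_prev_le: "rls_prev T u = u \<or> rls_less T (rls_prev T u) u"
proof (cases "\<exists>a. is_rls_before T u a")
  case True
  then obtain a where a: "is_rls_before T u a" by blast
  then have "rls_prev T u = a"
    using is_rls_before_unique by (auto simp: rls_prev_def)
  then show ?thesis
    using a by (auto simp: is_rls_before_def)
qed (auto simp: rls_prev_def)

lemma rls_prev_pow_le: "(rls_prev T ^^ n) u = u \<or> rls_less T ((rls_prev T ^^ n) u) u"
proof (induction n)
  case (Suc n)
  then show ?case
    using rls_prev_le[of "(rls_prev T ^^ n) u"] rls_trans by auto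
qed auto

text \<open>The vertex \<open>v\<close> lies on the line of \<open>u\<close>, and at a nonnegative
  index, since iterating \<open>rls_prev\<close> never leads above \<open>u\<close>. As
  \<open>rls_next\<close> skips no vertex, the interval is contained in the iterates up to that
  index.\<close>

lemma unique_succession_line_finite_interval:
  assumes "unique_succession_line T"
  shows "finite {x. rls_less T u x \<and> rls_less T x v}"
proof (cases "rls_less T u v")
  case False
  then have "{x. rls_less T u x \<and> rls_less T x v} = {}"
    using rls_trans by blast
  then show ?thesis by (simp only: finite.emptyI)
next
  case True
  have "succession_line T v 0 = v"
    by (simp add: succession_line_def)
  then have "v \<in> range (succession_line T u)"
    using assms True by (metis rangeI rls_less_def unique_succession_line_def)
  then obtain n where n: "v = succession_line T u n"
    by blast
  have "0 \<le> n"
    using rls_prev_pow_le[of "nat (- n)" u] n True rls_asym rls_irrefl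
    by (auto simp: succession_line_def split: if_splits)
  then have v: "v = (rls_next T ^^ nat n) u"
    using n by (simp add: succession_line_def)
  have "(\<exists>i\<le>m. x = (rls_next T ^^ i) u) \<or> rls_less T ((rls_next T ^^ m) u) x"
    if "rls_less T u x" for m x
  proof (induction m)
    case 0
    then show ?case using that by simp
  next
    case (Suc m)
    then show ?case
      using rls_next_after[of "(rls_next T ^^ m) u" x]
      by (cases "x = (rls_next T ^^ Suc m) u") (auto intro: le_SucI)
  qed
  then have "{x. rls_less T u x \<and> rls_less T x v} \<subseteq> (\<lambda>i. (rls_next T ^^ i) u) ` {..nat n}"
    using v rls_asym by blast
  then show ?thesis
    using finite_subset by blast
qed

text \<open>Pick an ancestor \<open>a\<close> common to \<open>u\<close>, \<open>v\<close> and
  \<open>z\<close>; by convexity all vertices between \<open>u\<close> and \<open>v\<close> are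
  below \<open>a\<close>. The assumption is confined to the ancestral line of one vertex
  \<open>z\<close>, to be applied with the root of a random tree.\<close>

lemma finite_descendants_finite_interval:
  assumes "\<And>w. (z, w) \<in> (arcs T)\<^sup>* \<Longrightarrow> finite {x. (x, w) \<in> (arcs T)\<^sup>*}" "z \<in> verts T"
  shows "finite {x. rls_less T u x \<and> rls_less T x v}"
proof (cases "u \<in> verts T \<and> v \<in> verts T")
  case True
  then obtain w where w: "(u, w) \<in> (arcs T)\<^sup>*" "(v, w) \<in> (arcs T)\<^sup>*"
    using common_ancestor by blast
  then have "w \<in> verts T"
    using True rtrancl_verts[OF w(1)] by simp
  then obtain a where a: "(w, a) \<in> (arcs T)\<^sup>*" "(z, a) \<in> (arcs T)\<^sup>*"
    using common_ancestor[OF _ assms(2)] by blast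
  have "x \<in> {x. (x, a) \<in> (arcs T)\<^sup>*}" if x: "rls_less T u x" "rls_less T x v" for x
  proof (rule ccontr)
    assume "x \<notin> {x. (x, a) \<in> (arcs T)\<^sup>*}"
    then have ax: "rls_less T a x"
      using rls_subtree[OF rtrancl_trans[OF w(1) a(1)] _ x(1)] by simp
    have "v = a \<or> rls_less T v a"
      using descendant_le[OF rtrancl_trans[OF w(2) a(1)]] rtrancl_verts[OF a(2)] assms(2) by simp
    then have "rls_less T x a"
      using x(2) rls_trans[OF x(2)] by auto
    then show False
      using rls_asym[OF ax] by contradiction
  qed
  then have "{x. rls_less T u x \<and> rls_less T x v} \<subseteq> {x. (x, a) \<in> (arcs T)\<^sup>*}"
    by blast
  then show ?thesis
    using assms(1)[OF a(2)] finite_subset by blast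
next
  case False
  then have "{x. rls_less T u x \<and> rls_less T x v} = {}"
    by (auto simp: rls_less_def)
  then show ?thesis by (simp only: finite.emptyI)
qed

end

section \<open>The offspring sequence and its record graph\<close>

text \<open>Negative indices use the converse relation, so no predecessor has to be chosen before it
  is known to exist.\<close>

definition nth_succ :: "'v odigraph \<Rightarrow> int \<Rightarrow> ('v \<times> 'v) set" where
  "nth_succ T n = (if 0 \<le> n then succ_rel T ^^ nat n else (succ_rel T ^^ nat (- n))\<inverse>)"

text \<open>Where the \<open>n + 1\<close>-st successor is unique, as in every ordered tree, \<open>LEAST\<close> just names its
  number of children; this form is measurable without knowing that the successor exists (the value
  is junk if it does not).\<close>

definition offspring_seq :: "'v odigraph \<Rightarrow> 'v \<Rightarrow> int \<Rightarrow> int" where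
  "offspring_seq T v n = int (LEAST k. \<exists>u. (v, u) \<in> nth_succ T (n + 1) \<and> card (children T u) = k) - 1"

text \<open>In contrast to \<open>succession_line\<close>, such a line cannot stall: it exists only
  through vertices with predecessors of every order.\<close>

definition succ_line :: "'v odigraph \<Rightarrow> (int \<Rightarrow> 'v) \<Rightarrow> bool" where
  "succ_line T u \<longleftrightarrow> (\<forall>n. (u n, u (n + 1)) \<in> succ_rel T)"

lemma single_valued_converse_relpow:
  assumes "single_valued ((r :: ('a \<times> 'a) set)\<inverse>)" "(y, x) \<in> r ^^ n" "(z, x) \<in> r ^^ n"
  shows "y = z"
  using assms(2,3)
proof (induction n arbitrary: x)
  case (Suc n)
  then obtain x1 x2 where "(y, x1) \<in> r ^^ n" "(x1, x) \<in> r" "(z, x2) \<in> r ^^ n" "(x2, x) \<in> r"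
    by auto
  moreover from this have "x1 = x2"
    using assms(1) by (auto dest: single_valuedD)
  ultimately show ?case
    using Suc.IH by blast
qed auto

lemma succ_line_relpow: "succ_line T u \<Longrightarrow> (u i, u (i + int k)) \<in> succ_rel T ^^ k"
proof (induction k)
  case (Suc k)
  then have "(u (i + int k), u (i + int k + 1)) \<in> succ_rel T"
    by (simp add: succ_line_def)
  then show ?case
    using Suc by (auto simp: algebra_simps)
qed simp

lemma succ_line_nth:
  assumes "succ_line T u"
  shows "(u i, u (i + n)) \<in> nth_succ T n"
  using succ_line_relpow[OF assms, of i "nat n"] succ_line_relpow[OF assms, of "i + n" "nat (- n)"]
  by (auto simp: nth_succ_def)

context ordered_tree
begin

lemma nth_succ_unique: "\<lbrakk>(v, x) \<in> nth_succ T n; (v, y) \<in> nth_succ T n\<rbrakk> \<Longrightarrow> x = y"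
  using single_valued_relpow[OF single_valued_succ(1), of v x "nat n" y]
    single_valued_converse_relpow[OF single_valued_succ(2), of x v "nat (- n)" y]
  by (auto simp: nth_succ_def split: if_splits)

lemma nth_succ_inj: "\<lbrakk>(x, v) \<in> nth_succ T n; (y, v) \<in> nth_succ T n\<rbrakk> \<Longrightarrow> x = y"
  using single_valued_relpow[OF single_valued_succ(1), of v x "nat (- n)" y]
    single_valued_converse_relpow[OF single_valued_succ(2), of x v "nat n" y]
  by (auto simp: nth_succ_def split: if_splits)

text \<open>Choosing an \<open>n\<close>-th successor for each \<open>n\<close> separately is
  enough: uniqueness of successors and predecessors links consecutive choices.\<close>

lemma exists_succ_line:
  assumes ex: "\<And>n. \<exists>q. (v, q) \<in> nth_succ T n"
  obtains u where "succ_line T u" "u 0 = v"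
proof -
  obtain u where u: "\<And>n. (v, u n) \<in> nth_succ T n"
    using ex by metis
  have "(u n, u (n + 1)) \<in> succ_rel T" for n
  proof (cases "0 \<le> n")
    case True
    then have "nat (n + 1) = Suc (nat n)"
      by simp
    then have "(v, u (n + 1)) \<in> succ_rel T ^^ Suc (nat n)"
      using u[of "n + 1"] True by (simp add: nth_succ_def)
    then obtain x where "(v, x) \<in> succ_rel T ^^ nat n" "(x, u (n + 1)) \<in> succ_rel T"
      by auto
    moreover have "(v, u n) \<in> succ_rel T ^^ nat n"
      using u[of n] True by (simp add: nth_succ_def)
    ultimately show ?thesis
      using single_valued_relpow[OF single_valued_succ(1)] by metis
  next
    case False
    then have "nat (- n) = Suc (nat (- (n + 1)))"
      by simp
    then have "(u n, v) \<in> succ_rel T ^^ Suc (nat (- (n + 1)))"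
      using u[of n] False by (simp add: nth_succ_def)
    then obtain x where x: "(u n, x) \<in> succ_rel T" "(x, v) \<in> succ_rel T ^^ nat (- (n + 1))"
      by (meson relpow_Suc_E2)
    \<comment> \<open>For \<open>n = - 1\<close> the index \<open>n + 1 = 0\<close> falls under the
      other branch of \<open>nth_succ\<close>; both branches are the identity there.\<close>
    have "(u (n + 1), v) \<in> succ_rel T ^^ nat (- (n + 1))"
      using u[of "n + 1"] False by (cases "n = - 1") (simp_all add: nth_succ_def)
    then have "x = u (n + 1)"
      using x(2) single_valued_converse_relpow[OF single_valued_succ(2)] by metis
    then show ?thesis
      using x by simp
  qed
  moreover have "u 0 = v"
    using u[of 0] by (simp add: nth_succ_def)
  ultimately show thesis
    using that by (auto simp: succ_line_def)
qed

section \<open>Left siblings along the ancestral line\<close>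

definition left_siblings :: "'v \<Rightarrow> nat" where
  "left_siblings x = card {s. sib_less s x}"

text \<open>The sum runs over the path from \<open>x\<close> up to \<open>w\<close>, including
  \<open>x\<close> and, by acyclicity, excluding \<open>w\<close>; it is empty unless
  \<open>w\<close> is a strict ancestor of \<open>x\<close>.\<close>

definition left_weight :: "'v \<Rightarrow> 'v \<Rightarrow> nat" where
  "left_weight w x = sum left_siblings {a. (x, a) \<in> (arcs T)\<^sup>* \<and> (a, w) \<in> (arcs T)\<^sup>+}"

lemma sib_less_set: "(x, w) \<in> arcs T \<Longrightarrow> {s. sib_less s x} = {s \<in> children T w. lt T s x}"
  using single_valuedD[OF sv] by (auto simp: sib_less_def children_def)

lemma finite_sib_less: "finite {s. sib_less s x}"
proof (cases "\<exists>w. (x, w) \<in> arcs T")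
  case True
  then show ?thesis
    using sib_less_set finite_children by fastforce
next
  case False
  then have "{s. sib_less s x} = {}"
    by (auto simp: sib_less_def)
  then show ?thesis by (simp only: finite.emptyI)
qed

lemma path_set_step:
  assumes "(x, x') \<in> arcs T" "(x', w) \<in> (arcs T)\<^sup>*"
  shows "{a. (x, a) \<in> (arcs T)\<^sup>* \<and> (a, w) \<in> (arcs T)\<^sup>+} =
    insert x {a. (x', a) \<in> (arcs T)\<^sup>* \<and> (a, w) \<in> (arcs T)\<^sup>+}"
proof -
  have "(x, w) \<in> (arcs T)\<^sup>+"
    using assms by (rule rtrancl_into_trancl2)
  then show ?thesis
    using rtrancl_via_parent[OF _ assms(1)] converse_rtrancl_into_rtrancl[OF assms(1)] by blast
qed

lemma finite_path_set:
  "(x, w) \<in> (arcs T)\<^sup>* \<Longrightarrow> finite {a. (x, a) \<in> (arcs T)\<^sup>* \<and> (a, w) \<in> (arcs T)\<^sup>+}"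
proof (induction rule: converse_rtrancl_induct)
  case base
  have "{a. (w, a) \<in> (arcs T)\<^sup>* \<and> (a, w) \<in> (arcs T)\<^sup>+} = {}"
    using acyc by (auto dest: rtrancl_trancl_trancl)
  then show ?case by (simp only: finite.emptyI)
next
  case (step x x')
  then show ?case
    by (simp add: path_set_step)
qed

lemma left_weight_self: "left_weight w w = 0"
proof -
  have "{a. (w, a) \<in> (arcs T)\<^sup>* \<and> (a, w) \<in> (arcs T)\<^sup>+} = {}"
    using acyc by (auto dest: rtrancl_trancl_trancl)
  then show ?thesis by (simp only: left_weight_def sum.empty)
qed

lemma left_weight_step:
  assumes "(x, x') \<in> arcs T" "(x', w) \<in> (arcs T)\<^sup>*"
  shows "left_weight w x = left_siblings x + left_weight w x'"
proof -
  have "(x', x) \<notin> (arcs T)\<^sup>*"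
    using acyc rtrancl_into_trancl2[OF assms(1)] by blast
  then show ?thesis
    using path_set_step[OF assms] finite_path_set[OF assms(2)] by (simp add: left_weight_def)
qed

lemma left_weight_ge:
  assumes "(x, s) \<in> (arcs T)\<^sup>*" "(s, w) \<in> (arcs T)\<^sup>+"
  shows "left_siblings s \<le> left_weight w x"
  unfolding left_weight_def
  using assms finite_path_set[OF rtrancl_trans[OF assms(1) trancl_into_rtrancl[OF assms(2)]]]
  by (intro member_le_sum) auto

lemma left_siblings_less:
  assumes "sib_less x s"
  shows "left_siblings x < left_siblings s"
  unfolding left_siblings_def
proof (rule psubset_card_mono[OF finite_sib_less])
  obtain w where w: "(x, w) \<in> arcs T" "(s, w) \<in> arcs T" "lt T x s"
    using assms by (auto simp: sib_less_def)
  show "{t. sib_less t x} \<subset> {t. sib_less t s}"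
    unfolding sib_less_set[OF w(1)] sib_less_set[OF w(2)]
    using w lt_irrefl lt_trans[of _ w x s] by (auto simp: children_def)
qed

lemma left_siblings_next:
  assumes "next_sibling T x s"
  shows "left_siblings s = Suc (left_siblings x)"
proof -
  obtain w where w: "(x, w) \<in> arcs T" "(s, w) \<in> arcs T" "lt T x s"
    "\<And>t. \<lbrakk>(t, w) \<in> arcs T; lt T x t\<rbrakk> \<Longrightarrow> t = s \<or> lt T s t"
    using assms by (auto simp: next_sibling_def children_def)
  have "t = x \<or> lt T t x" if "(t, w) \<in> arcs T" "lt T t s" for t
    using w(4)[OF that(1)] that lt_irrefl[OF w(2)] lt_trans[OF w(2) that(1) w(2)]
      lt_total[OF that(1) w(1)] by blast
  then have "{t. sib_less t s} = insert x {t. sib_less t x}"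
    unfolding sib_less_set[OF w(1)] sib_less_set[OF w(2)]
    using w lt_trans[OF _ w(1,2)] by (auto simp: children_def)
  moreover have "x \<notin> {t. sib_less t x}"
    using sib_lessD(3) by auto
  ultimately show ?thesis
    using finite_sib_less by (simp add: left_siblings_def)
qed

lemma left_siblings_last:
  assumes "last_child T x w"
  shows "card (children T w) = Suc (left_siblings x)"
proof -
  have x: "(x, w) \<in> arcs T" "\<And>t. (t, w) \<in> arcs T \<Longrightarrow> \<not> lt T x t"
    using assms by (auto simp: last_child_def children_def)
  have "{t. sib_less t x} = children T w - {x}"
    unfolding sib_less_set[OF x(1)] using x(2) lt_irrefl[OF x(1)] lt_total[OF x(1)]
    by (auto simp: children_def)
  then show ?thesis
    using x(1) finite_children[of w] card_Suc_Diff1[of "children T w" x]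
    by (simp add: left_siblings_def children_def)
qed

text \<open>First children have no left siblings, so the descent from \<open>s\<close> to
  \<open>q\<close> adds only zeros.\<close>

lemma left_weight_first_leaf:
  "\<lbrakk>first_leaf T s q; (s, w) \<in> (arcs T)\<^sup>*\<rbrakk> \<Longrightarrow> left_weight w q = left_weight w s"
proof (induction rule: first_leaf.induct)
  case (descend s c q)
  have c: "(c, s) \<in> arcs T" "\<And>d. (d, s) \<in> arcs T \<Longrightarrow> d = c \<or> lt T c d"
    using descend(1) by (auto simp: first_child_def children_def)
  have "{t. sib_less t c} = {}"
    unfolding sib_less_set[OF c(1)] using c(2) lt_irrefl[OF c(1)] lt_trans[OF c(1) _ c(1)]
    by (auto simp: children_def)
  then have "left_siblings c = 0"
    by (simp add: left_siblings_def)
  then have "left_weight w c = left_weight w s"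
    using left_weight_step[OF c(1) descend.prems] by simp
  then show ?case
    using descend.IH converse_rtrancl_into_rtrancl[OF c(1) descend.prems] by simp
qed simp

lemma first_leaf_childless: "first_leaf T s q \<Longrightarrow> children T q = {}"
  by (induction rule: first_leaf.induct) auto

text \<open>Along the succession line, the number of left siblings on the way up to a fixed ancestor is
  the height of the Lukasiewicz path of the offspring numbers.\<close>

lemma left_weight_succ:
  assumes "(x, x') \<in> succ_rel T" "(x, w) \<in> (arcs T)\<^sup>+"
  shows "int (card (children T x')) - 1 = int (left_weight w x) - int (left_weight w x')"
proof -
  consider "last_child T x x'" | s where "next_sibling T x s" "first_leaf T s x'"
    using assms(1) by (auto simp: succ_rel_def)
  then show ?thesis
  proof cases
    case 1
    then have a: "(x, x') \<in> arcs T"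
      by (simp add: last_child_def children_def)
    have "(x', w) \<in> (arcs T)\<^sup>*"
      using rtrancl_via_parent[OF trancl_into_rtrancl[OF assms(2)] a] acyc assms(2) by auto
    \<comment> \<open>Going up to the parent loses the term of \<open>x\<close>, and a last child
      has one left sibling fewer than its parent has children.\<close>
    then show ?thesis
      using left_weight_step[OF a] left_siblings_last[OF 1] by simp
  next
    case 2
    then obtain z where z: "(x, z) \<in> arcs T" "(s, z) \<in> arcs T"
      by (auto simp: next_sibling_def children_def)
    have zw: "(z, w) \<in> (arcs T)\<^sup>*"
      using rtrancl_via_parent[OF trancl_into_rtrancl[OF assms(2)] z(1)] acyc assms(2) by auto
    have "left_weight w x' = left_weight w s"
      using left_weight_first_leaf[OF 2(2)] converse_rtrancl_into_rtrancl[OF z(2) zw] by simp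
    \<comment> \<open>Here \<open>x'\<close> is a leaf, so the left side is \<open>- 1\<close>; the
      two weights differ only in the term of \<open>x\<close> against that of its next
      sibling.\<close>
    then show ?thesis
      using left_weight_step[OF z(1) zw] left_weight_step[OF z(2) zw]
        left_siblings_next[OF 2(1)] first_leaf_childless[OF 2(2)] by simp
  qed
qed

lemma succ_line_less:
  assumes "succ_line T u" "i < j"
  shows "rls_less T (u i) (u j)"
  using succ_pow_less[OF succ_line_relpow[OF assms(1), of i "nat (j - i)"]] assms(2) by simp

lemma succ_line_less_iff:
  assumes "succ_line T u"
  shows "rls_less T (u i) (u j) \<longleftrightarrow> i < j"
  using succ_line_less[OF assms] rls_asym rls_irrefl by (metis linorder_neqE)

lemma succ_line_inj: "succ_line T u \<Longrightarrow> u i = u j \<longleftrightarrow> i = j"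
  using succ_line_less_iff rls_irrefl by (metis linorder_neqE)

lemma offspring_seq_succ_line:
  assumes "succ_line T u"
  shows "offspring_seq T (u i) n = int (card (children T (u (i + n + 1)))) - 1"
proof -
  have "(u i, u (i + n + 1)) \<in> nth_succ T (n + 1)"
    using succ_line_nth[OF assms, of i "n + 1"] by (simp add: algebra_simps)
  then have "(\<exists>x. (u i, x) \<in> nth_succ T (n + 1) \<and> card (children T x) = k) \<longleftrightarrow>
      card (children T (u (i + n + 1))) = k" for k
    using nth_succ_unique by blast
  then show ?thesis
    by (simp add: offspring_seq_def Least_equality)
qed

end

context interval_finite_eft
begin

lemma exists_nth_succ:
  assumes "v \<in> verts T" "\<And>n. \<exists>p. (p, v) \<in> succ_rel T ^^ n"
  shows "\<exists>q. (v, q) \<in> nth_succ T n"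
  using assms(2)[of "nat (- n)"] exists_succ_pow[OF assms(1), of "nat n"] by (auto simp: nth_succ_def)

text \<open>The RLS order is total with finite intervals, so each vertex is finitely many successor
  steps after or before \<open>u 0\<close>.\<close>

lemma succ_line_verts:
  assumes "succ_line T u"
  shows "verts T = range u"
proof
  show "range u \<subseteq> verts T"
    using assms succ_verts by (auto simp: succ_line_def)
  show "verts T \<subseteq> range u"
  proof
    fix v assume v: "v \<in> verts T"
    have u0: "u 0 \<in> verts T"
      using assms succ_verts by (auto simp: succ_line_def)
    consider "v = u 0" | "rls_less T (u 0) v" | "rls_less T v (u 0)"
      using rls_total[OF v u0] by blast
    then show "v \<in> range u"
    proof cases
      case 2
      then obtain n where "(u 0, v) \<in> succ_rel T ^^ n"
        using less_imp_succ_pow by blast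
      then have "v = u (0 + int n)"
        using succ_line_relpow[OF assms, of 0 n] single_valued_relpow[OF single_valued_succ(1)]
        by metis
      then show ?thesis by simp
    next
      case 3
      then obtain n where "(v, u 0) \<in> succ_rel T ^^ n"
        using less_imp_succ_pow by blast
      then have "v = u (- int n)"
        using succ_line_relpow[OF assms, of "- int n" n]
          single_valued_converse_relpow[OF single_valued_succ(2), of v "u 0" n] by simp
      then show ?thesis by simp
    qed simp
  qed
qed

text \<open>The partial sum up to \<open>m\<close> is the left weight of \<open>u i\<close> minus
  that of \<open>u m\<close>, both relative to the parent \<open>u j\<close>. The first is just the
  number of left siblings of \<open>u i\<close>. For \<open>m\<close> strictly between,
  \<open>u m\<close> lies under a later sibling of \<open>u i\<close>, whose own term already
  exceeds this number, so the sum is negative; at \<open>m = j\<close> the weight is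
  \<open>0\<close> and the sum nonnegative.\<close>

lemma record_map_succ_line:
  assumes u: "succ_line T u" and y: "\<And>n. y n = int (card (children T (u (n + 1)))) - 1"
    and w: "(u i, u j) \<in> arcs T"
  shows "i < j" "record_map y i = j"
proof -
  show ij: "i < j"
    using rls_parent[OF w] succ_line_less_iff[OF u] by simp
  \<comment> \<open>What lies strictly between a vertex and its parent in the RLS order hangs below
    a later sibling of that vertex.\<close>
  have above: "\<exists>s. (u m, s) \<in> (arcs T)\<^sup>* \<and> (s, u j) \<in> arcs T \<and> sib_less (u i) s"
    if m: "i < m" "m < j" for m
  proof -
    have nb: "\<not> rls_less T (u j) (u m)" "u m \<noteq> u j"
      using succ_line_less_iff[OF u] succ_line_inj[OF u] m by auto
    have im: "rls_less T (u i) (u m)"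
      using succ_line_less[OF u m(1)] .
    have V: "u m \<in> verts T" "u j \<in> verts T"
      using succ_line_verts[OF u] by auto
    from im[unfolded rls_less_iff] show ?thesis
    proof (elim conjE disjE exE)
      assume a: "(u i, u m) \<in> (arcs T)\<^sup>+"
      then have "(u j, u m) \<in> (arcs T)\<^sup>*"
        using rtrancl_via_parent[OF trancl_into_rtrancl[OF a] w] acyc by auto
      then show ?thesis
        using descendant_le[OF _ V(1)] nb by metis
    next
      fix a b assume ab: "(u i, a) \<in> (arcs T)\<^sup>*" "(u m, b) \<in> (arcs T)\<^sup>*" "sib_less a b"
      consider "a = u i" | "(u j, a) \<in> (arcs T)\<^sup>*"
        using rtrancl_via_parent[OF ab(1) w] by auto
      then show ?thesis
      proof cases
        case 1
        then have "(b, u j) \<in> arcs T"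
          using ab(3) w single_valuedD[OF sv] by (auto simp: sib_less_def)
        then show ?thesis
          using ab 1 by blast
      next
        case 2
        then have "rls_less T (u j) (u m)"
          using ab V by (auto simp: rls_less_iff)
        then show ?thesis
          using nb by blast
      qed
    qed
  qed
  have below: "(u m, u j) \<in> (arcs T)\<^sup>+" if "i \<le> m" "m < j" for m
  proof (cases "m = i")
    case False
    then obtain s where "(u m, s) \<in> (arcs T)\<^sup>*" "(s, u j) \<in> arcs T"
      using above[of m] \<open>i \<le> m\<close> \<open>m < j\<close> by auto
    then show ?thesis
      by (rule rtrancl_into_trancl1)
  qed (use w in auto)
  \<comment> \<open>A telescoping sum of \<open>left_weight_succ\<close>, empty for
    \<open>m = i\<close>. It is restricted to \<open>m \<le> j\<close> because
    \<open>left_weight_succ\<close> needs the vertex being left to be strictly below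
    \<open>u j\<close>.\<close>
  have sums: "m \<le> j \<longrightarrow>
      (\<Sum>l\<in>{i..m - 1}. y l) = int (left_weight (u j) (u i)) - int (left_weight (u j) (u m))"
    if "i \<le> m" for m
    using that
  proof (induction m rule: int_ge_induct)
    case (step m)
    show ?case
    proof
      assume mj: "m + 1 \<le> j"
      have "(u m, u (m + 1)) \<in> succ_rel T"
        using u by (simp add: succ_line_def)
      then have "y m = int (left_weight (u j) (u m)) - int (left_weight (u j) (u (m + 1)))"
        using left_weight_succ below[of m] step.hyps mj y[of m] by simp
      moreover have "{i..m + 1 - 1} = insert m {i..m - 1}"
        using step.hyps by auto
      ultimately show
        "(\<Sum>l\<in>{i..m + 1 - 1}. y l) = int (left_weight (u j) (u i)) - int (left_weight (u j) (u (m + 1)))"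
        using step.IH mj by simp
    qed
  qed simp
  have start: "left_weight (u j) (u i) = left_siblings (u i)"
    using left_weight_step[OF w rtrancl_refl] left_weight_self by simp
  have neg: "(\<Sum>l\<in>{i..m - 1}. y l) < 0" if m: "i < m" "m < j" for m
  proof -
    obtain s where s: "(u m, s) \<in> (arcs T)\<^sup>*" "(s, u j) \<in> arcs T" "sib_less (u i) s"
      using above[OF m] by blast
    have "left_siblings (u i) < left_weight (u j) (u m)"
      using left_siblings_less[OF s(3)] left_weight_ge[OF s(1) r_into_trancl[OF s(2)]] by simp
    then show ?thesis
      using sums[of m] start m by simp
  qed
  have nonneg: "0 \<le> (\<Sum>l\<in>{i..j - 1}. y l)"
    using sums[of j] ij left_weight_self by simp
  have "Inf {k. i < k \<and> 0 \<le> (\<Sum>l\<in>{i..k - 1}. y l)} = j"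
  proof (rule cInf_eq_minimum)
    fix k assume "k \<in> {k. i < k \<and> 0 \<le> (\<Sum>l\<in>{i..k - 1}. y l)}"
    then show "j \<le> k"
      using neg[of k] by force
  qed (use ij nonneg in auto)
  then show "record_map y i = j"
    using ij nonneg by (auto simp: record_map_def)
qed

lemma record_graph_iso:
  assumes u: "succ_line T u" and y: "\<And>n. y n = int (card (children T (u (n + 1)))) - 1"
  shows "odigraph_iso u (component (record_graph y) i) T"
proof -
  have arcs_iff: "(k, l) \<in> arcs (record_graph y) \<longleftrightarrow> (u k, u l) \<in> arcs T" for k l
  proof -
    obtain w where "(u k, w) \<in> arcs T"
      using ex_parent succ_line_verts[OF u] by blast
    then obtain j where j: "(u k, u j) \<in> arcs T"
      using arcs_verts succ_line_verts[OF u] by (metis rangeE)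
    have "(k, l) \<in> arcs (record_graph y) \<longleftrightarrow> l = j"
      using record_map_succ_line[OF u y j] by (auto simp: record_graph_def)
    also have "\<dots> \<longleftrightarrow> (u k, u l) \<in> arcs T"
      using j single_valuedD[OF sv, of "u k"] succ_line_inj[OF u, of l j] by metis
    finally show ?thesis .
  qed
  \<comment> \<open>Paths in \<open>T\<close> lift along \<open>u\<close> to the record graph, so
    connectedness of \<open>T\<close> makes the component of \<open>i\<close> the whole
    graph.\<close>
  have reach: "\<exists>k. v = u k \<and> (i, k) \<in> (adj (record_graph y))\<^sup>*" if "(u i, v) \<in> (adj T)\<^sup>*" for v
    using that
  proof (induction rule: rtrancl_induct)
    case (step v v')
    then obtain k where k: "v = u k" "(i, k) \<in> (adj (record_graph y))\<^sup>*"
      by blast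
    have "v' \<in> verts T"
      using step arcs_verts by (auto simp: adj_def)
    then obtain l where l: "v' = u l"
      using succ_line_verts[OF u] by auto
    then have "(k, l) \<in> adj (record_graph y)"
      using step k by (simp add: adj_def arcs_iff)
    with k(2) have "(i, l) \<in> (adj (record_graph y))\<^sup>*"
      by (rule rtrancl_into_rtrancl)
    with l show ?case by blast
  qed auto
  have "(i, k) \<in> (adj (record_graph y))\<^sup>*" for k
    using reach[of "u k"] adj_rtrancl[of "u i" "u k"] succ_line_verts[OF u] succ_line_inj[OF u]
    by auto
  then have vs: "verts (component (record_graph y) i) = UNIV"
    and as: "arcs (component (record_graph y) i) = arcs (record_graph y)"
    and ls: "lt (component (record_graph y) i) = (<)"
    by (auto simp: component_def restrict_verts_def record_graph_def)
  show ?thesis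
    unfolding odigraph_iso_def vs as ls children_def
  proof (intro conjI ballI)
    show "bij_betw u UNIV (verts T)"
      using succ_line_verts[OF u] succ_line_inj[OF u] by (auto simp: bij_betw_def inj_on_def)
    show "(k, l) \<in> arcs (record_graph y) \<longleftrightarrow> (u k, u l) \<in> arcs T" for k l
      by (rule arcs_iff)
    fix w k l assume "k \<in> {k. (k, w) \<in> arcs (record_graph y)}" "l \<in> {k. (k, w) \<in> arcs (record_graph y)}"
    then have kl: "(u k, u w) \<in> arcs T" "(u l, u w) \<in> arcs T"
      by (simp_all add: arcs_iff)
    \<comment> \<open>The order of siblings is part of the RLS order, which the line translates into
      the order of the integers.\<close>
    have lt_less: "a < b" if "lt T (u a) (u b)" "(u a, u w) \<in> arcs T" "(u b, u w) \<in> arcs T" for a b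
    proof -
      have "sib_less (u a) (u b)"
        using that by (auto simp: sib_less_def)
      then have "rls_less T (u a) (u b)"
        using that arcs_verts by (auto simp: rls_less_iff)
      then show ?thesis
        using succ_line_less_iff[OF u] by simp
    qed
    show "k < l \<longleftrightarrow> lt T (u k) (u l)"
      using lt_less[of k l] lt_less[of l k] kl lt_total[OF kl] succ_line_inj[OF u] by force
  qed
qed

end

section \<open>Isomorphisms of trees and balls\<close>

definition valid :: "nat \<Rightarrow> 'v odigraph \<Rightarrow> 'v list \<Rightarrow> bool" where
  "valid k T os \<longleftrightarrow> ordered_family_tree T \<and> set os \<subseteq> verts T \<and> length os = k"

lemma arcs_in_verts: "\<lbrakk>ordered_family_tree T; (u, v) \<in> arcs T\<rbrakk> \<Longrightarrow> u \<in> verts T \<and> v \<in> verts T"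
  by (meson ordered_tree.arcs_verts ordered_tree.intro)

lemma odigraph_iso_id: "odigraph_iso id T T"
  by (simp add: odigraph_iso_def)

lemma odigraph_iso_children:
  assumes "odigraph_iso f S T" "arcs S \<subseteq> verts S \<times> verts S" "w \<in> verts S" "u \<in> children S w"
  shows "f u \<in> children T (f w)" "u \<in> verts S"
  using assms by (auto simp: odigraph_iso_def children_def)

lemma odigraph_iso_comp:
  assumes f: "odigraph_iso f S T" and g: "odigraph_iso g T U" and S: "arcs S \<subseteq> verts S \<times> verts S"
  shows "odigraph_iso (g \<circ> f) S U"
  unfolding odigraph_iso_def
proof (intro conjI ballI)
  show "bij_betw (g \<circ> f) (verts S) (verts U)"
    using f g by (auto simp: odigraph_iso_def intro: bij_betw_trans)
  have fv: "f u \<in> verts T" if "u \<in> verts S" for u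
    using f that by (auto simp: odigraph_iso_def bij_betw_def)
  show "(u, v) \<in> arcs S \<longleftrightarrow> ((g \<circ> f) u, (g \<circ> f) v) \<in> arcs U" if "u \<in> verts S" "v \<in> verts S" for u v
    using f g that fv by (simp add: odigraph_iso_def)
  show "lt S u v \<longleftrightarrow> lt U ((g \<circ> f) u) ((g \<circ> f) v)"
    if w: "w \<in> verts S" and uv: "u \<in> children S w" "v \<in> children S w" for w u v
  proof -
    have "lt S u v \<longleftrightarrow> lt T (f u) (f v)"
      using f w uv unfolding odigraph_iso_def by blast
    also have "\<dots> \<longleftrightarrow> lt U (g (f u)) (g (f v))"
      using g fv[OF w] odigraph_iso_children(1)[OF f S w] uv unfolding odigraph_iso_def by blast
    finally show ?thesis by simp
  qed
qed

lemma odigraph_iso_inv: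
  assumes f: "odigraph_iso f S T" and T: "arcs T \<subseteq> verts T \<times> verts T"
  shows "odigraph_iso (inv_into (verts S) f) T S"
proof -
  let ?g = "inv_into (verts S) f"
  have b: "bij_betw f (verts S) (verts T)"
    using f by (simp add: odigraph_iso_def)
  have g: "?g v \<in> verts S" "f (?g v) = v" if "v \<in> verts T" for v
    using b that by (auto simp: bij_betw_def inv_into_into f_inv_into_f)
  have a: "(u, v) \<in> arcs T \<longleftrightarrow> (?g u, ?g v) \<in> arcs S" if "u \<in> verts T" "v \<in> verts T" for u v
    using f g[OF that(1)] g[OF that(2)] by (simp add: odigraph_iso_def)
  show ?thesis
    unfolding odigraph_iso_def
  proof (intro conjI ballI)
    show "bij_betw ?g (verts T) (verts S)"
      by (rule bij_betw_inv_into[OF b])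
    show "(u, v) \<in> arcs T \<longleftrightarrow> (?g u, ?g v) \<in> arcs S" if "u \<in> verts T" "v \<in> verts T" for u v
      using a that .
    fix w u v assume w: "w \<in> verts T" and uv: "u \<in> children T w" "v \<in> children T w"
    then have V: "u \<in> verts T" "v \<in> verts T"
      using T by (auto simp: children_def)
    have "?g u \<in> children S (?g w)" "?g v \<in> children S (?g w)"
      using a[OF V(1) w] a[OF V(2) w] uv by (auto simp: children_def)
    then have "lt S (?g u) (?g v) \<longleftrightarrow> lt T (f (?g u)) (f (?g v))"
      using f g(1)[OF w] unfolding odigraph_iso_def by blast
    then show "lt T u v \<longleftrightarrow> lt S (?g u) (?g v)"
      using g V by simp
  qed
qed

lemma rooted_iso_refl: "rooted_iso T os T os"
  unfolding rooted_iso_def using odigraph_iso_id by (metis list.map_id)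

lemma rooted_iso_trans:
  assumes "rooted_iso S os T ps" "rooted_iso T ps U qs" "arcs S \<subseteq> verts S \<times> verts S"
  shows "rooted_iso S os U qs"
  using assms odigraph_iso_comp unfolding rooted_iso_def by (metis map_map)

lemma rooted_iso_sym:
  assumes "rooted_iso S os T ps" "arcs T \<subseteq> verts T \<times> verts T" "set os \<subseteq> verts S"
  shows "rooted_iso T ps S os"
proof -
  obtain f where f: "odigraph_iso f S T" "map f os = ps"
    using assms(1) by (auto simp: rooted_iso_def)
  have "inj_on f (verts S)"
    using f by (simp add: odigraph_iso_def bij_betw_def)
  then have "map (inv_into (verts S) f) ps = os"
    using f(2) assms(3) by (auto simp: map_idI subset_iff)
  then show ?thesis
    using odigraph_iso_inv[OF f(1) assms(2)] by (auto simp: rooted_iso_def)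
qed

lemma valid_arcs: "valid k T os \<Longrightarrow> arcs T \<subseteq> verts T \<times> verts T"
  by (auto simp: valid_def dest: arcs_in_verts)

text \<open>The vertex types may differ: this is what identifies the class of a component of the
  record graph on \<open>int\<close> with the class of a tree on \<open>nat\<close>.\<close>

lemma tree_class_eq:
  assumes "rooted_iso S os T ps" "arcs S \<subseteq> verts S \<times> verts S" "arcs T \<subseteq> verts T \<times> verts T"
    "set os \<subseteq> verts S"
  shows "tree_class S os = tree_class T ps"
  using assms rooted_iso_trans[OF rooted_iso_sym[OF assms(1,3,4)]] rooted_iso_trans[OF assms(1)]
  unfolding tree_class_def by blast

text \<open>The same choice as in \<open>vertex_sum\<close>, so that vertex sums range over the
  vertices of \<open>tree_of C\<close> literally and not just up to isomorphism.\<close>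

definition rep :: "tree_class \<Rightarrow> nat odigraph \<times> nat list" where
  "rep C = (SOME R. R \<in> C)"

definition tree_of :: "tree_class \<Rightarrow> nat odigraph" where
  "tree_of C = fst (rep C)"

definition roots_of :: "tree_class \<Rightarrow> nat list" where
  "roots_of C = snd (rep C)"

lemma rooted_iso_length: "rooted_iso T os S ps \<Longrightarrow> length ps = length os"
  by (auto simp: rooted_iso_def)

lemma tree_class_self:
  fixes T :: "nat odigraph"
  shows "valid k T os \<Longrightarrow> (T, os) \<in> tree_class T os"
  using rooted_iso_refl by (auto simp: tree_class_def valid_def)

lemma tree_class_in_tree_classes:
  fixes T :: "nat odigraph"
  shows "valid k T os \<Longrightarrow> tree_class T os \<in> tree_classes k"
  by (auto simp: tree_classes_def valid_def)

lemma mem_tree_class: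
  fixes T :: "nat odigraph"
  assumes "valid k T os" "(S, ps) \<in> tree_class T os"
  shows "valid k S ps" "rooted_iso T os S ps" "tree_class S ps = tree_class T os"
proof -
  show v: "valid k S ps" and i: "rooted_iso T os S ps"
    using assms rooted_iso_length by (auto simp: tree_class_def valid_def)
  show "tree_class S ps = tree_class T os"
    using tree_class_eq[OF i] valid_arcs[OF v] valid_arcs[OF assms(1)] assms(1)
    by (simp add: valid_def)
qed

lemma rep_tree_class:
  fixes T :: "nat odigraph"
  assumes "valid k T os"
  shows "valid k (tree_of (tree_class T os)) (roots_of (tree_class T os))"
    "rooted_iso T os (tree_of (tree_class T os)) (roots_of (tree_class T os))"
    "(tree_of (tree_class T os), roots_of (tree_class T os)) \<in> tree_class T os"
proof -
  have "rep (tree_class T os) \<in> tree_class T os"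
    unfolding rep_def using tree_class_self[OF assms] by (rule someI)
  then show *: "(tree_of (tree_class T os), roots_of (tree_class T os)) \<in> tree_class T os"
    by (simp add: tree_of_def roots_of_def)
  show "valid k (tree_of (tree_class T os)) (roots_of (tree_class T os))"
    "rooted_iso T os (tree_of (tree_class T os)) (roots_of (tree_class T os))"
    using mem_tree_class[OF assms *] by auto
qed

lemma rep_tree_classes:
  assumes "C \<in> tree_classes k"
  shows "valid k (tree_of C) (roots_of C)" "C = tree_class (tree_of C) (roots_of C)"
    "(tree_of C, roots_of C) \<in> C"
proof -
  obtain T :: "nat odigraph" and os where T: "valid k T os" "C = tree_class T os"
    using assms unfolding tree_classes_def valid_def by blast
  show "valid k (tree_of C) (roots_of C)" "(tree_of C, roots_of C) \<in> C"
    using rep_tree_class[OF T(1)] T(2) by auto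
  then show "C = tree_class (tree_of C) (roots_of C)"
    using mem_tree_class(3)[OF T(1)] T(2) by simp
qed

section \<open>What an isomorphism of balls preserves\<close>

definition ball_iso :: "nat \<Rightarrow> 'v odigraph \<Rightarrow> 'v list \<Rightarrow> 'w odigraph \<Rightarrow> 'w list \<Rightarrow> ('v \<Rightarrow> 'w) \<Rightarrow> bool" where
  "ball_iso r T os S ps f \<longleftrightarrow>
     odigraph_iso f (root_ball T os r) (root_ball S ps r) \<and> map f os = ps"

definition near :: "'v odigraph \<Rightarrow> 'v list \<Rightarrow> nat \<Rightarrow> 'v set" where
  "near T os k = {v. \<exists>p\<in>set os. \<exists>n\<le>k. (p, v) \<in> adj T ^^ n}"

lemma near_Suc: "\<lbrakk>v \<in> near T os k; (v, w) \<in> adj T\<rbrakk> \<Longrightarrow> w \<in> near T os (Suc k)"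
  unfolding near_def by (auto intro: relpow_Suc_I)

lemma near_mono: "k \<le> l \<Longrightarrow> near T os k \<subseteq> near T os l"
  unfolding near_def by (auto intro: order_trans)

lemma adj_relpow_verts:
  assumes "ordered_family_tree T" "p \<in> verts T" "(p, v) \<in> adj T ^^ n"
  shows "v \<in> verts T"
  using assms(3,2)
proof (induction n arbitrary: v)
  case (Suc n)
  then show ?case
    using arcs_in_verts[OF assms(1)] by (auto simp: adj_def)
qed simp

lemma near_verts: "valid k T os \<Longrightarrow> near T os r \<subseteq> verts T"
  using adj_relpow_verts by (fastforce simp: near_def valid_def)

lemma root_ball_simps:
  assumes "valid k T os"
  shows "verts (root_ball T os r) = near T os r"
    "arcs (root_ball T os r) = arcs T \<inter> near T os r \<times> near T os r"
    "lt (root_ball T os r) = lt T"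
  using near_verts[OF assms, of r] by (auto simp: root_ball_def near_def restrict_verts_def)

lemma exists_near:
  assumes "valid k T os" "0 < k" "v \<in> verts T"
  shows "\<exists>m. v \<in> near T os m"
proof -
  interpret ordered_tree T
    using assms by unfold_locales (simp add: valid_def)
  obtain p where p: "p \<in> set os" "p \<in> verts T"
    using assms by (cases os) (auto simp: valid_def)
  then obtain n where "(p, v) \<in> adj T ^^ n"
    using adj_rtrancl[OF p(2) assms(3)] by (auto simp: rtrancl_power)
  then show ?thesis
    using p by (auto simp: near_def)
qed

lemma ball_iso_facts:
  assumes T: "valid k T os" and S: "valid k S ps" and iso: "ball_iso r T os S ps f"
  shows "bij_betw f (near T os r) (near S ps r)"
    "\<And>u v. \<lbrakk>u \<in> near T os r; v \<in> near T os r\<rbrakk> \<Longrightarrow> (u, v) \<in> arcs T \<longleftrightarrow> (f u, f v) \<in> arcs S"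
    "\<And>w u v. \<lbrakk>w \<in> near T os r; u \<in> near T os r; v \<in> near T os r;
        (u, w) \<in> arcs T; (v, w) \<in> arcs T\<rbrakk> \<Longrightarrow> lt T u v \<longleftrightarrow> lt S (f u) (f v)"
    "map f os = ps"
  using iso bij_betwE[of f "near T os r" "near S ps r"]
  unfolding ball_iso_def odigraph_iso_def root_ball_simps[OF T] root_ball_simps[OF S] children_def
  by auto

lemma ball_iso_near:
  assumes T: "valid k T os" and S: "valid k S ps" and iso: "ball_iso r T os S ps f"
    and "v \<in> near T os m" "m \<le> r"
  shows "f v \<in> near S ps m"
proof -
  note F = ball_iso_facts[OF T S iso]
  have "(f p, f v) \<in> adj S ^^ n" if "p \<in> set os" "(p, v) \<in> adj T ^^ n" "n \<le> r" for p v n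
    using that(2,3)
  proof (induction n arbitrary: v)
    case (Suc n)
    then obtain x where x: "(p, x) \<in> adj T ^^ n" "(x, v) \<in> adj T"
      by auto
    have "x \<in> near T os r" "v \<in> near T os r"
      using x(1) Suc.prems that(1) unfolding near_def by (blast intro: Suc_leD)+
    then have "(f x, f v) \<in> adj S"
      using x(2) F(2) by (auto simp: adj_def)
    then show ?case
      using Suc x(1) by auto
  qed simp
  moreover obtain p n where "p \<in> set os" "n \<le> m" "(p, v) \<in> adj T ^^ n"
    using assms(4) by (auto simp: near_def)
  ultimately have "(f p, f v) \<in> adj S ^^ n" "f p \<in> set ps"
    using assms(5) F(4) by auto
  then show ?thesis
    using \<open>n \<le> m\<close> by (auto simp: near_def)
qed

text \<open>The strict inequality \<open>m < r\<close> keeps all neighbours of \<open>v\<close> and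
  of \<open>f v\<close> inside the two balls, so \<open>f v\<close> cannot have a child outside the
  image of \<open>f\<close>.\<close>

lemma ball_iso_local:
  assumes T: "valid k T os" and S: "valid k S ps" and iso: "ball_iso r T os S ps f"
    and v: "v \<in> near T os m" "m < r"
  shows "f v \<in> verts S" "children S (f v) = f ` children T v"
    "\<And>w. (v, w) \<in> arcs T \<Longrightarrow> (f v, f w) \<in> arcs S"
    "\<And>c d. \<lbrakk>c \<in> children T v; d \<in> children T v\<rbrakk> \<Longrightarrow> lt S (f c) (f d) \<longleftrightarrow> lt T c d"
proof -
  note F = ball_iso_facts[OF T S iso]
  have vr: "v \<in> near T os r"
    using v near_mono[of m r T os] by auto
  have fv: "f v \<in> near S ps m"
    using ball_iso_near[OF T S iso v(1)] v(2) by simp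
  then show "f v \<in> verts S"
    using near_verts[OF S] by blast
  have nb: "w \<in> near T os r" if "(v, w) \<in> adj T" for w
    using near_Suc[OF v(1) that] near_mono[of "Suc m" r T os] v(2) by auto
  have nb': "w \<in> near S ps r" if "(f v, w) \<in> adj S" for w
    using near_Suc[OF fv that] near_mono[of "Suc m" r S ps] v(2) by auto
  have child: "w \<in> near T os r" if "(w, v) \<in> arcs T" for w
    using nb that by (simp add: adj_def)
  show "children S (f v) = f ` children T v"
  proof
    show "f ` children T v \<subseteq> children S (f v)"
      using F(2)[OF child vr] by (auto simp: children_def)
    show "children S (f v) \<subseteq> f ` children T v"
    proof
      fix c assume c: "c \<in> children S (f v)"
      then have "c \<in> near S ps r"
        using nb' by (auto simp: children_def adj_def)
      then obtain c' where c': "c' \<in> near T os r" "c = f c'"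
        using F(1) by (auto simp: bij_betw_def)
      then have "c' \<in> children T v"
        using F(2)[OF c'(1) vr] c by (simp add: children_def)
      then show "c \<in> f ` children T v"
        using c' by blast
    qed
  qed
  show "(f v, f w) \<in> arcs S" if "(v, w) \<in> arcs T" for w
  proof -
    have "w \<in> near T os r"
      using nb that by (simp add: adj_def)
    then show ?thesis
      using F(2)[OF vr] that by simp
  qed
  show "lt S (f c) (f d) \<longleftrightarrow> lt T c d" if "c \<in> children T v" "d \<in> children T v" for c d
    using F(3)[OF vr child child] that by (simp add: children_def)
qed

text \<open>An isomorphism preserves distances from the roots and hence restricts to balls of every
  radius; this makes properties visible in balls invariant.\<close>

lemma rooted_iso_imp_ball_iso:
  assumes T: "valid k T os" and S: "valid k S ps" and iso: "odigraph_iso f T S" "map f os = ps"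
  shows "ball_iso r T os S ps f"
proof -
  have b: "bij_betw f (verts T) (verts S)"
    and a: "\<And>u v. \<lbrakk>u \<in> verts T; v \<in> verts T\<rbrakk> \<Longrightarrow> (u, v) \<in> arcs T \<longleftrightarrow> (f u, f v) \<in> arcs S"
    and l: "\<And>w u v. \<lbrakk>w \<in> verts T; (u, w) \<in> arcs T; (v, w) \<in> arcs T\<rbrakk> \<Longrightarrow> lt T u v \<longleftrightarrow> lt S (f u) (f v)"
    using iso by (auto simp: odigraph_iso_def children_def)
  have aT: "\<And>u v. (u, v) \<in> adj T \<Longrightarrow> u \<in> verts T \<and> v \<in> verts T"
    and aS: "\<And>u v. (u, v) \<in> adj S \<Longrightarrow> u \<in> verts S \<and> v \<in> verts S"
    using valid_arcs[OF T] valid_arcs[OF S] by (auto simp: adj_def)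
  have os: "set os \<subseteq> verts T" and ps: "ps = map f os"
    using T iso(2) by (auto simp: valid_def)
  have ad: "(u, v) \<in> adj T \<longleftrightarrow> (f u, f v) \<in> adj S" if "u \<in> verts T" "v \<in> verts T" for u v
    using a[OF that] a[OF that(2,1)] by (auto simp: adj_def)
  have fwd: "(f p, f v) \<in> adj S ^^ n" if "(p, v) \<in> adj T ^^ n" for p v n
    using that
  proof (induction n arbitrary: v)
    case (Suc n)
    then obtain z where z: "(p, z) \<in> adj T ^^ n" "(z, v) \<in> adj T"
      by auto
    have "(f z, f v) \<in> adj S"
      using ad aT[OF z(2)] z(2) by blast
    with Suc.IH[OF z(1)] show ?case
      by (rule relpow_Suc_I)
  qed simp
  have bwd: "\<exists>v. x = f v \<and> v \<in> verts T \<and> (p, v) \<in> adj T ^^ n"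
    if "(f p, x) \<in> adj S ^^ n" "p \<in> verts T" for p x n
    using that
  proof (induction n arbitrary: x)
    case (Suc n)
    then obtain z where z: "(f p, z) \<in> adj S ^^ n" "(z, x) \<in> adj S"
      by auto
    then obtain v where v: "z = f v" "v \<in> verts T" "(p, v) \<in> adj T ^^ n"
      using Suc by blast
    obtain y where y: "x = f y" "y \<in> verts T"
      using aS[OF z(2)] b by (auto simp: bij_betw_def)
    then have "(v, y) \<in> adj T"
      using ad z v by blast
    with v(3) have "(p, y) \<in> adj T ^^ Suc n"
      by (rule relpow_Suc_I)
    then show ?case
      using y by blast
  qed auto
  have "f ` near T os r = near S ps r"
  proof
    show "f ` near T os r \<subseteq> near S ps r"
      unfolding near_def ps set_map using fwd by blast
    show "near S ps r \<subseteq> f ` near T os r"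
    proof
      fix x assume "x \<in> near S ps r"
      then obtain p n where "p \<in> set os" "n \<le> r" "(f p, x) \<in> adj S ^^ n"
        by (auto simp: near_def ps)
      then show "x \<in> f ` near T os r"
        using bwd[of p x n] os by (auto simp: near_def)
    qed
  qed
  then have br: "bij_betw f (near T os r) (near S ps r)"
    using b near_verts[OF T] unfolding bij_betw_def by (blast intro: inj_on_subset)
  then have n: "u \<in> verts T" "f u \<in> near S ps r" if "u \<in> near T os r" for u
    using subsetD[OF near_verts[OF T] that] bij_betwE[of f "near T os r" "near S ps r"] that by simp_all
  show ?thesis
    unfolding ball_iso_def odigraph_iso_def root_ball_simps[OF T] root_ball_simps[OF S]
  proof (intro conjI ballI)
    show "bij_betw f (near T os r) (near S ps r)"
      by (rule br)
    show "(u, v) \<in> arcs T \<inter> near T os r \<times> near T os r \<longleftrightarrow>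
        (f u, f v) \<in> arcs S \<inter> near S ps r \<times> near S ps r"
      if "u \<in> near T os r" "v \<in> near T os r" for u v
      using n(2)[OF that(1)] n(2)[OF that(2)] that a[OF n(1)[OF that(1)] n(1)[OF that(2)]] by simp
    fix w u v
    assume w: "w \<in> near T os r"
      and "u \<in> children (root_ball T os r) w" "v \<in> children (root_ball T os r) w"
    then have "(u, w) \<in> arcs T" "(v, w) \<in> arcs T"
      unfolding children_def root_ball_simps[OF T] by simp_all
    then show "lt T u v \<longleftrightarrow> lt S (f u) (f v)"
      by (rule l[OF n(1)[OF w]])
  qed (rule iso(2))
qed

section \<open>Local properties are measurable\<close>

text \<open>Stability is one-sided, matching open rather than clopen events: that \<open>q\<close> follows \<open>p\<close> is
  visible in a large enough ball, that \<open>p\<close> has no successor may not be.\<close>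

definition stable ::
  "nat odigraph \<Rightarrow> nat list \<Rightarrow> (nat odigraph \<Rightarrow> (nat \<Rightarrow> nat) \<Rightarrow> bool) \<Rightarrow> bool" where
  "stable T os Q \<longleftrightarrow> (\<forall>\<^sub>F r in sequentially.
     \<forall>S ps f. valid (length os) S ps \<longrightarrow> ball_iso r T os S ps f \<longrightarrow> Q S f)"

definition open_prop :: "nat \<Rightarrow> (nat odigraph \<Rightarrow> nat list \<Rightarrow> bool) \<Rightarrow> bool" where
  "open_prop k Q \<longleftrightarrow>
     (\<forall>T os. valid k T os \<longrightarrow> Q T os \<longrightarrow> stable T os (\<lambda>S f. Q S (map f os)))"

lemma stable_mono:
  assumes "stable T os Q" "\<And>S f. Q S f \<Longrightarrow> R S f"
  shows "stable T os R"
  using assms(1) unfolding stable_def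
  by (rule eventually_mono) (use assms(2) in blast)

lemma stable_conj:
  assumes "stable T os Q" "stable T os R"
  shows "stable T os (\<lambda>S f. Q S f \<and> R S f)"
  using assms unfolding stable_def by (rule eventually_elim2) blast

lemma stable_ball:
  assumes "finite A" "\<And>x. x \<in> A \<Longrightarrow> stable T os (Q x)"
  shows "stable T os (\<lambda>S f. \<forall>x\<in>A. Q x S f)"
proof -
  have "\<forall>\<^sub>F r in sequentially. \<forall>x\<in>A.
      \<forall>S ps f. valid (length os) S ps \<longrightarrow> ball_iso r T os S ps f \<longrightarrow> Q x S f"
    using assms by (simp add: eventually_ball_finite_distrib stable_def)
  then show ?thesis
    unfolding stable_def by (rule eventually_mono) blast
qed

locale rooted_tree = ordered_tree T for T :: "nat odigraph" +
  fixes os :: "nat list"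
  assumes roots: "set os \<subseteq> verts T" "os \<noteq> []"
begin

lemma valid_T: "valid (length os) T os"
  using oft roots by (simp add: valid_def)

lemma stable_local:
  assumes "v \<in> verts T"
  shows "stable T os (\<lambda>S f. f v \<in> verts S \<and> children S (f v) = f ` children T v \<and>
    (\<forall>w. (v, w) \<in> arcs T \<longrightarrow> (f v, f w) \<in> arcs S) \<and>
    (\<forall>c\<in>children T v. \<forall>d\<in>children T v. lt S (f c) (f d) \<longleftrightarrow> lt T c d))"
proof -
  obtain m where "v \<in> near T os m"
    using exists_near[OF valid_T _ assms] roots by auto
  then show ?thesis
    unfolding stable_def
  proof (intro eventually_mono[OF eventually_gt_at_top[of m]] allI impI)
    fix r S ps f
    assume "v \<in> near T os m" "m < r" "valid (length os) S ps" "ball_iso r T os S ps f"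
    note * = ball_iso_local[OF valid_T this(3,4,1,2)]
    show "f v \<in> verts S \<and> children S (f v) = f ` children T v \<and>
      (\<forall>w. (v, w) \<in> arcs T \<longrightarrow> (f v, f w) \<in> arcs S) \<and>
      (\<forall>c\<in>children T v. \<forall>d\<in>children T v. lt S (f c) (f d) \<longleftrightarrow> lt T c d)"
      using * by simp
  qed
qed

text \<open>A ball isomorphism is injective on its ball only, so the radius has to reach each of the
  finitely many vertices. Comparing cardinalities relies on this.\<close>

lemma stable_inj:
  assumes "finite A" "A \<subseteq> verts T"
  shows "stable T os (\<lambda>S f. inj_on f A)"
proof -
  have "\<forall>\<^sub>F r in sequentially. \<forall>v\<in>A. v \<in> near T os r"
  proof (intro eventually_ball_finite[OF assms(1)] ballI)
    fix v assume "v \<in> A"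
    then obtain m where "v \<in> near T os m"
      using exists_near[OF valid_T, of v] roots(2) subsetD[OF assms(2)] by auto
    then show "\<forall>\<^sub>F r in sequentially. v \<in> near T os r"
      by (intro eventually_mono[OF eventually_ge_at_top[of m]]) (rule subsetD[OF near_mono])
  qed
  then show ?thesis
    unfolding stable_def
  proof (elim eventually_mono, intro allI impI)
    fix r S ps f
    assume A: "\<forall>v\<in>A. v \<in> near T os r" and S: "valid (length os) S ps" "ball_iso r T os S ps f"
    have "inj_on f (near T os r)"
      using ball_iso_facts(1)[OF valid_T S] by (simp add: bij_betw_def)
    then show "inj_on f A"
      by (rule inj_on_subset) (use A in blast)
  qed
qed

lemma stable_arc:
  assumes "(u, v) \<in> arcs T"
  shows "stable T os (\<lambda>S f. (f u, f v) \<in> arcs S)"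
  using stable_local[of u] arcs_verts[OF assms] assms by (auto elim: stable_mono)

lemma stable_relpow:
  assumes "\<And>u v. (u, v) \<in> R T \<Longrightarrow> stable T os (\<lambda>S f. (f u, f v) \<in> R S)"
    and "(u, v) \<in> R T ^^ n"
  shows "stable T os (\<lambda>S f. (f u, f v) \<in> R S ^^ n)"
  using assms(2)
proof (induction n arbitrary: v)
  case 0
  then show ?case
    by (simp add: stable_def)
next
  case (Suc n)
  then obtain x where "(u, x) \<in> R T ^^ n" "(x, v) \<in> R T"
    by auto
  then have "stable T os (\<lambda>S f. (f u, f x) \<in> R S ^^ n \<and> (f x, f v) \<in> R S)"
    using Suc.IH assms(1) stable_conj by blast
  then show ?case
    by (rule stable_mono) auto
qed

lemma stable_last_child:
  assumes "last_child T p w"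
  shows "stable T os (\<lambda>S f. last_child S (f p) (f w))"
proof -
  have "w \<in> verts T"
    using assms arcs_verts by (auto simp: last_child_def children_def)
  from stable_local[OF this] show ?thesis
    by (rule stable_mono) (use assms in \<open>auto simp: last_child_def\<close>)
qed

lemma stable_next_sibling:
  assumes "next_sibling T p s"
  shows "stable T os (\<lambda>S f. next_sibling S (f p) (f s))"
proof -
  obtain w where w: "p \<in> children T w" "s \<in> children T w" "lt T p s"
     "\<forall>t\<in>children T w. lt T p t \<longrightarrow> t = s \<or> lt T s t"
    using assms by (auto simp: next_sibling_def)
  then have "w \<in> verts T"
    using arcs_verts by (auto simp: children_def)
  from stable_local[OF this] show ?thesis
  proof (rule stable_mono, goal_cases)
    case (1 S f)
    then show ?case
      unfolding next_sibling_def by (intro exI[of _ "f w"]) (use w in auto)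
  qed
qed

lemma stable_first_child:
  assumes "first_child T w c"
  shows "stable T os (\<lambda>S f. first_child S (f w) (f c))"
proof -
  have "w \<in> verts T"
    using assms arcs_verts by (auto simp: first_child_def children_def)
  from stable_local[OF this] show ?thesis
    by (rule stable_mono) (use assms in \<open>auto simp: first_child_def\<close>)
qed

text \<open>A derivation of \<open>first_leaf\<close> inspects finitely many vertices, each with its
  children visible in some ball. Rule induction combines the radii.\<close>

lemma stable_first_leaf:
  "first_leaf T s q \<Longrightarrow> stable T os (\<lambda>S f. first_leaf S (f s) (f q))"
proof (induction rule: first_leaf.induct)
  case (leaf s)
  from stable_local[OF leaf(1)] show ?case
    by (rule stable_mono) (use leaf in \<open>auto intro: first_leaf.leaf\<close>)
next
  case (descend s c q)
  from stable_conj[OF stable_first_child[OF descend(1)] descend.IH] show ?case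
    by (rule stable_mono) (auto intro: first_leaf.descend)
qed

lemma stable_succ:
  assumes "(p, q) \<in> succ_rel T"
  shows "stable T os (\<lambda>S f. (f p, f q) \<in> succ_rel S)"
proof -
  consider "last_child T p q" | s where "next_sibling T p s" "first_leaf T s q"
    using assms by (auto simp: succ_rel_def)
  then show ?thesis
  proof cases
    case 1
    from stable_last_child[OF this] show ?thesis
      by (rule stable_mono) (auto simp: succ_rel_def)
  next
    case 2
    from stable_conj[OF stable_next_sibling[OF 2(1)] stable_first_leaf[OF 2(2)]] show ?thesis
      by (rule stable_mono) (auto simp: succ_rel_def)
  qed
qed

lemma stable_nth_succ:
  assumes "(p, q) \<in> nth_succ T n"
  shows "stable T os (\<lambda>S f. (f p, f q) \<in> nth_succ S n)"
  using assms stable_relpow[of succ_rel, OF stable_succ]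
  by (cases "0 \<le> n") (auto simp: nth_succ_def)

end

section \<open>Generations of descendants\<close>

definition descendants :: "nat odigraph \<Rightarrow> nat \<Rightarrow> nat \<Rightarrow> nat set" where
  "descendants S n v = {u. (u, v) \<in> arcs S ^^ n}"

lemma descendants_0: "descendants S 0 v = {v}"
  by (auto simp: descendants_def)

lemma descendants_Suc: "descendants S (Suc n) v = (\<Union>x\<in>descendants S n v. children S x)"
  by (auto simp: descendants_def children_def relpow_commute[symmetric])

context rooted_tree
begin

lemma finite_descendants: "v \<in> verts T \<Longrightarrow> finite (descendants T n v) \<and> descendants T n v \<subseteq> verts T"
proof (induction n)
  case (Suc n)
  then show ?case
    using finite_children arcs_verts by (auto simp: descendants_Suc children_def)
qed (simp add: descendants_0)

lemma stable_descendants: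
  assumes "v \<in> verts T"
  shows "stable T os (\<lambda>S f. descendants S n (f v) = f ` descendants T n v)"
proof (induction n)
  case 0
  then show ?case
    by (simp add: descendants_0 stable_def)
next
  case (Suc n)
  have "stable T os (\<lambda>S f. \<forall>x\<in>descendants T n v. children S (f x) = f ` children T x)"
  proof (rule stable_ball)
    fix x assume "x \<in> descendants T n v"
    then have "x \<in> verts T"
      using finite_descendants[OF assms] by blast
    from stable_local[OF this] show "stable T os (\<lambda>S f. children S (f x) = f ` children T x)"
      by (rule stable_mono) simp
  qed (use finite_descendants[OF assms] in blast)
  from stable_conj[OF Suc this] show ?case
    by (rule stable_mono) (auto simp: descendants_Suc)
qed

lemma stable_card_descendants:
  assumes "v \<in> verts T"
  shows "stable T os (\<lambda>S f. card (descendants S n (f v)) = card (descendants T n v))"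
proof -
  have "stable T os (\<lambda>S f. inj_on f (descendants T n v))"
    using stable_inj finite_descendants[OF assms] by blast
  from stable_conj[OF stable_descendants[OF assms, of n] this] show ?thesis
    by (rule stable_mono) (auto simp: card_image)
qed

lemma stable_card_children:
  assumes "v \<in> verts T"
  shows "stable T os (\<lambda>S f. card (children S (f v)) = card (children T v))"
proof -
  have "descendants S (Suc 0) x = children S x" for S x
    by (simp add: descendants_Suc descendants_0)
  then show ?thesis
    using stable_card_descendants[OF assms, of "Suc 0"] by simp
qed

lemma relpow_verts: "\<lbrakk>(u, v) \<in> arcs T ^^ n; u \<in> verts T\<rbrakk> \<Longrightarrow> v \<in> verts T"
  using rtrancl_verts relpow_imp_rtrancl by blast

lemma nth_succ_verts: "\<lbrakk>(u, v) \<in> nth_succ T n; u \<in> verts T\<rbrakk> \<Longrightarrow> v \<in> verts T"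
proof -
  have *: "u \<in> verts T \<longleftrightarrow> v \<in> verts T" if "(u, v) \<in> succ_rel T ^^ n" for u v n
    using that by (induction n arbitrary: v) (auto dest: succ_verts)
  assume "(u, v) \<in> nth_succ T n" "u \<in> verts T"
  then show "v \<in> verts T"
    using * by (auto simp: nth_succ_def split: if_splits)
qed

end

lemma valid_root: "\<lbrakk>valid k T os; i < k\<rbrakk> \<Longrightarrow> os ! i \<in> verts T"
  by (auto simp: valid_def)

lemma rooted_treeI: "\<lbrakk>valid k T os; 0 < k\<rbrakk> \<Longrightarrow> rooted_tree T os"
  by unfold_locales (auto simp: valid_def)

lemma open_prop_nth_succ:
  assumes "i < k" "j < k"
  shows "open_prop k (\<lambda>T os. (os ! i, os ! j) \<in> nth_succ T n)"
  unfolding open_prop_def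
proof (intro allI impI)
  fix T :: "nat odigraph" and os assume *: "valid k T os" "(os ! i, os ! j) \<in> nth_succ T n"
  interpret rooted_tree T os
    by (rule rooted_treeI[OF *(1)]) (use assms in simp)
  from stable_nth_succ[OF *(2)] show
    "stable T os (\<lambda>S f. (map f os ! i, map f os ! j) \<in> nth_succ S n)"
    by (rule stable_mono) (use *(1) assms in \<open>simp add: valid_def\<close>)
qed

lemma open_prop_nth_succ_children:
  assumes "i < k"
  shows "open_prop k (\<lambda>T os. \<exists>u. (os ! i, u) \<in> nth_succ T n \<and> card (children T u) = m)"
  unfolding open_prop_def
proof (intro allI impI)
  fix T :: "nat odigraph" and os assume *: "valid k T os" "\<exists>u. (os ! i, u) \<in> nth_succ T n \<and> card (children T u) = m"
  interpret rooted_tree T os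
    by (rule rooted_treeI[OF *(1)]) (use assms in simp)
  from * obtain u where u: "(os ! i, u) \<in> nth_succ T n" "card (children T u) = m"
    by blast
  have "u \<in> verts T"
    using nth_succ_verts[OF u(1)] valid_root[OF *(1) assms] by simp
  from stable_conj[OF stable_nth_succ[OF u(1)] stable_card_children[OF this]] show
    "stable T os (\<lambda>S f. \<exists>u. (map f os ! i, u) \<in> nth_succ S n \<and> card (children S u) = m)"
    by (rule stable_mono) (use *(1) assms u(2) in \<open>auto simp: valid_def\<close>)
qed

lemma open_prop_relpow:
  assumes "i < k" "j < k"
  shows "open_prop k (\<lambda>T os. (os ! i, os ! j) \<in> arcs T ^^ n)"
  unfolding open_prop_def
proof (intro allI impI)
  fix T :: "nat odigraph" and os assume *: "valid k T os" "(os ! i, os ! j) \<in> arcs T ^^ n"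
  interpret rooted_tree T os
    by (rule rooted_treeI[OF *(1)]) (use assms in simp)
  have "i < length os" "j < length os"
    using *(1) assms by (simp_all add: valid_def)
  then show "stable T os (\<lambda>S f. (map f os ! i, map f os ! j) \<in> arcs S ^^ n)"
    using stable_relpow[of arcs, OF stable_arc *(2)] by simp
qed

text \<open>The case \<open>m = 0\<close> speaks of the generations of the root itself and later
  gives invariance and measurability of their sizes.\<close>

lemma open_prop_ancestor_descendants:
  assumes "i < k"
  shows "open_prop k (\<lambda>T os. \<exists>w. (os ! i, w) \<in> arcs T ^^ m \<and> card (descendants T n w) = c)"
  unfolding open_prop_def
proof (intro allI impI)
  fix T :: "nat odigraph" and os assume *: "valid k T os" "\<exists>w. (os ! i, w) \<in> arcs T ^^ m \<and> card (descendants T n w) = c"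
  interpret rooted_tree T os
    by (rule rooted_treeI[OF *(1)]) (use assms in simp)
  from * obtain w where w: "(os ! i, w) \<in> arcs T ^^ m" "card (descendants T n w) = c"
    by blast
  have "w \<in> verts T"
    using relpow_verts[OF w(1)] valid_root[OF *(1) assms] by simp
  from stable_conj[OF stable_relpow[of arcs, OF stable_arc w(1)] stable_card_descendants[OF this]]
  show "stable T os (\<lambda>S f. \<exists>w. (map f os ! i, w) \<in> arcs S ^^ m \<and> card (descendants S n w) = c)"
    by (rule stable_mono) (use *(1) assms w(2) in \<open>auto simp: valid_def\<close>)
qed

section \<open>Open properties are invariant and measurable\<close>

definition invariant :: "nat \<Rightarrow> (nat odigraph \<Rightarrow> nat list \<Rightarrow> 'a) \<Rightarrow> bool" where
  "invariant k F \<longleftrightarrow>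
     (\<forall>T os S ps. valid k T os \<longrightarrow> valid k S ps \<longrightarrow> rooted_iso T os S ps \<longrightarrow> F T os = F S ps)"

text \<open>An isomorphism restricts to a ball isomorphism at the radius where \<open>Q\<close>
  becomes stable, so \<open>Q\<close> carries over; the inverse isomorphism gives the other
  direction.\<close>

lemma open_prop_invariant:
  assumes "open_prop k Q"
  shows "invariant k Q"
proof -
  have imp: "Q S ps" if a: "valid k T os" "valid k S ps" "rooted_iso T os S ps" "Q T os" for T os S ps
  proof -
    obtain f where f: "odigraph_iso f T S" "map f os = ps"
      using a(3) unfolding rooted_iso_def by blast
    have "stable T os (\<lambda>S f. Q S (map f os))"
      using assms a by (auto simp: open_prop_def)
    then obtain r where "\<And>S ps f. \<lbrakk>valid (length os) S ps; ball_iso r T os S ps f\<rbrakk> \<Longrightarrow> Q S (map f os)"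
      unfolding stable_def eventually_sequentially by blast
    moreover have "length os = k"
      using a by (simp add: valid_def)
    ultimately show "Q S ps"
      using a rooted_iso_imp_ball_iso[OF a(1,2) f, of r] f(2) by blast
  qed
  then show ?thesis
    unfolding invariant_def using rooted_iso_sym valid_arcs
    by (metis valid_def)
qed

lemma invariant_rep:
  fixes T :: "nat odigraph"
  assumes "invariant k F" "valid k T os"
  shows "F (tree_of (tree_class T os)) (roots_of (tree_class T os)) = F T os"
  using assms rep_tree_class[OF assms(2)] unfolding invariant_def by metis

lemma space_tree_space: "space (tree_space k) = tree_classes k"
  by (simp add: tree_space_def space_measure_of_conv)

lemma openin_local_topology_subset:
  assumes "openin (local_topology k) U"
  shows "U \<subseteq> tree_classes k"
proof -
  have "U \<subseteq> topspace (local_topology k)"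
    using assms by (rule openin_subset)
  also have "\<dots> \<subseteq> tree_classes k"
    by (auto simp: local_topology_def topology_generated_by_topspace local_nbhd_def)
  finally show ?thesis .
qed

lemma openin_tree_space:
  assumes "openin (local_topology k) U"
  shows "U \<in> sets (tree_space k)"
  unfolding tree_space_def using assms openin_local_topology_subset
  by (subst sets_measure_of) auto

lemma self_mem_local_nbhd:
  assumes "valid k T os"
  shows "tree_class T os \<in> local_nbhd k T os r"
  using tree_class_in_tree_classes[OF assms] tree_class_self[OF assms] rooted_iso_refl
  by (auto simp: local_nbhd_def)

text \<open>The radius at which \<open>Q\<close> becomes stable at \<open>C\<close> provides a basic
  neighbourhood inside the set. Membership in it supplies just some representative of a class;
  invariance moves \<open>Q\<close> to the chosen one.\<close>

lemma open_prop_openin: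
  assumes Q: "open_prop k Q"
  shows "openin (local_topology k) {C \<in> tree_classes k. Q (tree_of C) (roots_of C)}" (is "openin _ ?E")
proof (subst openin_subopen, intro ballI)
  fix C assume "C \<in> ?E"
  then have C: "C \<in> tree_classes k" "Q (tree_of C) (roots_of C)"
    by auto
  let ?T = "tree_of C" and ?os = "roots_of C"
  note v = rep_tree_classes(1,2)[OF C(1)]
  then have len: "length ?os = k"
    by (simp add: valid_def)
  have "stable ?T ?os (\<lambda>S f. Q S (map f ?os))"
    using Q C v by (simp add: open_prop_def)
  then obtain r where r: "\<And>S ps f. \<lbrakk>valid k S ps; ball_iso r ?T ?os S ps f\<rbrakk> \<Longrightarrow> Q S (map f ?os)"
    unfolding stable_def eventually_sequentially len by blast
  have "local_nbhd k ?T ?os r \<subseteq> ?E"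
  proof
    fix D assume D: "D \<in> local_nbhd k ?T ?os r"
    then obtain S ps where S: "D \<in> tree_classes k" "(S, ps) \<in> D"
      "rooted_iso (root_ball ?T ?os r) ?os (root_ball S ps r) ps"
      by (auto simp: local_nbhd_def)
    obtain D' :: "nat odigraph" and qs where D': "valid k D' qs" "D = tree_class D' qs"
      using rep_tree_classes[OF S(1)] by blast
    have vS: "valid k S ps" "tree_class S ps = D"
      using mem_tree_class[OF D'(1)] S(2) D'(2) by auto
    obtain f where "ball_iso r ?T ?os S ps f"
      using S(3) by (auto simp: rooted_iso_def ball_iso_def)
    then have "Q S ps"
      using r[OF vS(1)] by (auto simp: ball_iso_def)
    then show "D \<in> ?E"
      using invariant_rep[OF open_prop_invariant[OF Q] vS(1)] vS(2) S(1) by simp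
  qed
  moreover have "C \<in> local_nbhd k ?T ?os r"
    using self_mem_local_nbhd[OF v(1)] v(2) by simp
  moreover have "openin (local_topology k) (local_nbhd k ?T ?os r)"
    unfolding local_topology_def
    by (rule topology_generated_by_Basis) (use v in \<open>auto simp: valid_def\<close>)
  ultimately show "\<exists>U. openin (local_topology k) U \<and> C \<in> U \<and> U \<subseteq> ?E"
    by blast
qed

lemma open_prop_measurable:
  assumes "open_prop k Q"
  shows "Measurable.pred (tree_space k) (\<lambda>C. Q (tree_of C) (roots_of C))"
  using openin_tree_space[OF open_prop_openin[OF assms]]
  by (simp add: pred_def space_tree_space)

section \<open>Mass transport\<close>

lemma nn_integral_count_of_bool:
  assumes "finite {u \<in> V. R u}"
  shows "(\<integral>\<^sup>+ u. of_bool (R u) \<partial>count_space V) = of_nat (card {u \<in> V. R u})"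
proof -
  have "(\<integral>\<^sup>+ u. of_bool (R u) \<partial>count_space V) = (\<integral>\<^sup>+ u. indicator {u \<in> V. R u} u \<partial>count_space V)"
    by (intro nn_integral_cong) (auto simp: indicator_def)
  also have "\<dots> = of_nat (card {u \<in> V. R u})"
    using assms by simp
  finally show ?thesis .
qed

lemma nn_integral_count_unique:
  assumes "\<And>u. \<lbrakk>u \<in> V; R u\<rbrakk> \<Longrightarrow> u = v" "v \<in> V"
  shows "(\<integral>\<^sup>+ u. of_bool (R u) \<partial>count_space V) = of_bool (R v)"
proof (cases "R v")
  case True
  then have "{u \<in> V. R u} = {v}"
    using assms by blast
  then show ?thesis
    using True nn_integral_count_of_bool[of V R] by simp
next
  case False
  then have "{u \<in> V. R u} = {}"
    using assms by blast
  then show ?thesis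
    using False nn_integral_count_of_bool[of V R] by (simp del: Collect_empty_eq)
qed

lemma offspring_seq_invariant:
  assumes "i < k"
  shows "invariant k (\<lambda>T os. offspring_seq T (os ! i))"
proof -
  have "offspring_seq T (os ! i) n = offspring_seq S (ps ! i) n"
    if "valid k T os" "valid k S ps" "rooted_iso T os S ps"
    for T S :: "nat odigraph" and os ps n
  proof -
    have "(\<exists>u. (os ! i, u) \<in> nth_succ T (n + 1) \<and> card (children T u) = m) \<longleftrightarrow>
        (\<exists>u. (ps ! i, u) \<in> nth_succ S (n + 1) \<and> card (children S u) = m)" for m
      using open_prop_invariant[OF open_prop_nth_succ_children[OF assms, of "n + 1" m]] that
      by (simp add: invariant_def)
    then show ?thesis
      by (simp add: offspring_seq_def)
  qed
  then show ?thesis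
    by (auto simp: invariant_def)
qed

lemma offspring_seq_measurable:
  assumes "i < k"
  shows "(\<lambda>C. offspring_seq (tree_of C) (roots_of C ! i)) \<in>
    measurable (tree_space k) (\<Pi>\<^sub>M n\<in>UNIV. count_space UNIV)"
proof (rule measurable_abs_UNIV)
  fix n
  let ?L = "\<lambda>C. LEAST m. \<exists>u. (roots_of C ! i, u) \<in> nth_succ (tree_of C) (n + 1) \<and>
      card (children (tree_of C) u) = m"
  have "?L \<in> measurable (tree_space k) (count_space UNIV)"
    by (rule measurable_Least, rule open_prop_measurable[OF open_prop_nth_succ_children[OF assms]])
  then have "(\<lambda>C. int (?L C) - 1) \<in> measurable (tree_space k) (count_space UNIV)"
    by (rule measurable_compose) simp
  then show "(\<lambda>C. offspring_seq (tree_of C) (roots_of C ! i) n) \<in>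
      measurable (tree_space k) (count_space UNIV)"
    unfolding offspring_seq_def .
qed

lemma nth_succ_uminus: "(u, v) \<in> nth_succ T (- n) \<longleftrightarrow> (v, u) \<in> nth_succ T n"
  by (auto simp: nth_succ_def)

lemma descendants_empty_mono: "\<lbrakk>descendants T n v = {}; n \<le> m\<rbrakk> \<Longrightarrow> descendants T m v = {}"
  by (induction m) (auto simp: descendants_Suc le_Suc_eq)

lemma finite_below:
  assumes "ordered_tree T" "v \<in> verts T" "descendants T n v = {}"
  shows "finite {x. (x, v) \<in> (arcs T)\<^sup>*}"
proof -
  interpret rooted_tree T "[v]"
    using assms by (simp add: rooted_tree_def rooted_tree_axioms_def)
  have "{x. (x, v) \<in> (arcs T)\<^sup>*} \<subseteq> (\<Union>m<n. descendants T m v)"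
  proof
    fix x assume "x \<in> {x. (x, v) \<in> (arcs T)\<^sup>*}"
    then obtain m where m: "x \<in> descendants T m v"
      by (auto simp: rtrancl_power descendants_def)
    then have "m < n"
      using descendants_empty_mono[OF assms(3), of m] by (cases "m < n") auto
    then show "x \<in> (\<Union>m<n. descendants T m v)"
      using m by blast
  qed
  then show ?thesis
    using finite_descendants[OF assms(2)] by (simp add: finite_subset)
qed

section \<open>A unimodular random tree and its chosen representative\<close>

locale random_tree = prob_space M for M :: "'w measure" +
  fixes X :: "'w \<Rightarrow> tree_class"
  assumes X: "X \<in> measurable M rooted_trees"
    and AE_EFT: "AE \<omega> in M. holds_for ordered_EFT (X \<omega>)"
    and unimod: "unimodular M X"
begin

definition T :: "'w \<Rightarrow> nat odigraph" where "T \<omega> = tree_of (X \<omega>)"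

definition root :: "'w \<Rightarrow> nat" where "root \<omega> = hd (roots_of (X \<omega>))"

lemma T_facts:
  assumes "\<omega> \<in> space M"
  shows "roots_of (X \<omega>) = [root \<omega>]" "valid 1 (T \<omega>) [root \<omega>]" "X \<omega> = tree_class (T \<omega>) [root \<omega>]"
    "(T \<omega>, [root \<omega>]) \<in> X \<omega>" "ordered_tree (T \<omega>)" "root \<omega> \<in> verts (T \<omega>)" "rooted_tree (T \<omega>) [root \<omega>]"
proof -
  have C: "X \<omega> \<in> tree_classes 1"
    using measurable_space[OF X assms] by (simp add: space_tree_space)
  note v = rep_tree_classes[OF C]
  show r: "roots_of (X \<omega>) = [root \<omega>]"
    using v(1) by (cases "roots_of (X \<omega>)") (auto simp: valid_def root_def)
  show v1: "valid 1 (T \<omega>) [root \<omega>]" and "X \<omega> = tree_class (T \<omega>) [root \<omega>]" "(T \<omega>, [root \<omega>]) \<in> X \<omega>"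
    using v by (simp_all add: r T_def)
  show "ordered_tree (T \<omega>)" "root \<omega> \<in> verts (T \<omega>)"
    using v1 by (simp_all add: valid_def ordered_tree_def)
  show "rooted_tree (T \<omega>) [root \<omega>]"
    using rooted_treeI[OF v1] by simp
qed

lemma AE_holds_for:
  assumes "AE \<omega> in M. holds_for P (X \<omega>)"
  shows "AE \<omega> in M. P (T \<omega>)"
  using assms AE_space by eventually_elim (use T_facts(4) in \<open>auto simp: holds_for_def\<close>)

lemma AE_ordered_EFT: "AE \<omega> in M. ordered_EFT (T \<omega>)"
  by (rule AE_holds_for[OF AE_EFT])

lemma measurable_T:
  assumes "(\<lambda>C. F (tree_of C) (roots_of C)) \<in> measurable rooted_trees N"
  shows "(\<lambda>\<omega>. F (T \<omega>) [root \<omega>]) \<in> measurable M N"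
proof -
  have "(\<lambda>\<omega>. F (tree_of (X \<omega>)) (roots_of (X \<omega>))) \<in> measurable M N"
    using measurable_compose[OF X assms] .
  then show ?thesis
    by (rule measurable_cong[THEN iffD1, rotated]) (simp add: T_facts(1) T_def)
qed

text \<open>Unimodularity concerns functions of classes. An invariant \<open>H\<close> induces one,
  called \<open>g\<close>, by evaluation at the chosen representative, and invariance carries the
  value back to \<open>T \<omega>\<close> for any pair of roots.\<close>

lemma mass_transport:
  fixes H :: "nat odigraph \<Rightarrow> nat list \<Rightarrow> ennreal"
  assumes inv: "invariant 2 H"
    and meas: "(\<lambda>C. H (tree_of C) (roots_of C)) \<in> borel_measurable doubly_rooted_trees"
  shows "(\<integral>\<^sup>+ \<omega>. (\<integral>\<^sup>+ u. H (T \<omega>) [root \<omega>, u] \<partial>count_space (verts (T \<omega>))) \<partial>M) =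
    (\<integral>\<^sup>+ \<omega>. (\<integral>\<^sup>+ u. H (T \<omega>) [u, root \<omega>] \<partial>count_space (verts (T \<omega>))) \<partial>M)"
proof -
  define g where "g C = H (tree_of C) (roots_of C)" for C
  have sum_eq: "vertex_sum h (X \<omega>) = (\<integral>\<^sup>+ u. h (T \<omega>) (root \<omega>) u \<partial>count_space (verts (T \<omega>)))" for h \<omega>
    by (simp add: vertex_sum_def T_def root_def tree_of_def roots_of_def rep_def split_beta)
  have g: "g (tree_class (T \<omega>) [u, v]) = H (T \<omega>) [u, v]"
    if "\<omega> \<in> space M" "u \<in> verts (T \<omega>)" "v \<in> verts (T \<omega>)" for \<omega> u v
    unfolding g_def using T_facts(2)[OF that(1)] that(2,3)
    by (intro invariant_rep[OF inv]) (simp add: valid_def)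
  have "(\<integral>\<^sup>+ \<omega>. vertex_sum (\<lambda>T p u. g (tree_class T [p, u])) (X \<omega>) \<partial>M) =
      (\<integral>\<^sup>+ \<omega>. vertex_sum (\<lambda>T p u. g (tree_class T [u, p])) (X \<omega>) \<partial>M)"
    using unimod meas unfolding unimodular_def by (elim bspec) (simp add: g_def)
  then show ?thesis
    unfolding sum_eq
    by (subst (asm) (1 2) nn_integral_cong[OF nn_integral_cong[OF g]]) (auto simp: T_facts)
qed

lemma mass_transport_pred:
  assumes inv: "invariant 2 Q"
    and meas: "Measurable.pred doubly_rooted_trees (\<lambda>C. Q (tree_of C) (roots_of C))"
  shows "(\<integral>\<^sup>+ \<omega>. (\<integral>\<^sup>+ u. of_bool (Q (T \<omega>) [root \<omega>, u]) \<partial>count_space (verts (T \<omega>))) \<partial>M) =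
    (\<integral>\<^sup>+ \<omega>. (\<integral>\<^sup>+ u. of_bool (Q (T \<omega>) [u, root \<omega>]) \<partial>count_space (verts (T \<omega>))) \<partial>M)"
proof (rule mass_transport)
  show "invariant 2 (\<lambda>T os. of_bool (Q T os))"
    using inv by (simp add: invariant_def)
  have "(\<lambda>C. of_bool (Q (tree_of C) (roots_of C)) :: ennreal) = (\<lambda>C. if Q (tree_of C) (roots_of C) then 1 else 0)"
    by (simp add: of_bool_def)
  then show "(\<lambda>C. of_bool (Q (tree_of C) (roots_of C)) :: ennreal) \<in> borel_measurable doubly_rooted_trees"
    using meas by simp
qed

lemma nn_integral_of_bool:
  assumes "Measurable.pred M P"
  shows "(\<integral>\<^sup>+ \<omega>. of_bool (P \<omega>) \<partial>M) = emeasure M {\<omega> \<in> space M. P \<omega>}"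
proof -
  have "(\<integral>\<^sup>+ \<omega>. of_bool (P \<omega>) \<partial>M) = (\<integral>\<^sup>+ \<omega>. indicator {\<omega> \<in> space M. P \<omega>} \<omega> \<partial>M)"
    by (intro nn_integral_cong) (simp add: indicator_def)
  also have "\<dots> = emeasure M {\<omega> \<in> space M. P \<omega>}"
    using assms by (intro nn_integral_indicator) (simp add: pred_def)
  finally show ?thesis .
qed

text \<open>Let each vertex send mass 1 to its \<open>n\<close>-th successor. The root almost surely
  sends 1, and it receives 1 or 0 according to whether it has an \<open>n\<close>-th predecessor.
  Equality of the means forces this event to have probability 1.\<close>

lemma AE_succ_line:
  assumes "AE \<omega> in M. interval_finite_eft (T \<omega>)"
  shows "AE \<omega> in M. \<exists>u. succ_line (T \<omega>) u \<and> u 0 = root \<omega>"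
proof -
  have "AE \<omega> in M. \<exists>q. (root \<omega>, q) \<in> nth_succ (T \<omega>) (- int n)" for n
  proof -
    let ?Q = "\<lambda>T os. (os ! 0, os ! 1) \<in> nth_succ T (int n)"
    let ?P = "\<lambda>\<omega>. \<exists>u. (root \<omega>, u) \<in> nth_succ (T \<omega>) (- int n)"
    have Q: "open_prop 2 ?Q"
      by (rule open_prop_nth_succ) auto
    \<comment> \<open>Existence of the predecessor is split according to its number of children,
      since \<open>open_prop_nth_succ_children\<close> provides events of that form.\<close>
    have "Measurable.pred M (\<lambda>\<omega>. \<exists>u. (root \<omega>, u) \<in> nth_succ (T \<omega>) (- int n) \<and>
        card (children (T \<omega>) u) = m)" for m
      using measurable_T[OF open_prop_measurable[OF open_prop_nth_succ_children[of 0 1 "- int n" m]]]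
      by simp
    then have "Measurable.pred M (\<lambda>\<omega>. \<exists>m u. (root \<omega>, u) \<in> nth_succ (T \<omega>) (- int n) \<and>
        card (children (T \<omega>) u) = m)"
      by (rule pred_intros_countable)
    then have P: "Measurable.pred M ?P"
      by simp
    have "(\<integral>\<^sup>+ \<omega>. (\<integral>\<^sup>+ u. of_bool (?Q (T \<omega>) [root \<omega>, u]) \<partial>count_space (verts (T \<omega>))) \<partial>M) = (\<integral>\<^sup>+ \<omega>. 1 \<partial>M)"
    proof (rule nn_integral_cong_AE)
      show "AE \<omega> in M. (\<integral>\<^sup>+ u. of_bool (?Q (T \<omega>) [root \<omega>, u]) \<partial>count_space (verts (T \<omega>))) = 1"
        using assms AE_space
      proof eventually_elim
        case (elim \<omega>)
        interpret interval_finite_eft "T \<omega>" by (rule elim(1))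
        obtain q where q: "q \<in> verts (T \<omega>)" "(root \<omega>, q) \<in> nth_succ (T \<omega>) (int n)"
          using exists_succ_pow[of "root \<omega>" n] T_facts(6)[OF elim(2)] by (auto simp: nth_succ_def)
        show ?case
          by (subst nn_integral_count_unique[where v = q]) (use q nth_succ_unique in auto)
      qed
    qed
    moreover have "(\<integral>\<^sup>+ \<omega>. (\<integral>\<^sup>+ u. of_bool (?Q (T \<omega>) [u, root \<omega>]) \<partial>count_space (verts (T \<omega>))) \<partial>M) =
        (\<integral>\<^sup>+ \<omega>. of_bool (?P \<omega>) \<partial>M)"
    proof (rule nn_integral_cong)
      fix \<omega> assume w: "\<omega> \<in> space M"
      interpret rooted_tree "T \<omega>" "[root \<omega>]" by (rule T_facts(7)[OF w])
      show "(\<integral>\<^sup>+ u. of_bool (?Q (T \<omega>) [u, root \<omega>]) \<partial>count_space (verts (T \<omega>))) = of_bool (?P \<omega>)"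
      proof (cases "?P \<omega>")
        case True
        then obtain p where p: "(p, root \<omega>) \<in> nth_succ (T \<omega>) (int n)"
          by (auto simp: nth_succ_uminus)
        have "p \<in> verts (T \<omega>)"
          using p nth_succ_verts[of "root \<omega>" p "- int n"] T_facts(6)[OF w]
          by (simp add: nth_succ_uminus)
        then show ?thesis
          using True p nth_succ_inj by (subst nn_integral_count_unique[where v = p]) auto
      next
        case False
        then show ?thesis
          by (subst nn_integral_count_of_bool) (auto simp: nth_succ_uminus)
      qed
    qed
    ultimately have "emeasure M {\<omega> \<in> space M. ?P \<omega>} = 1"
      using mass_transport_pred[OF open_prop_invariant[OF Q] open_prop_measurable[OF Q]]
        nn_integral_of_bool[OF P] by (simp add: emeasure_space_1)
    then show ?thesis
      using AE_iff_emeasure_eq_1[OF P] by simp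
  qed
  then have "AE \<omega> in M. \<forall>n. \<exists>q. (root \<omega>, q) \<in> nth_succ (T \<omega>) (- int n)"
    by (simp add: AE_all_countable)
  then show ?thesis
    using assms AE_space
  proof eventually_elim
    case (elim \<omega>)
    interpret interval_finite_eft "T \<omega>" by (rule elim(2))
    have "\<exists>p. (p, root \<omega>) \<in> succ_rel (T \<omega>) ^^ n" for n
      using elim(1)[rule_format, of n] by (auto simp: nth_succ_uminus) (auto simp: nth_succ_def)
    then show ?case
      using exists_succ_line[OF exists_nth_succ] T_facts(6)[OF elim(3)] by metis
  qed
qed

end

section \<open>Stationarity of the offspring sequence\<close>

context random_tree
begin

definition offspring :: "'w \<Rightarrow> int \<Rightarrow> int" where
  "offspring \<omega> = offspring_seq (T \<omega>) (root \<omega>)"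

definition bi_infinite :: "'w \<Rightarrow> bool" where
  "bi_infinite \<omega> \<longleftrightarrow> interval_finite_eft (T \<omega>) \<and> (\<exists>u. succ_line (T \<omega>) u \<and> u 0 = root \<omega>)"

lemma offspring_measurable: "offspring \<in> measurable M (\<Pi>\<^sub>M n\<in>UNIV. count_space UNIV)"
  using measurable_T[OF offspring_seq_measurable[of 0 1]] by (simp add: offspring_def[abs_def])

lemma shift_measurable:
  "(\<lambda>y n. y (n + k :: int)) \<in> measurable (\<Pi>\<^sub>M n\<in>UNIV. count_space UNIV) (\<Pi>\<^sub>M n\<in>UNIV. count_space (UNIV :: int set))"
  by (rule measurable_abs_UNIV) (rule measurable_component_singleton, simp)

text \<open>Each vertex sends mass 1 to its \<open>k\<close>-th successor if the offspring sequence
  seen from there is in \<open>B\<close>. The mass sent by the root tests its shifted sequence; the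
  mass received, coming from \<open>u (- k)\<close> alone, tests its unshifted one.\<close>

lemma offspring_shift_emeasure:
  assumes bi_infinite: "AE \<omega> in M. bi_infinite \<omega>" and B[measurable]: "B \<in> sets (\<Pi>\<^sub>M n\<in>UNIV. count_space (UNIV :: int set))"
  shows "emeasure M {\<omega> \<in> space M. (\<lambda>n. offspring \<omega> (n + k)) \<in> B} = emeasure M {\<omega> \<in> space M. offspring \<omega> \<in> B}"
proof -
  let ?Q = "\<lambda>T os. (os ! 0, os ! 1) \<in> nth_succ T k \<and> offspring_seq T (os ! 1) \<in> B"
  have op: "open_prop 2 (\<lambda>T os. (os ! 0, os ! 1) \<in> nth_succ T k)"
    by (rule open_prop_nth_succ) auto
  have inv: "invariant 2 ?Q"
    using open_prop_invariant[OF op] offspring_seq_invariant[of 1 2] unfolding invariant_def by simp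
  have [measurable]: "(\<lambda>C. offspring_seq (tree_of C) (roots_of C ! 1)) \<in>
      measurable (tree_space 2) (\<Pi>\<^sub>M n\<in>UNIV. count_space UNIV)"
    by (rule offspring_seq_measurable) simp
  note [measurable] = open_prop_measurable[OF op]
  have meas: "Measurable.pred (tree_space 2) (\<lambda>C. ?Q (tree_of C) (roots_of C))"
    by measurable
  note [measurable] = offspring_measurable
  have [measurable]: "(\<lambda>\<omega> n. offspring \<omega> (n + k)) \<in> measurable M (\<Pi>\<^sub>M n\<in>UNIV. count_space UNIV)"
    by (rule measurable_compose[OF offspring_measurable shift_measurable])
  have "(\<integral>\<^sup>+ \<omega>. (\<integral>\<^sup>+ u. of_bool (?Q (T \<omega>) [root \<omega>, u]) \<partial>count_space (verts (T \<omega>))) \<partial>M) =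
      (\<integral>\<^sup>+ \<omega>. of_bool ((\<lambda>n. offspring \<omega> (n + k)) \<in> B) \<partial>M)"
  proof (rule nn_integral_cong_AE)
    show "AE \<omega> in M. (\<integral>\<^sup>+ u. of_bool (?Q (T \<omega>) [root \<omega>, u]) \<partial>count_space (verts (T \<omega>))) =
        of_bool ((\<lambda>n. offspring \<omega> (n + k)) \<in> B)"
      using bi_infinite
    proof eventually_elim
      case (elim \<omega>)
      then interpret interval_finite_eft "T \<omega>" by (simp add: bi_infinite_def)
      obtain u where u: "succ_line (T \<omega>) u" "u 0 = root \<omega>"
        using elim by (auto simp: bi_infinite_def)
      have k: "(root \<omega>, u k) \<in> nth_succ (T \<omega>) k"
        using succ_line_nth[OF u(1), of 0 k] u(2) by simp
      have "offspring_seq (T \<omega>) (u k) n = offspring \<omega> (n + k)" for n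
        unfolding offspring_def u(2)[symmetric] offspring_seq_succ_line[OF u(1)]
        by (simp add: add_ac)
      then have "offspring_seq (T \<omega>) (u k) = (\<lambda>n. offspring \<omega> (n + k))"
        by (rule ext)
      then show ?case
        by (subst nn_integral_count_unique[where v = "u k"])
          (use k nth_succ_unique succ_line_verts[OF u(1)] in auto)
    qed
  qed
  moreover have "(\<integral>\<^sup>+ \<omega>. (\<integral>\<^sup>+ u. of_bool (?Q (T \<omega>) [u, root \<omega>]) \<partial>count_space (verts (T \<omega>))) \<partial>M) =
      (\<integral>\<^sup>+ \<omega>. of_bool (offspring \<omega> \<in> B) \<partial>M)"
  proof (rule nn_integral_cong_AE)
    show "AE \<omega> in M. (\<integral>\<^sup>+ u. of_bool (?Q (T \<omega>) [u, root \<omega>]) \<partial>count_space (verts (T \<omega>))) =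
        of_bool (offspring \<omega> \<in> B)"
      using bi_infinite
    proof eventually_elim
      case (elim \<omega>)
      then interpret interval_finite_eft "T \<omega>" by (simp add: bi_infinite_def)
      obtain u where u: "succ_line (T \<omega>) u" "u 0 = root \<omega>"
        using elim by (auto simp: bi_infinite_def)
      have k: "(u (- k), root \<omega>) \<in> nth_succ (T \<omega>) k"
        using succ_line_nth[OF u(1), of "- k" k] u(2) by simp
      then show ?case
        by (subst nn_integral_count_unique[where v = "u (- k)"])
          (use k nth_succ_inj succ_line_verts[OF u(1)] in \<open>auto simp: offspring_def\<close>)
    qed
  qed
  moreover have "(\<integral>\<^sup>+ \<omega>. of_bool ((\<lambda>n. offspring \<omega> (n + k)) \<in> B) \<partial>M) =
      emeasure M {\<omega> \<in> space M. (\<lambda>n. offspring \<omega> (n + k)) \<in> B}"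
    by (rule nn_integral_of_bool) measurable
  moreover have "(\<integral>\<^sup>+ \<omega>. of_bool (offspring \<omega> \<in> B) \<partial>M) = emeasure M {\<omega> \<in> space M. offspring \<omega> \<in> B}"
    by (rule nn_integral_of_bool) measurable
  ultimately show ?thesis
    using mass_transport_pred[OF inv meas] by simp
qed

lemma record_tree_offspring:
  assumes "bi_infinite \<omega>" "\<omega> \<in> space M"
  shows "record_tree (offspring \<omega>) = X \<omega>" "- 1 \<le> offspring \<omega> n"
proof -
  interpret interval_finite_eft "T \<omega>" using assms(1) by (simp add: bi_infinite_def)
  obtain u where u: "succ_line (T \<omega>) u" "u 0 = root \<omega>"
    using assms(1) by (auto simp: bi_infinite_def)
  have "offspring \<omega> n = int (card (children (T \<omega>) (u (n + 1)))) - 1" for n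
    using offspring_seq_succ_line[OF u(1), of 0 n] u(2) by (simp add: offspring_def)
  then have "odigraph_iso u (component (record_graph (offspring \<omega>)) 0) (T \<omega>)"
    by (rule record_graph_iso[OF u(1)])
  then have iso: "rooted_iso (component (record_graph (offspring \<omega>)) 0) [0] (T \<omega>) [root \<omega>]"
    using u(2) by (auto simp: rooted_iso_def)
  show "record_tree (offspring \<omega>) = X \<omega>"
    unfolding record_tree_def T_facts(3)[OF assms(2)]
  proof (rule tree_class_eq[OF iso])
    show "arcs (T \<omega>) \<subseteq> verts (T \<omega>) \<times> verts (T \<omega>)"
      by (rule valid_arcs[OF T_facts(2)[OF assms(2)]])
  qed (auto simp: component_def restrict_verts_def record_graph_def)
  show "- 1 \<le> offspring \<omega> n"
    by (simp add: offspring_def offspring_seq_def)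
qed

text \<open>\<open>Y\<close> consists of the coordinate maps on a set of integer sequences that
  carries the law of the offspring sequence.\<close>

lemma representation:
  assumes bi_infinite: "AE \<omega> in M. bi_infinite \<omega>"
  shows "\<exists>(N :: (int \<Rightarrow> int) measure) Y.
           stationary_sequence N Y \<and> (\<forall>n. \<forall>\<eta>\<in>space N. - 1 \<le> Y n \<eta>) \<and>
           eq_in_distribution rooted_trees M X N (\<lambda>\<eta>. record_tree (\<lambda>n. Y n \<eta>))"
proof -
  let ?P = "\<Pi>\<^sub>M n\<in>UNIV. count_space (UNIV :: int set)"
  obtain Z where Z: "{\<omega> \<in> space M. \<not> bi_infinite \<omega>} \<subseteq> Z" "emeasure M Z = 0" "Z \<in> sets M"
    using bi_infinite by (rule AE_E)
  have "\<exists>\<omega>0. \<omega>0 \<in> space M - Z"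
  proof (rule ccontr)
    assume "\<not> ?thesis"
    then have "emeasure M (space M) \<le> emeasure M Z"
      using Z(3) by (intro emeasure_mono) auto
    then show False
      using Z(2) by (simp add: emeasure_space_1)
  qed
  then obtain \<omega>0 where \<omega>0: "\<omega>0 \<in> space M" "\<omega>0 \<notin> Z"
    by blast
  \<comment> \<open>Measurability into \<open>rooted_trees\<close> requires a genuine tree class at
    every point, which is known for \<open>record_tree (offspring \<omega>)\<close> only where the
    line is bi-infinite. On the null set \<open>Z\<close> the values at one good point
    \<open>\<omega>0\<close> are therefore substituted.\<close>
  define W where "W \<omega> = (if \<omega> \<in> Z then offspring \<omega>0 else offspring \<omega>)" for \<omega>
  define X' where "X' \<omega> = (if \<omega> \<in> Z then X \<omega>0 else X \<omega>)" for \<omega>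
  have AE_Z: "AE \<omega> in M. \<omega> \<notin> Z"
    using Z by (intro AE_not_in) auto
  have "X \<omega>0 \<in> space rooted_trees"
    using measurable_space[OF X \<omega>0(1)] .
  then have X'_meas: "X' \<in> measurable M rooted_trees"
    unfolding X'_def using Z(3) X by (intro measurable_If_set) (auto simp: Int_absorb2 sets.sets_into_space)
  have W_meas: "W \<in> measurable M ?P"
    unfolding W_def using Z(3) offspring_measurable measurable_space[OF offspring_measurable \<omega>0(1)]
    by (intro measurable_If_set) (auto simp: Int_absorb2 sets.sets_into_space)
  have record_W: "record_tree (W \<omega>) = X' \<omega>" and W_ge: "- 1 \<le> W \<omega> n" if "\<omega> \<in> space M" for \<omega> n
    using record_tree_offspring that \<omega>0 Z(1) by (auto simp: W_def X'_def)
  \<comment> \<open>\<open>K\<close> is the push-forward \<open>\<sigma>\<close>-algebra: with it, measurability of \<open>record_tree\<close> is that of \<open>X\<close>.\<close>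
  define G where "G = {\<eta>. (\<forall>n. - 1 \<le> \<eta> n) \<and> record_tree \<eta> \<in> tree_classes 1}"
  define K where "K = sigma G {A. A \<subseteq> G \<and> W -` A \<inter> space M \<in> sets M}"
  have space_K: "space K = G"
    by (simp add: K_def space_measure_of_conv)
  have WG: "W \<omega> \<in> G" if "\<omega> \<in> space M" for \<omega>
    using W_ge[OF that] record_W[OF that] measurable_space[OF X'_meas that]
    by (simp add: G_def space_tree_space)
  have W_K: "W \<in> measurable M K"
    unfolding K_def by (rule measurable_measure_of) (use WG in auto)
  \<comment> \<open>The sigma-algebra of \<open>K\<close> is the largest one for which
    \<open>W\<close> is measurable, so measurability of any map on \<open>K\<close> can be tested
    after composing it with \<open>W\<close>; this covers coordinates and shifts too.\<close>
  have meas_K: "f \<in> measurable K S" if "\<And>\<eta>. \<eta> \<in> G \<Longrightarrow> f \<eta> \<in> space S" "(\<lambda>\<omega>. f (W \<omega>)) \<in> measurable M S"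
    for f and S :: "'s measure"
  proof (rule measurableI)
    fix A assume A: "A \<in> sets S"
    have "W -` (f -` A \<inter> G) \<inter> space M = (\<lambda>\<omega>. f (W \<omega>)) -` A \<inter> space M"
      using WG by auto
    also have "\<dots> \<in> sets M"
      by (rule measurable_sets[OF that(2) A])
    finally show "f -` A \<inter> space K \<in> sets K"
      unfolding space_K unfolding K_def by (subst sets_measure_of) auto
  qed (use that(1) in \<open>simp add: space_K\<close>)
  have shift_K: "(\<lambda>\<eta> n. \<eta> (n + k)) \<in> measurable K ?P" for k
    by (rule meas_K) (auto simp: space_PiM intro: measurable_compose[OF W_meas shift_measurable])
  define N where "N = distr M K W"
  have distr_shift: "distr N ?P (\<lambda>\<eta> n. \<eta> (n + k)) = distr M ?P (\<lambda>\<omega> n. offspring \<omega> (n + k))" for k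
  proof -
    have "distr N ?P (\<lambda>\<eta> n. \<eta> (n + k)) = distr M ?P (\<lambda>\<omega> n. W \<omega> (n + k))"
      unfolding N_def by (simp add: distr_distr[OF shift_K W_K] comp_def)
    also have "\<dots> = distr M ?P (\<lambda>\<omega> n. offspring \<omega> (n + k))"
    proof (rule distr_cong_AE)
      show "AE \<omega> in M. (\<lambda>n. W \<omega> (n + k)) = (\<lambda>n. offspring \<omega> (n + k))"
        using AE_Z by eventually_elim (simp add: W_def)
    qed (auto intro: measurable_compose[OF W_meas shift_measurable]
        measurable_compose[OF offspring_measurable shift_measurable])
    finally show ?thesis .
  qed
  have distr_eq: "distr M ?P (\<lambda>\<omega> n. offspring \<omega> (n + k)) = distr M ?P offspring" for k
  proof (rule measure_eqI)
    fix B assume "B \<in> sets (distr M ?P (\<lambda>\<omega> n. offspring \<omega> (n + k)))"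
    then have B: "B \<in> sets ?P"
      by simp
    have "(\<lambda>\<omega> n. offspring \<omega> (n + k)) \<in> measurable M ?P"
      by (rule measurable_compose[OF offspring_measurable shift_measurable])
    then show "emeasure (distr M ?P (\<lambda>\<omega> n. offspring \<omega> (n + k))) B = emeasure (distr M ?P offspring) B"
      using offspring_shift_emeasure[OF bi_infinite B, of k] B offspring_measurable
      by (simp add: emeasure_distr vimage_def Int_def conj_commute)
  qed simp
  have "stationary_sequence N (\<lambda>n \<eta>. \<eta> n)"
    unfolding stationary_sequence_def
  proof (intro conjI allI)
    show "prob_space N"
      unfolding N_def by (rule prob_space_distr[OF W_K])
    show "(\<lambda>\<eta>. \<eta> n) \<in> measurable N (count_space UNIV)" for n
      unfolding N_def measurable_distr_eq1
      by (rule meas_K) (auto intro: measurable_compose[OF W_meas measurable_component_singleton])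
    show "distr N ?P (\<lambda>\<omega> n. \<omega> (n + k)) = distr N ?P (\<lambda>\<omega> n. \<omega> n)" for k
      using distr_shift[of k] distr_shift[of 0] distr_eq[of k] distr_eq[of 0] by simp
  qed
  moreover have "- 1 \<le> \<eta> n" if "\<eta> \<in> space N" for \<eta> n
    using that by (simp add: N_def space_K G_def)
  moreover have "eq_in_distribution rooted_trees M X N (\<lambda>\<eta>. record_tree (\<lambda>n. \<eta> n))"
    unfolding eq_in_distribution_def
  proof (intro conjI X)
    have R: "record_tree \<in> measurable K rooted_trees"
    proof (rule meas_K)
      show "(\<lambda>\<omega>. record_tree (W \<omega>)) \<in> measurable M rooted_trees"
        using X'_meas record_W by (subst measurable_cong[where g = X']) auto
    qed (simp add: G_def space_tree_space)
    then show "(\<lambda>\<eta>. record_tree (\<lambda>n. \<eta> n)) \<in> measurable N rooted_trees"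
      by (simp add: N_def)
    have "distr N rooted_trees (\<lambda>\<eta>. record_tree (\<lambda>n. \<eta> n)) = distr M rooted_trees (\<lambda>\<omega>. record_tree (W \<omega>))"
      unfolding N_def by (subst distr_distr[OF R W_K]) (simp add: comp_def)
    also have "\<dots> = distr M rooted_trees X'"
      by (intro distr_cong refl) (simp add: record_W)
    also have "\<dots> = distr M rooted_trees X"
      by (intro distr_cong_AE refl X X'_meas)
        (use AE_Z in \<open>eventually_elim, simp add: X'_def\<close>)
    finally show "distr M rooted_trees X = distr N rooted_trees (\<lambda>\<eta>. record_tree (\<lambda>n. \<eta> n))"
      by simp
  qed
  ultimately show ?thesis
    by (intro exI[of _ N] exI[of _ "\<lambda>n \<eta>. \<eta> n"]) simp
qed

lemma AE_finite_intervals_unique_line: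
  assumes "AE \<omega> in M. holds_for unique_succession_line (X \<omega>)"
  shows "AE \<omega> in M. interval_finite_eft (T \<omega>)"
  using AE_holds_for[OF assms] AE_ordered_EFT AE_space
proof eventually_elim
  case (elim \<omega>)
  interpret ordered_tree "T \<omega>" by (rule T_facts(5)[OF elim(3)])
  show ?case
    using unique_succession_line_finite_interval[OF elim(1)] elim(2)
    by unfold_locales (auto simp: ordered_EFT_def)
qed

end

section \<open>Finiteness of descendant trees in class I/I\<close>

context random_tree
begin

lemma card_descendants_invariant:
  assumes "i < k"
  shows "invariant k (\<lambda>T os. card (descendants T n (os ! i)))"
proof -
  have "card (descendants T n (os ! i)) = card (descendants S n (ps ! i))"
    if "valid k T os" "valid k S ps" "rooted_iso T os S ps" for T S :: "nat odigraph" and os ps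
    using open_prop_invariant[OF open_prop_ancestor_descendants[OF assms, of 0 n]] that
    by (simp add: invariant_def)
  then show ?thesis
    by (simp add: invariant_def)
qed

lemma card_descendants_measurable:
  assumes "i < k"
  shows "(\<lambda>C. card (descendants (tree_of C) n (roots_of C ! i))) \<in> measurable (tree_space k) (count_space UNIV)"
proof (subst measurable_count_space_eq2_countable, intro conjI ballI)
  fix c
  have "Measurable.pred (tree_space k) (\<lambda>C. card (descendants (tree_of C) n (roots_of C ! i)) = c)"
    using open_prop_measurable[OF open_prop_ancestor_descendants[OF assms, of 0 n c]] by simp
  then show "(\<lambda>C. card (descendants (tree_of C) n (roots_of C ! i))) -` {c} \<inter> space (tree_space k)
      \<in> sets (tree_space k)"
    by (simp add: pred_def vimage_def Int_def conj_commute)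
qed auto

lemma ancestor_descendants_measurable:
  "Measurable.pred M (\<lambda>\<omega>. \<exists>w. (root \<omega>, w) \<in> arcs (T \<omega>) ^^ m \<and> card (descendants (T \<omega>) n w) = c)"
  using measurable_T[OF open_prop_measurable[OF open_prop_ancestor_descendants[of 0 1 m n c]]] by simp

lemma descendants_measurable:
  "Measurable.pred M (\<lambda>\<omega>. card (descendants (T \<omega>) n (root \<omega>)) \<noteq> 0)"
proof (rule pred_intros_logic(2))
  show "Measurable.pred M (\<lambda>\<omega>. card (descendants (T \<omega>) n (root \<omega>)) = 0)"
    using ancestor_descendants_measurable[of 0 n 0] by simp
qed

text \<open>As with \<open>offspring_seq\<close>, \<open>LEAST\<close> names the value by countably
  many measurable events without choosing an ancestor; the root itself is counted.\<close>

definition peers :: "nat \<Rightarrow> 'w \<Rightarrow> nat" where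
  "peers n \<omega> = (LEAST c. \<exists>w. (root \<omega>, w) \<in> arcs (T \<omega>) ^^ n \<and> card (descendants (T \<omega>) n w) = c)"

lemma peers_measurable: "peers n \<in> measurable M (count_space UNIV)"
  unfolding peers_def[abs_def]
  by (rule measurable_Least) (rule ancestor_descendants_measurable)

lemma peers_eq:
  assumes "\<omega> \<in> space M" "(root \<omega>, w) \<in> arcs (T \<omega>) ^^ n"
  shows "peers n \<omega> = card (descendants (T \<omega>) n w)"
proof -
  interpret ordered_tree "T \<omega>" by (rule T_facts(5)[OF assms(1)])
  have "(\<exists>v. (root \<omega>, v) \<in> arcs (T \<omega>) ^^ n \<and> card (descendants (T \<omega>) n v) = c) \<longleftrightarrow>
      card (descendants (T \<omega>) n w) = c" for c
    using assms(2) single_valued_relpow[OF sv assms(2)] by blast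
  then show ?thesis
    by (simp add: peers_def Least_equality)
qed

lemma exists_ancestor:
  assumes "ordered_EFT S" "v \<in> verts S"
  shows "\<exists>w\<in>verts S. (v, w) \<in> arcs S ^^ n"
proof (induction n)
  case (Suc n)
  then obtain w where w: "w \<in> verts S" "(v, w) \<in> arcs S ^^ n"
    by blast
  then obtain x where "(w, x) \<in> arcs S"
    using assms by (auto simp: ordered_EFT_def)
  then have "(v, x) \<in> arcs S ^^ Suc n" "x \<in> verts S"
    using w arcs_in_verts[of S w x] assms(1) by (auto simp: ordered_EFT_def)
  then show ?case
    by blast
qed (use assms in simp)

text \<open>Vertices that share an \<open>N\<close>-th ancestor share all later ones. Hence any
  \<open>c\<close> members of the foil are eventually all peers of the root.\<close>

lemma filterlim_peers:
  assumes w: "\<omega> \<in> space M" and eft: "ordered_EFT (T \<omega>)" and foil: "infinite (foil (T \<omega>) (root \<omega>))"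
  shows "filterlim (\<lambda>n. peers n \<omega>) at_top sequentially"
  unfolding filterlim_at_top
proof
  fix c
  interpret rooted_tree "T \<omega>" "[root \<omega>]" by (rule T_facts(7)[OF w])
  obtain A where A: "A \<subseteq> foil (T \<omega>) (root \<omega>)" "finite A" "card A = c"
    using infinite_arbitrarily_large[OF foil] by blast
  have "\<exists>N. \<forall>n\<ge>N. \<forall>x. (root \<omega>, x) \<in> arcs (T \<omega>) ^^ n \<longrightarrow> (v, x) \<in> arcs (T \<omega>) ^^ n" if v: "v \<in> A" for v
  proof -
    have "v \<in> foil (T \<omega>) (root \<omega>)"
      using A(1) v by blast
    then obtain N z where z: "(v, z) \<in> arcs (T \<omega>) ^^ N" "(root \<omega>, z) \<in> arcs (T \<omega>) ^^ N"
      unfolding foil_def by blast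
    have "(v, x) \<in> arcs (T \<omega>) ^^ n" if "n \<ge> N" "(root \<omega>, x) \<in> arcs (T \<omega>) ^^ n" for n x
    proof -
      have "(z, x) \<in> arcs (T \<omega>) ^^ (n - N)"
        using single_valued_relpow_diff[OF sv z(2) that(2,1)] .
      then have "(v, x) \<in> arcs (T \<omega>) ^^ (N + (n - N))"
        using z(1) unfolding relpow_add by blast
      then show ?thesis
        using that(1) by simp
    qed
    then show ?thesis by blast
  qed
  then obtain N where N: "\<And>v n x. \<lbrakk>v \<in> A; n \<ge> N v; (root \<omega>, x) \<in> arcs (T \<omega>) ^^ n\<rbrakk> \<Longrightarrow> (v, x) \<in> arcs (T \<omega>) ^^ n"
    by metis
  have "c \<le> peers n \<omega>" if n: "n \<ge> Max (N ` A)" for n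
  proof -
    obtain x where x: "x \<in> verts (T \<omega>)" "(root \<omega>, x) \<in> arcs (T \<omega>) ^^ n"
      using exists_ancestor[OF eft T_facts(6)[OF w]] by blast
    have "N v \<le> n" if "v \<in> A" for v
      using that n A(2) by (meson Max_ge finite_imageI imageI order_trans)
    then have "A \<subseteq> descendants (T \<omega>) n x"
      using N x(2) by (auto simp: descendants_def)
    then have "card A \<le> card (descendants (T \<omega>) n x)"
      using finite_descendants[OF x(1)] by (intro card_mono) auto
    then show ?thesis
      using A(3) peers_eq[OF w x(2)] by simp
  qed
  then show "\<forall>\<^sub>F n in sequentially. c \<le> peers n \<omega>"
    by (auto simp: eventually_sequentially)
qed

text \<open>Every vertex spreads mass \<open>1\<close> over its \<open>n\<close>-th descendants: the probability that the root has
  any is the expected reciprocal of the number of vertices sharing its \<open>n\<close>-th ancestor.\<close>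

lemma emeasure_descendants_eq_peers:
  "emeasure M {\<omega> \<in> space M. card (descendants (T \<omega>) n (root \<omega>)) \<noteq> 0} =
    (\<integral>\<^sup>+ \<omega>. ennreal (1 / real (peers n \<omega>)) \<partial>M)"
proof -
  \<comment> \<open>The vertex \<open>os ! 1\<close> is the one spreading mass: each member
    \<open>os ! 0\<close> of its \<open>n\<close>-th generation gets an equal share.\<close>
  let ?H = "\<lambda>T os. of_bool ((os ! 0, os ! 1) \<in> arcs T ^^ n) * ennreal (1 / real (card (descendants T n (os ! 1))))"
  have op: "open_prop 2 (\<lambda>T os. (os ! 0, os ! 1) \<in> arcs T ^^ n)"
    by (rule open_prop_relpow) auto
  have inv: "invariant 2 ?H"
    using open_prop_invariant[OF op] card_descendants_invariant[of 1 2 n] unfolding invariant_def by simp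
  have "(\<lambda>C. ennreal (1 / real (card (descendants (tree_of C) n (roots_of C ! 1)))))
      \<in> borel_measurable (tree_space 2)"
    by (rule measurable_compose[OF card_descendants_measurable]) simp_all
  then have "(\<lambda>C. if (roots_of C ! 0, roots_of C ! 1) \<in> arcs (tree_of C) ^^ n
        then ennreal (1 / real (card (descendants (tree_of C) n (roots_of C ! 1)))) else 0)
      \<in> borel_measurable (tree_space 2)"
    using open_prop_measurable[OF op] by (intro measurable_If) (simp_all add: pred_def)
  moreover have "(\<lambda>C. ?H (tree_of C) (roots_of C)) = (\<lambda>C. if (roots_of C ! 0, roots_of C ! 1) \<in> arcs (tree_of C) ^^ n
        then ennreal (1 / real (card (descendants (tree_of C) n (roots_of C ! 1)))) else 0)"
    by (simp add: fun_eq_iff)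
  ultimately have meas: "(\<lambda>C. ?H (tree_of C) (roots_of C)) \<in> borel_measurable (tree_space 2)"
    by simp
  have pred: "Measurable.pred M (\<lambda>\<omega>. card (descendants (T \<omega>) n (root \<omega>)) \<noteq> 0)"
    by (rule descendants_measurable)
  have "(\<integral>\<^sup>+ \<omega>. (\<integral>\<^sup>+ u. ?H (T \<omega>) [root \<omega>, u] \<partial>count_space (verts (T \<omega>))) \<partial>M) =
      (\<integral>\<^sup>+ \<omega>. ennreal (1 / real (peers n \<omega>)) \<partial>M)"
  proof (rule nn_integral_cong_AE)
    show "AE \<omega> in M. (\<integral>\<^sup>+ u. ?H (T \<omega>) [root \<omega>, u] \<partial>count_space (verts (T \<omega>))) = ennreal (1 / real (peers n \<omega>))"
      using AE_ordered_EFT AE_space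
    proof eventually_elim
      case (elim \<omega>)
      interpret ordered_tree "T \<omega>" by (rule T_facts(5)[OF elim(2)])
      obtain x where x: "x \<in> verts (T \<omega>)" "(root \<omega>, x) \<in> arcs (T \<omega>) ^^ n"
        using exists_ancestor[OF elim(1) T_facts(6)[OF elim(2)]] by blast
      have "(\<integral>\<^sup>+ u. ?H (T \<omega>) [root \<omega>, u] \<partial>count_space (verts (T \<omega>))) =
          (\<integral>\<^sup>+ u. of_bool ((root \<omega>, u) \<in> arcs (T \<omega>) ^^ n) * ennreal (1 / real (peers n \<omega>)) \<partial>count_space (verts (T \<omega>)))"
      proof (rule nn_integral_cong)
        fix u
        show "?H (T \<omega>) [root \<omega>, u] =
            of_bool ((root \<omega>, u) \<in> arcs (T \<omega>) ^^ n) * ennreal (1 / real (peers n \<omega>))"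
          using peers_eq[OF elim(2), of u n] by (cases "(root \<omega>, u) \<in> arcs (T \<omega>) ^^ n") simp_all
      qed
      also have "\<dots> = (\<integral>\<^sup>+ u. of_bool ((root \<omega>, u) \<in> arcs (T \<omega>) ^^ n) \<partial>count_space (verts (T \<omega>))) *
          ennreal (1 / real (peers n \<omega>))"
        by (rule nn_integral_multc) simp
      also have "(\<integral>\<^sup>+ u. of_bool ((root \<omega>, u) \<in> arcs (T \<omega>) ^^ n) \<partial>count_space (verts (T \<omega>))) = 1"
        using x by (subst nn_integral_count_unique[where v = x])
          (simp_all add: single_valued_relpow[OF sv _ x(2)])
      finally show ?case by simp
    qed
  qed
  moreover have "(\<integral>\<^sup>+ \<omega>. (\<integral>\<^sup>+ u. ?H (T \<omega>) [u, root \<omega>] \<partial>count_space (verts (T \<omega>))) \<partial>M) =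
      (\<integral>\<^sup>+ \<omega>. of_bool (card (descendants (T \<omega>) n (root \<omega>)) \<noteq> 0) \<partial>M)"
  proof (rule nn_integral_cong)
    fix \<omega> assume w: "\<omega> \<in> space M"
    interpret rooted_tree "T \<omega>" "[root \<omega>]" by (rule T_facts(7)[OF w])
    let ?d = "card (descendants (T \<omega>) n (root \<omega>))"
    have D: "{u \<in> verts (T \<omega>). (u, root \<omega>) \<in> arcs (T \<omega>) ^^ n} = descendants (T \<omega>) n (root \<omega>)"
      "finite (descendants (T \<omega>) n (root \<omega>))"
      using finite_descendants[OF T_facts(6)[OF w], of n] by (auto simp: descendants_def)
    have "(\<integral>\<^sup>+ u. ?H (T \<omega>) [u, root \<omega>] \<partial>count_space (verts (T \<omega>))) =
        (\<integral>\<^sup>+ u. of_bool ((u, root \<omega>) \<in> arcs (T \<omega>) ^^ n) \<partial>count_space (verts (T \<omega>))) * ennreal (1 / real ?d)"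
      by (subst nn_integral_multc[symmetric]) simp_all
    also have "\<dots> = of_nat ?d * ennreal (1 / real ?d)"
      using D by (subst nn_integral_count_of_bool) simp_all
    \<comment> \<open>For \<open>?d = 0\<close> the product is \<open>0\<close>; otherwise
      \<open>?d\<close> shares of \<open>1 / ?d\<close> add up to \<open>1\<close>.\<close>
    also have "\<dots> = of_bool (?d \<noteq> 0)"
      by (simp add: ennreal_of_nat_eq_real_of_nat ennreal_mult'[symmetric])
    finally show "(\<integral>\<^sup>+ u. ?H (T \<omega>) [u, root \<omega>] \<partial>count_space (verts (T \<omega>))) = of_bool (?d \<noteq> 0)" .
  qed
  ultimately show ?thesis
    using mass_transport[OF inv meas] nn_integral_of_bool[OF pred] by simp
qed

text \<open>Dominated convergence sends the expected reciprocals to 0. Survival of every generation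
  is contained in survival of the \<open>n\<close>-th one for each \<open>n\<close>, so its
  probability is 0.\<close>

lemma AE_descendants_die_out:
  assumes foils: "AE \<omega> in M. infinite (foil (T \<omega>) (root \<omega>))"
  shows "AE \<omega> in M. \<exists>n. card (descendants (T \<omega>) n (root \<omega>)) = 0"
proof -
  have pred: "Measurable.pred M (\<lambda>\<omega>. card (descendants (T \<omega>) n (root \<omega>)) \<noteq> 0)" for n
    by (rule descendants_measurable)
  have "(\<lambda>n. \<integral>\<^sup>+ \<omega>. ennreal (1 / real (peers n \<omega>)) \<partial>M) \<longlonglongrightarrow> (\<integral>\<^sup>+ \<omega>. 0 \<partial>M)"
  proof (rule nn_integral_dominated_convergence[where w = "\<lambda>_. 1"])
    show "AE \<omega> in M. (\<lambda>n. ennreal (1 / real (peers n \<omega>))) \<longlonglongrightarrow> 0"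
      using foils AE_ordered_EFT AE_space
    proof eventually_elim
      case (elim \<omega>)
      have "filterlim (\<lambda>n. real (peers n \<omega>)) at_top sequentially"
        by (rule filterlim_compose[OF filterlim_real_sequentially filterlim_peers[OF elim(3,2,1)]])
      then have "(\<lambda>n. 1 / real (peers n \<omega>)) \<longlonglongrightarrow> 0"
        by (intro tendsto_divide_0[OF tendsto_const] filterlim_at_top_imp_at_infinity)
      then have "(\<lambda>n. ennreal (1 / real (peers n \<omega>))) \<longlonglongrightarrow> ennreal 0"
        by (rule tendsto_ennrealI)
      then show ?case by simp
    qed
    show "AE \<omega> in M. ennreal (1 / real (peers n \<omega>)) \<le> 1" for n
    proof (rule AE_I2)
      fix \<omega>
      \<comment> \<open>Division by zero gives \<open>0\<close>, so the bound also holds where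
        \<open>peers\<close> vanishes.\<close>
      have "1 / real (peers n \<omega>) \<le> 1"
        by (cases "peers n \<omega> = 0") simp_all
      then show "ennreal (1 / real (peers n \<omega>)) \<le> 1"
        by (metis ennreal_1 ennreal_leI)
    qed
    show "(\<lambda>\<omega>. ennreal (1 / real (peers n \<omega>))) \<in> borel_measurable M" for n
      using peers_measurable[of n] by measurable
  qed (simp_all add: emeasure_space_1)
  then have lim: "(\<lambda>n. emeasure M {\<omega> \<in> space M. card (descendants (T \<omega>) n (root \<omega>)) \<noteq> 0}) \<longlonglongrightarrow> 0"
    unfolding emeasure_descendants_eq_peers by simp
  have "emeasure M {\<omega> \<in> space M. \<forall>n. card (descendants (T \<omega>) n (root \<omega>)) \<noteq> 0} \<le>
      emeasure M {\<omega> \<in> space M. card (descendants (T \<omega>) n (root \<omega>)) \<noteq> 0}" for n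
    using pred[of n] by (intro emeasure_mono) (auto simp: pred_def)
  then have "emeasure M {\<omega> \<in> space M. \<forall>n. card (descendants (T \<omega>) n (root \<omega>)) \<noteq> 0} \<le> 0"
    by (intro LIMSEQ_le_const[OF lim]) blast
  moreover have "Measurable.pred M (\<lambda>\<omega>. \<forall>n. card (descendants (T \<omega>) n (root \<omega>)) \<noteq> 0)"
    using pred by (rule pred_intros_countable)
  ultimately show ?thesis
    using AE_iff_measurable[of "{\<omega> \<in> space M. \<forall>n. card (descendants (T \<omega>) n (root \<omega>)) \<noteq> 0}" M
        "\<lambda>\<omega>. \<exists>n. card (descendants (T \<omega>) n (root \<omega>)) = 0"] by (simp add: pred_def)
qed

text \<open>Let each vertex send mass 1 to its \<open>m\<close>-th ancestor if that ancestor has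
  descendants in every generation. Mass can be received only by a root that has them itself, which
  is a null event; so almost surely none is sent either.\<close>

lemma AE_ancestor_descendants_die_out:
  assumes die: "AE \<omega> in M. \<exists>n. card (descendants (T \<omega>) n (root \<omega>)) = 0"
  shows "AE \<omega> in M. \<forall>m w. (root \<omega>, w) \<in> arcs (T \<omega>) ^^ m \<longrightarrow> (\<exists>n. card (descendants (T \<omega>) n w) = 0)"
proof -
  have "AE \<omega> in M. \<forall>w. (root \<omega>, w) \<in> arcs (T \<omega>) ^^ m \<longrightarrow> (\<exists>n. card (descendants (T \<omega>) n w) = 0)" for m
  proof -
    let ?Q = "\<lambda>T os. (os ! 0, os ! 1) \<in> arcs T ^^ m \<and> (\<forall>n. card (descendants T n (os ! 1)) \<noteq> 0)"
    \<comment> \<open>Writing a nonzero cardinality as \<open>Suc c\<close> makes this a countable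
      combination of the events of \<open>ancestor_descendants_measurable\<close>.\<close>
    let ?P = "\<lambda>\<omega>. \<forall>n. \<exists>c w. (root \<omega>, w) \<in> arcs (T \<omega>) ^^ m \<and> card (descendants (T \<omega>) n w) = Suc c"
    have op: "open_prop 2 (\<lambda>T os. (os ! 0, os ! 1) \<in> arcs T ^^ m)"
      by (rule open_prop_relpow) auto
    have inv: "invariant 2 ?Q"
      using open_prop_invariant[OF op] card_descendants_invariant[of 1 2] unfolding invariant_def by simp
    have "Measurable.pred (tree_space 2) (\<lambda>C. card (descendants (tree_of C) n (roots_of C ! 1)) \<noteq> 0)" for n
      by (rule measurable_compose[OF card_descendants_measurable]) simp_all
    then have meas: "Measurable.pred (tree_space 2) (\<lambda>C. ?Q (tree_of C) (roots_of C))"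
      using open_prop_measurable[OF op] by (intro pred_intros_logic(3) pred_intros_countable(1))
    have P: "Measurable.pred M ?P"
      by (rule pred_intros_countable(1), rule pred_intros_countable(2),
          rule ancestor_descendants_measurable)
    have "(\<integral>\<^sup>+ \<omega>. (\<integral>\<^sup>+ u. of_bool (?Q (T \<omega>) [u, root \<omega>]) \<partial>count_space (verts (T \<omega>))) \<partial>M) = (\<integral>\<^sup>+ \<omega>. 0 \<partial>M)"
    proof (rule nn_integral_cong_AE)
      show "AE \<omega> in M. (\<integral>\<^sup>+ u. of_bool (?Q (T \<omega>) [u, root \<omega>]) \<partial>count_space (verts (T \<omega>))) = 0"
        using die by eventually_elim (auto simp: nn_integral_0_iff_AE)
    qed
    moreover have "(\<integral>\<^sup>+ \<omega>. (\<integral>\<^sup>+ u. of_bool (?Q (T \<omega>) [root \<omega>, u]) \<partial>count_space (verts (T \<omega>))) \<partial>M) =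
        (\<integral>\<^sup>+ \<omega>. of_bool (?P \<omega>) \<partial>M)"
    proof (rule nn_integral_cong_AE)
      show "AE \<omega> in M. (\<integral>\<^sup>+ u. of_bool (?Q (T \<omega>) [root \<omega>, u]) \<partial>count_space (verts (T \<omega>))) = of_bool (?P \<omega>)"
        using AE_ordered_EFT AE_space
      proof eventually_elim
        case (elim \<omega>)
        interpret ordered_tree "T \<omega>" by (rule T_facts(5)[OF elim(2)])
        obtain x where x: "x \<in> verts (T \<omega>)" "(root \<omega>, x) \<in> arcs (T \<omega>) ^^ m"
          using exists_ancestor[OF elim(1) T_facts(6)[OF elim(2)]] by blast
        have un: "w = x" if "(root \<omega>, w) \<in> arcs (T \<omega>) ^^ m" for w
          using single_valued_relpow[OF sv that x(2)] .
        have "(\<exists>c w. (root \<omega>, w) \<in> arcs (T \<omega>) ^^ m \<and> card (descendants (T \<omega>) n w) = Suc c) \<longleftrightarrow>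
            card (descendants (T \<omega>) n x) \<noteq> 0" (is "?L \<longleftrightarrow> ?R") for n
        proof
          show ?R if L: ?L
          proof -
            obtain c w where cw: "(root \<omega>, w) \<in> arcs (T \<omega>) ^^ m" "card (descendants (T \<omega>) n w) = Suc c"
              using L by blast
            then show ?thesis
              using un[OF cw(1)] by simp
          qed
          show ?L if ?R
            using x(2) not0_implies_Suc[OF that] by blast
        qed
        then have "?P \<omega> \<longleftrightarrow> ?Q (T \<omega>) [root \<omega>, x]"
          using x(2) by simp
        moreover have "(\<integral>\<^sup>+ u. of_bool (?Q (T \<omega>) [root \<omega>, u]) \<partial>count_space (verts (T \<omega>))) =
            of_bool (?Q (T \<omega>) [root \<omega>, x])"
          by (rule nn_integral_count_unique[OF _ x(1)]) (simp add: un)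
        ultimately show ?case
          by simp
      qed
    qed
    ultimately have "emeasure M {\<omega> \<in> space M. ?P \<omega>} = 0"
      using mass_transport_pred[OF inv meas] nn_integral_of_bool[OF P] by simp
    then have "AE \<omega> in M. \<not> ?P \<omega>"
      using AE_iff_measurable[of "{\<omega> \<in> space M. ?P \<omega>}" M "\<lambda>\<omega>. \<not> ?P \<omega>"] P by (simp add: pred_def)
    then show ?thesis
      by eventually_elim (metis not0_implies_Suc)
  qed
  then show ?thesis
    by (simp add: AE_all_countable)
qed

text \<open>An empty generation leaves only finitely many finite ones. Knowing this for all
  ancestors of the root is enough, since both ends of any interval share an ancestor with the
  root.\<close>

lemma AE_finite_intervals_class_I_I:
  assumes "AE \<omega> in M. holds_for class_I_I (X \<omega>)"
  shows "AE \<omega> in M. interval_finite_eft (T \<omega>)"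
proof -
  have "AE \<omega> in M. infinite (foil (T \<omega>) (root \<omega>))"
    using AE_holds_for[OF assms] AE_space
    by eventually_elim (use T_facts(6) in \<open>auto simp: class_I_I_def\<close>)
  from AE_ancestor_descendants_die_out[OF AE_descendants_die_out[OF this]] AE_ordered_EFT AE_space
  show ?thesis
  proof eventually_elim
    case (elim \<omega>)
    interpret rooted_tree "T \<omega>" "[root \<omega>]" by (rule T_facts(7)[OF elim(3)])
    have "finite {x. (x, w) \<in> (arcs (T \<omega>))\<^sup>*}" if rw: "(root \<omega>, w) \<in> (arcs (T \<omega>))\<^sup>*" for w
    proof -
      have wV: "w \<in> verts (T \<omega>)"
        using rtrancl_verts[OF rw] T_facts(6)[OF elim(3)] by simp
      obtain n where "card (descendants (T \<omega>) n w) = 0"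
        using elim(1) rw by (auto simp: rtrancl_power)
      then have "descendants (T \<omega>) n w = {}"
        using finite_descendants[OF wV] by simp
      then show ?thesis
        by (rule finite_below[OF ordered_tree_axioms wV])
    qed
    note fin = finite_descendants_finite_interval[OF this T_facts(6)[OF elim(3)]]
    show ?case
      using elim(2) fin by unfold_locales (auto simp: ordered_EFT_def)
  qed
qed

lemma AE_bi_infinite: "AE \<omega> in M. interval_finite_eft (T \<omega>) \<Longrightarrow> AE \<omega> in M. bi_infinite \<omega>"
  using AE_succ_line by (auto simp: bi_infinite_def)

end

theorem theorem120:
  fixes M :: "'w measure" and X :: "'w \<Rightarrow> tree_class"
  assumes "random_rooted_ordered_EFT M X"
    and "unimodular M X"
  shows "((AE \<omega> in M. holds_for unique_succession_line (X \<omega>)) \<longrightarrow>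
            (\<exists>(N :: (int \<Rightarrow> int) measure) Y.
               stationary_sequence N Y \<and> (\<forall>n. \<forall>\<eta>\<in>space N. - 1 \<le> Y n \<eta>) \<and>
               eq_in_distribution rooted_trees M X N (\<lambda>\<eta>. record_tree (\<lambda>n. Y n \<eta>)))) \<and>
         ((AE \<omega> in M. holds_for class_I_I (X \<omega>)) \<longrightarrow>
            (\<exists>(N :: (int \<Rightarrow> int) measure) Y.
               stationary_sequence N Y \<and> (\<forall>n. \<forall>\<eta>\<in>space N. - 1 \<le> Y n \<eta>) \<and>
               eq_in_distribution rooted_trees M X N (\<lambda>\<eta>. record_tree (\<lambda>n. Y n \<eta>))))"
proof -
  interpret random_tree M X
    using assms by (simp add: random_tree_def random_tree_axioms_def random_rooted_ordered_EFT_def)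
  show ?thesis
    by (intro conjI impI representation AE_bi_infinite)
      (rule AE_finite_intervals_unique_line AE_finite_intervals_class_I_I, assumption)+
qed

end
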